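(* Let $\zeta\in(-1/2,\infty)$ and $\alpha\in(0,2]$. In what follows, $f\lesssim_{p} g$ means $f\le Kg$ for a constant $K\in(0,\infty)$ depending only on the listed parameters $p$ (and not on the variables $r,s,z,t,\tau$), and $f\sim_p g$ means $f\lesssim_p g\lesssim_p f$. \begin{enumerate} \item Let $0<C\le1$. There are constants $c_1,c_2>0$ depending only on $\zeta$ and $C$ such that for all $z,s>0$ and $\tau\in[C,C^{-1}]$, \[ p_\zeta^{(2)}(1,c_1z,c_1s)\lesssim_{C,\zeta}p_\zeta^{(2)}(\tau,z,s)\lesssim_{C,\zeta}p_\zeta^{(2)}(1,c_2z,c_2s), \] and, if $\alpha<2$, $p_\zeta^{(\alpha)}(\tau,z,s)\sim_{C,\zeta,\alpha}p_\zeta^{(\alpha)}(1,z,s)$. In particular, for $\alpha\in(0,2)$ and all $\tau,z,s,c>0$: $p_\zeta^{(\alpha)}(\tau,cz,cs)\sim_{\zeta,\alpha,c}p_\zeta^{(\alpha)}(\tau,z,s)$ and $p_\zeta^{(\alpha)}(c\tau,z,s)\sim_{\zeta,\alpha,c}p_\zeta^{(\alpha)}(\tau,z,s)$. \item Let $C>0$. There is $c>0$ depending only on $\zeta$ and $C$ such that for all $\tau>0$ and $0<z\le s/2$: \[ p_\zeta^{(\alpha)}(\tau,z,s)\lesssim_{C,\zeta,\alpha}p_\zeta^{(\alpha)}(\tau,c,cs)\mathbf{1}_{\{\tau>C\}}+\Big(\tau^{-1/2}\frac{e^{-cs^2/\tau}}{(\tau+s^2)^{\zeta}}\mathbf{1}_{\alpha=2}+\frac{\tau}{s^{2\zeta+1+\alpha}+\tau^{\frac{2\zeta+1+\alpha}{\alpha}}}\mathbf{1}_{\alpha\in(0,2)}\Big)\mathbf{1}_{\{\tau<C\}},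 \] \[ p_\zeta^{(\alpha)}(\tau,z,s)\lesssim_{\zeta,\alpha}\tau^{-1/2}\frac{e^{-cs^2/\tau}}{(\tau+s^2)^{\zeta}}\mathbf{1}_{\alpha=2}+\frac{\tau}{s^{2\zeta+1+\alpha}+\tau^{(2\zeta+1+\alpha)/\alpha}}\mathbf{1}_{\alpha\in(0,2)}, \] \[ p_\zeta^{(\alpha)}(\tau,z,s)\lesssim_{\zeta,\alpha}s^{-(2\zeta+1)}. \] \item Let $C>0$. There is $c>0$ depending only on $\zeta$ and $C$ such that for all $0<\tau\le1$, $0<z\le s/2$ with $s\ge C$: $p_\zeta^{(\alpha)}(\tau,z,s)\lesssim_{C,\zeta,\alpha}p_\zeta^{(\alpha)}(1,c,cs)$. \item There is $c>0$ depending only on $\zeta$ and $\alpha$ such that for all $0<r\le s$: $p_\zeta^{(\alpha)}(1,1,s)\lesssim_{\zeta,\alpha}p_\zeta^{(\alpha)}(1,cr,cs)$. In particular, for all $r,s>0$: $\min\{p_\zeta^{(\alpha)}(1,1,r),p_\zeta^{(\alpha)}(1,1,s)\}\lesssim_{\zeta,\alpha}p_\zeta^{(\alpha)}(1,cr,cs)$. \item There is $c>0$ depending only on $\zeta$ and $\alpha$ such that for all $r,s,z,t>0$ with $|z-s|>|r-s|/2$: $p_\zeta^{(\alpha)}(t,z,s)\lesssim_{\zeta,\alpha}p_\zeta^{(\alpha)}(t,cr,cs)$. \end{enumerate}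
   Context: For $\nu\in\mathbb{C}$, $I_\nu$ is the modified Bessel function of the first kind. For $\zeta\in(-1/2,\infty)$, $p_\zeta^{(2)}(t,r,s):=\frac{(rs)^{1/2-\zeta}}{2t}\exp\big(-\frac{r^2+s^2}{4t}\big)I_{\zeta-1/2}\big(\frac{rs}{2t}\big)$ for $r,s,t>0$. For $\alpha\in(0,2)$ and $t>0$, $\sigma_t^{(\alpha/2)}$ is the probability density on $(0,\infty)$ with $e^{-t\lambda^{\alpha/2}}=\int_0^\infty e^{-\tau\lambda}\sigma_t^{(\alpha/2)}(\tau)\,d\tau$ for $\lambda\ge0$, and $p_\zeta^{(\alpha)}(t,r,s):=\int_0^\infty p_\zeta^{(2)}(\tau,r,s)\sigma_t^{(\alpha/2)}(\tau)\,d\tau$. $\mathbf{1}$ denotes an indicator. The constants $c$ in distinct parts (and distinct displayed inequalities) may differ.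
   Formalization: In the first bound of part 2 the indicator of τ>C is replaced by that of τ≥C, because at τ=C both indicators in the original vanish and the bound would read that a positive kernel is at most 0. *)

theory Defs
  imports "HOL-Analysis.Analysis"
begin

definition bessel_I :: "real \<Rightarrow> real \<Rightarrow> real" where
  "bessel_I \<nu> x = (\<Sum>k. (x / 2) powr (2 * real k + \<nu>) / (fact k * Gamma (real k + \<nu> + 1)))"

definition p2 :: "real \<Rightarrow> real \<Rightarrow> real \<Rightarrow> real \<Rightarrow> real" where
  "p2 \<zeta> t r s = (r * s) powr (1/2 - \<zeta>) / (2 * t) * exp (- (r^2 + s^2) / (4 * t))
                   * bessel_I (\<zeta> - 1/2) (r * s / (2 * t))"

text \<open>Density sigma_t^(alpha/2) of the (alpha/2)-stable subordinator on (0,infinity),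
  characterised by its Laplace transform (chosen by Hilbert choice; it is
  unique up to null sets, which does not affect the subordinated kernel).\<close>
definition stable_density :: "real \<Rightarrow> real \<Rightarrow> real \<Rightarrow> real" where
  "stable_density \<alpha> t = (SOME f. f \<in> borel_measurable lborel \<and> (\<forall>\<tau>. 0 \<le> f \<tau>) \<and>
      set_integrable lborel {0<..} f \<and>
      (\<forall>l\<ge>0. exp (- t * l powr (\<alpha> / 2)) = (LINT \<tau>:{0<..}|lborel. exp (- \<tau> * l) * f \<tau>)))"

definition p_alpha :: "real \<Rightarrow> real \<Rightarrow> real \<Rightarrow> real \<Rightarrow> real \<Rightarrow> real" where
  "p_alpha \<zeta> \<alpha> t r s = (if \<alpha> = 2 then p2 \<zeta> t r s
     else (LINT \<tau>:{0<..}|lborel. p2 \<zeta> \<tau> r s * stable_density \<alpha> t \<tau>))"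

definition ind :: "bool \<Rightarrow> real" where
  "ind P = (if P then 1 else 0)"

end

theory Submission
  imports Defs "HOL-Probability.Probability" "HOL-Real_Asymp.Real_Asymp"
begin

text \<open>
  Everything follows from two-sided bounds of the kernels by elementary functions. The coefficients of
  the Bessel series are comparable to those of \<open>\<Sum>k. w ^ (2 * k) / fact (2 * k) * (2 * k + 1) powr - \<zeta>\<close>,
  a moment of a Poisson-like law concentrated near \<open>w\<close>; this gives
  \<open>p2 \<zeta> t r s \<sim> t powr (-1/2) * (t + r * s) powr - \<zeta> * exp (- (r - s)\<^sup>2 / (4 * t))\<close>.

  For \<open>\<alpha> < 2\<close> the subordinated kernel is estimated from the Laplace transform
  \<open>exp (- t * l powr (\<alpha> / 2))\<close> of the subordinator alone: the heat kernel is compared pointwise with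
  combinations of \<open>1 - exp (- l * \<tau>)\<close> and with negative powers of \<open>\<tau>\<close>, whose expectations are
  explicit. With \<open>T = t powr (2 / \<alpha>)\<close> the result is
  \<open>p_alpha \<zeta> \<alpha> t r s \<sim> t * (T + (r - s)\<^sup>2) powr (- (1 + \<alpha>) / 2) * (T + (r + s)\<^sup>2) powr - \<zeta>\<close>.

  As the subordinator density is given by Hilbert choice, its existence has to be shown. Sums of
  independent Sibuya variables (generating function \<open>1 - (1 - z) powr \<beta>\<close>), rescaled, are tight and
  have Laplace transforms tending to \<open>exp (- t * l powr \<beta>)\<close>. A weak limit \<open>\<mu>\<close> satisfies
  \<open>x \<mu>(dx) = (k * \<mu>)(x) dx\<close> with \<open>k x = t * \<beta> / Gamma (1 - \<beta>) * x powr - \<beta>\<close>, which exhibits a density.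
\<close>

section \<open>Existence of the stable density\<close>

text \<open>The density in the definition is picked by \<open>SOME\<close>, so only the properties
  in the choice predicate are available, and these only after some function is shown to have them.
  Hence every estimate starts from functions whose expectation follows from the Laplace transform,
  with constants uniform in the time. The exponent -\<zeta> has no fixed sign, so factors carrying
  it are compared from both sides. The hypothesis \<zeta> > -1/2 enters through 1/2 + \<zeta>, which
  must be positive as an argument of Gamma and as the order of a negative moment. The contraction
  factors 1/32, 1/2 and 1/4 come from Gaussian bookkeeping: part of the exponent pays for polynomial
  factors, and the points must be contracted far enough for the remainder to dominate the Gaussian
  of the target. They depend neither on \<zeta> nor on \<alpha>. Without a Gaussian, for \<alpha> <
  2, the same factors work by comparing quadratic polynomials. The inequality for separated points
  holds for the heat kernel at all times with one constant and is integrated against the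
  subordinator. The others restrict the time or change it, and are proved for each comparison kernel
  separately.\<close>

definition sibuya_coeff :: "real \<Rightarrow> nat \<Rightarrow> real" where
  "sibuya_coeff \<beta> k = (if k = 0 then 0 else (-1) ^ (k + 1) * (\<beta> gchoose k))"

lemma zero_le_mult_imp_nonneg: "0 \<le> m * x \<Longrightarrow> 0 < m \<Longrightarrow> 0 \<le> x" for m x :: real
  by (simp add: zero_le_mult_iff)

text \<open>Passing from one generalized binomial coefficient to the next multiplies by (\<beta> -
  k) / (k + 1), which is negative from k = 1 on because \<beta> < 1. The signs therefore alternate
  after the first coefficient \<beta> > 0, and the sign in the definition compensates this.\<close>

lemma sibuya_coeff_nonneg:
  assumes "0 < \<beta>" "\<beta> < 1"
  shows "0 \<le> sibuya_coeff \<beta> k"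
proof -
  have "0 \<le> (-1) ^ k * (\<beta> gchoose Suc k)" for k
  proof (induction k)
    case 0
    then show ?case using assms by simp
  next
    case (Suc k)
    have *: "\<beta> * u = n * u + m * v \<Longrightarrow> m * (- w * v) = (n - \<beta>) * (w * u)" for u v w m n :: real
      by algebra
    have "real (Suc (Suc k)) * (- ((-1) ^ k) * (\<beta> gchoose Suc (Suc k)))
        = (real (Suc k) - \<beta>) * ((-1) ^ k * (\<beta> gchoose Suc k))"
      by (rule *[OF gbinomial_mult_1])
    also have "\<dots> \<ge> 0"
      using assms by (intro mult_nonneg_nonneg[OF _ Suc.IH]) auto
    finally have "0 \<le> - ((-1) ^ k) * (\<beta> gchoose Suc (Suc k))"
      by (rule zero_le_mult_imp_nonneg) simp
    then show ?case by simp
  qed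
  from this[of "k - 1"] show ?thesis
    by (cases k) (auto simp: sibuya_coeff_def)
qed

lemma sibuya_coeff_sums:
  assumes "0 \<le> z" "z < 1"
  shows "(\<lambda>k. sibuya_coeff \<beta> k * z ^ k) sums (1 - (1 - z) powr \<beta>)"
proof -
  have "(\<lambda>n. (\<beta> gchoose n) * (- z) ^ n) sums (1 + (- z)) powr \<beta>"
    using assms by (intro gen_binomial_real) auto
  then have "(\<lambda>n. (if n = 0 then 1 else 0) - (\<beta> gchoose n) * (- z) ^ n) sums (1 - (1 + (- z)) powr \<beta>)"
    by (intro sums_diff sums_single[of 0 "\<lambda>_. 1", simplified]) auto
  moreover have "(if n = 0 then 1 else 0) - (\<beta> gchoose n) * (- z) ^ n = sibuya_coeff \<beta> n * z ^ n" for n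
    by (auto simp: sibuya_coeff_def power_minus[of z])
  ultimately show ?thesis by simp
qed

text \<open>An Abel-type argument, since the binomial series is used only for z < 1. Letting z tend
  to 1 in finite sums bounds the partial sums by 1. Conversely, nonnegativity makes the total at
  least the value at each z < 1, and these values tend to 1.\<close>

lemma sibuya_coeff_sums_1:
  assumes "0 < \<beta>" "\<beta> < 1"
  shows "sibuya_coeff \<beta> sums 1"
proof -
  have nn: "0 \<le> sibuya_coeff \<beta> k" for k
    using sibuya_coeff_nonneg assms by auto
  have part: "(\<Sum>k<n. sibuya_coeff \<beta> k) \<le> 1" for n
  proof -
    have "((\<lambda>z. \<Sum>k<n. sibuya_coeff \<beta> k * z ^ k) \<longlongrightarrow> (\<Sum>k<n. sibuya_coeff \<beta> k * 1 ^ k)) (at_left 1)"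
      by (intro tendsto_intros)
    moreover have "\<forall>\<^sub>F z in at_left (1::real). (\<Sum>k<n. sibuya_coeff \<beta> k * z ^ k) \<le> 1"
    proof -
      have "\<forall>\<^sub>F z in at_left (1::real). z \<in> {0<..<1}"
        by (rule eventually_at_left_real) simp
      then show ?thesis
      proof eventually_elim
        case (elim z)
        then have *: "(\<lambda>k. sibuya_coeff \<beta> k * z ^ k) sums (1 - (1 - z) powr \<beta>)"
          using sibuya_coeff_sums[of z \<beta>] by simp
        have "(\<Sum>k<n. sibuya_coeff \<beta> k * z ^ k) \<le> (\<Sum>k. sibuya_coeff \<beta> k * z ^ k)"
          using elim nn by (intro sum_le_suminf sums_summable[OF *]) auto
        also have "\<dots> = 1 - (1 - z) powr \<beta>"
          using * by (rule sums_unique[symmetric])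
        finally have "(\<Sum>k<n. sibuya_coeff \<beta> k * z ^ k) \<le> 1 - (1 - z) powr \<beta>" .
        then show ?case
          using powr_ge_zero[of "1 - z" \<beta>] by linarith
      qed
    qed
    ultimately show ?thesis
      by (intro tendsto_upperbound[where F = "at_left (1::real)"]) auto
  qed
  have sm: "summable (sibuya_coeff \<beta>)"
    by (rule summableI_nonneg_bounded[where x = 1]) (use nn part in auto)
  have "suminf (sibuya_coeff \<beta>) \<le> 1"
    by (rule suminf_le_const[OF sm part])
  moreover have "1 \<le> suminf (sibuya_coeff \<beta>)"
  proof -
    have "((\<lambda>z. 1 - (1 - z) powr \<beta>) \<longlongrightarrow> 1 - 0) (at_left (1::real))"
      using assms by (intro tendsto_diff tendsto_const) real_asymp
    moreover have "\<forall>\<^sub>F z in at_left (1::real). 1 - (1 - z) powr \<beta> \<le> suminf (sibuya_coeff \<beta>)"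
    proof -
      have "\<forall>\<^sub>F z in at_left (1::real). z \<in> {0<..<1}"
        by (rule eventually_at_left_real) simp
      then show ?thesis
      proof eventually_elim
        case (elim z)
        have *: "(\<lambda>k. sibuya_coeff \<beta> k * z ^ k) sums (1 - (1 - z) powr \<beta>)"
          using sibuya_coeff_sums[of z \<beta>] elim by simp
        have "sibuya_coeff \<beta> k * z ^ k \<le> sibuya_coeff \<beta> k" for k
          using nn[of k] elim by (intro mult_right_le_one_le) (auto intro: power_le_one)
        then show ?case
          by (intro sums_le[OF _ * summable_sums[OF sm]])
      qed
    qed
    ultimately show ?thesis
      by (intro tendsto_upperbound[where F = "at_left (1::real)"]) auto
  qed
  ultimately have "suminf (sibuya_coeff \<beta>) = 1" by (rule order_antisym)
  then show ?thesis using summable_sums[OF sm] by simp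
qed

lemma exists_sibuya_pmf:
  assumes "0 < \<beta>" "\<beta> < 1"
  shows "\<exists>p::nat pmf. \<forall>z. 0 \<le> z \<and> z < 1 \<longrightarrow> (\<integral>\<^sup>+k. ennreal (z ^ k) \<partial>p) = ennreal (1 - (1 - z) powr \<beta>)"
proof -
  define p where "p = embed_pmf (sibuya_coeff \<beta>)"
  have nn: "0 \<le> sibuya_coeff \<beta> k" for k
    using sibuya_coeff_nonneg assms by auto
  have "(\<integral>\<^sup>+k. ennreal (sibuya_coeff \<beta> k) \<partial>count_space UNIV) = 1"
    using sibuya_coeff_sums_1[OF assms] nn
    by (simp add: nn_integral_count_space_nat suminf_ennreal2 sums_iff)
  then have pmf: "pmf p k = sibuya_coeff \<beta> k" for k
    using nn unfolding p_def by (intro pmf_embed_pmf) auto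
  have "(\<integral>\<^sup>+k. ennreal (z ^ k) \<partial>p) = ennreal (1 - (1 - z) powr \<beta>)" if "0 \<le> z \<and> z < 1" for z
    using sibuya_coeff_sums[of z \<beta>] nn that
    by (simp add: nn_integral_measure_pmf pmf nn_integral_count_space_nat ennreal_mult[symmetric]
      suminf_ennreal2 sums_iff)
  then show ?thesis by auto
qed

section \<open>Rescaled sums of Sibuya variables and their weak limit\<close>

primrec iid_sum :: "nat pmf \<Rightarrow> nat \<Rightarrow> nat pmf" where
  "iid_sum p 0 = return_pmf 0"
| "iid_sum p (Suc n) = bind_pmf p (\<lambda>x. map_pmf ((+) x) (iid_sum p n))"

lemma nn_integral_iid_sum:
  assumes "0 \<le> z"
  shows "(\<integral>\<^sup>+k. ennreal (z ^ k) \<partial>iid_sum p n) = (\<integral>\<^sup>+k. ennreal (z ^ k) \<partial>p) ^ n"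
  using assms
  by (induction n) (auto simp: power_add ennreal_mult nn_integral_cmult nn_integral_multc)

text \<open>The step size \<open>(t / real n) powr (1 / \<beta>)\<close> is chosen so that
  \<open>(1 - exp (- l * e)) powr \<beta>\<close> is asymptotic to t l^\<beta> / n; the expression
  is then of the form (1 - x/n + o(1/n))^n.\<close>

lemma LIMSEQ_sibuya:
  fixes \<beta> t l :: real
  assumes "0 < \<beta>" "\<beta> < 1" "0 < t" "0 < l"
  shows "(\<lambda>n. (1 - (1 - exp (- l * (t / real n) powr (1 / \<beta>))) powr \<beta>) ^ n) \<longlonglongrightarrow> exp (- t * l powr \<beta>)"
proof -
  have "(l * t powr (1 / \<beta>)) powr \<beta> = t * l powr \<beta>"
    using assms by (simp add: powr_mult powr_powr)
  moreover have "(\<lambda>n. (1 - (1 - exp (- l * (t / real n) powr (1 / \<beta>))) powr \<beta>) ^ n)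
      \<longlonglongrightarrow> exp (- ((l * t powr (1 / \<beta>)) powr \<beta>))"
    using assms by real_asymp
  ultimately show ?thesis by simp
qed

text \<open>Makes 1 - exp(-l x) a substitute for the truncation min(1, l x). The latter is what tail
  and moment estimates need, while the former has an expectation given by the Laplace transform. The
  bound comes from exp(-x) \<le> 1 / (1 + x).\<close>

lemma one_minus_exp_minus_ge:
  fixes x :: real
  assumes "0 \<le> x"
  shows "min 1 x \<le> 2 * (1 - exp (- x))"
proof -
  have "exp (- x) = 1 / exp x" by (simp add: exp_minus field_simps)
  also have "\<dots> \<le> 1 / (1 + x)"
    using assms exp_ge_add_one_self[of x] by (intro divide_left_mono) auto
  finally have "1 - exp (- x) \<ge> x / (1 + x)" using assms by (simp add: field_simps)
  moreover have "min 1 x \<le> 2 * (x / (1 + x))"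
    using assms by (auto simp: min_def field_simps) (smt (verit) mult_left_le_one_le)
  ultimately show ?thesis by (smt (verit))
qed

text \<open>The test function is \<open>exp (- l * max 0 x)\<close> because weak convergence on the
  real line asks for bounded continuous functions on all of it. On the approximating laws, which
  live on the nonnegative half-line, the truncation changes nothing, and the limit law is only ever
  integrated through \<open>max 0 x\<close>.\<close>

lemma exists_stable_law:
  fixes \<beta> t :: real
  assumes \<beta>: "0 < \<beta>" "\<beta> < 1" and t: "0 < t"
  shows "\<exists>M. real_distribution M \<and> (\<forall>l>0. (LINT x|M. exp (- l * max 0 x)) = exp (- t * l powr \<beta>))"
proof -
  obtain p :: "nat pmf" where p: "\<And>z. 0 \<le> z \<Longrightarrow> z < 1 \<Longrightarrow> (\<integral>\<^sup>+k. ennreal (z ^ k) \<partial>p) = ennreal (1 - (1 - z) powr \<beta>)"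
    using exists_sibuya_pmf[OF \<beta>] by blast
  define e where "e n = (t / real n) powr (1 / \<beta>)" for n
  have e0: "0 \<le> e n" for n by (simp add: e_def)
  define M where "M n = distr (measure_pmf (iid_sum p n)) borel (\<lambda>k. e n * real k)" for n
  have rd: "real_distribution (M n)" for n
    unfolding M_def by (intro real_distribution.intro real_distribution_axioms.intro prob_space.prob_space_distr)
      (auto simp: measure_pmf.prob_space_axioms)
  define \<phi> where "\<phi> n l = (1 - (1 - exp (- l * e n)) powr \<beta>) ^ n" for n l
  have lap_n: "(LINT x|M n. exp (- l * max 0 x)) = \<phi> n l" if l: "0 < l" and n: "0 < n" for n l
  proof -
    have en: "0 < e n" using n t by (simp add: e_def)
    have "(LINT x|M n. exp (- l * max 0 x)) = (LINT k|iid_sum p n. exp (- l * max 0 (e n * real k)))"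
      unfolding M_def by (subst integral_distr) auto
    also have "\<dots> = (LINT k|iid_sum p n. exp (- l * e n) ^ k)"
      using e0 by (intro Bochner_Integration.integral_cong) (auto simp: exp_of_nat_mult[symmetric] max_def zero_le_mult_iff
          mult_le_0_iff mult_ac)
    also have "\<dots> = enn2real (\<integral>\<^sup>+k. ennreal (exp (- l * e n) ^ k) \<partial>iid_sum p n)"
      by (intro integral_eq_nn_integral) auto
    also have "\<dots> = \<phi> n l"
    proof -
      have z: "exp (- l * e n) < 1" using l en by simp
      then have "(1 - exp (- l * e n)) powr \<beta> \<le> 1"
        using \<beta> by (intro powr_le1) auto
      then show ?thesis
        using z by (subst nn_integral_iid_sum) (auto simp: p \<phi>_def ennreal_power)
    qed
    finally show ?thesis .
  qed
  have \<phi>_ge: "1 - \<phi> n l \<le> t * l powr \<beta>" if l: "0 < l" and n: "0 < n" for n l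
  proof -
    have en: "0 < e n" using n t by (simp add: e_def)
    define y where "y = (1 - exp (- l * e n)) powr \<beta>"
    have y1: "y \<le> 1" unfolding y_def using l en \<beta> by (intro powr_le1) auto
    \<comment> \<open>Bernoulli's inequality turns the n-th power into a bound free of n: the factor
      n cancels against the t / n inside \<open>e n\<close>. This uniformity is what tightness
      needs.\<close>
    have "1 + real n * (- y) \<le> (1 + - y) ^ n"
      using y1 by (intro Bernoulli_inequality) auto
    then have "1 - \<phi> n l \<le> real n * y" by (simp add: \<phi>_def y_def)
    also have "y \<le> (l * e n) powr \<beta>"
      unfolding y_def using l en \<beta> exp_ge_add_one_self[of "- l * e n"] by (intro powr_mono2) auto
    then have "real n * y \<le> real n * (l * e n) powr \<beta>"
      by (intro mult_left_mono) auto
    also have "\<dots> = t * l powr \<beta>"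
      using l t n \<beta> by (simp add: e_def powr_mult powr_powr)
    finally show ?thesis by simp
  qed
  \<comment> \<open>A Markov inequality with 1 - exp(-x / b) in place of x, whose mean may be
    infinite: the mass beyond b is at most 2 t b^(-\<beta>) for every n. The left end -1 of the
    interval only serves to include 0 in a half-open interval.\<close>
  have tight: "tight (\<lambda>n. M (Suc n))"
    unfolding tight_def
  proof (intro conjI allI impI rd)
    fix \<epsilon> :: real assume \<epsilon>: "0 < \<epsilon>"
    have "((\<lambda>b::real. 2 * (t * (1 / b) powr \<beta>)) \<longlongrightarrow> 0) at_top"
      using \<beta> t by real_asymp
    then have "\<forall>\<^sub>F b in at_top. 2 * (t * (1 / b) powr \<beta>) < \<epsilon>"
      using \<epsilon> by (rule order_tendstoD)
    then have "\<forall>\<^sub>F b in at_top. 2 * (t * (1 / b) powr \<beta>) < \<epsilon> \<and> 0 < b"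
      using eventually_gt_at_top[of 0] by eventually_elim auto
    then obtain b :: real where b: "2 * (t * (1 / b) powr \<beta>) < \<epsilon>" "0 < b"
      using eventually_happens by force
    have "1 - \<epsilon> < measure (M (Suc n)) {-1<..b}" for n
    proof -
      interpret real_distribution "M (Suc n)" by (rule rd)
      have supp: "AE x in M (Suc n). 0 \<le> x"
        unfolding M_def by (subst AE_distr_iff) (auto simp: e0)
      have "measure (M (Suc n)) (- {-1<..b}) = (LINT x|M (Suc n). indicator (- {-1<..b}) x)"
        by simp
      also have "\<dots> \<le> (LINT x|M (Suc n). 2 * (1 - exp (- (1 / b) * max 0 x)))"
      proof (intro integral_mono_AE)
        show "integrable (M (Suc n)) (indicator (- {-1<..b}) :: real \<Rightarrow> real)"
          by (intro integrable_const_bound[where B = 1]) (auto simp: indicator_def)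
        show "integrable (M (Suc n)) (\<lambda>x. 2 * (1 - exp (- (1 / b) * max 0 x)))"
          using b by (intro integrable_const_bound[where B = 2]) auto
        show "AE x in M (Suc n). indicator (- {-1<..b}) x \<le> 2 * (1 - exp (- (1 / b) * max 0 x))"
          using supp
        proof eventually_elim
          case (elim x)
          then show ?case using one_minus_exp_minus_ge[of "x / b"] b
            by (auto simp: indicator_def max_def min_def field_simps split: if_splits)
        qed
      qed
      also have "\<dots> = 2 * (1 - \<phi> (Suc n) (1 / b))"
      proof -
        have "integrable (M (Suc n)) (\<lambda>x. exp (- (1 / b) * max 0 x))"
          using b by (intro integrable_const_bound[where B = 1]) auto
        moreover have "(LINT x|M (Suc n). exp (- (1 / b) * max 0 x)) = \<phi> (Suc n) (1 / b)"
          using b by (intro lap_n) auto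
        ultimately show ?thesis
          by (simp only: Bochner_Integration.integral_mult_right_zero Bochner_Integration.integral_diff integrable_const) (simp add: prob_space[simplified])
      qed
      also have "\<dots> \<le> 2 * (t * (1 / b) powr \<beta>)"
        using \<phi>_ge[of "1 / b" "Suc n"] b by auto
      finally have "measure (M (Suc n)) (- {-1<..b}) < \<epsilon>" using b by linarith
      moreover have "measure (M (Suc n)) (- {-1<..b}) = 1 - measure (M (Suc n)) {-1<..b}"
        using prob_compl[of "{-1<..b}"] by (simp add: Compl_eq_Diff_UNIV)
      ultimately show ?thesis by linarith
    qed
    then show "\<exists>a b. a < b \<and> (\<forall>n. 1 - \<epsilon> < measure (M (Suc n)) {a<..b})"
      using b by (intro exI[of _ "-1"] exI[of _ b]) auto
  qed
  obtain r N where r: "strict_mono (r :: nat \<Rightarrow> nat)" and N: "real_distribution N"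
    and w: "weak_conv_m ((\<lambda>n. M (Suc n)) \<circ> id \<circ> r) N"
    using tight_imp_convergent_subsubsequence[OF tight strict_mono_id] by blast
  have "(LINT x|N. exp (- l * max 0 x)) = exp (- t * l powr \<beta>)" if l: "0 < l" for l
  proof -
    have "(\<lambda>n. LINT x|((\<lambda>n. M (Suc n)) \<circ> id \<circ> r) n. exp (- l * max 0 x)) \<longlonglongrightarrow> (LINT x|N. exp (- l * max 0 x))"
    proof (rule weak_conv_imp_integral_bdd_continuous_conv[where B = 1, OF _ N w])
      show "isCont (\<lambda>x. exp (- l * max 0 x)) x" for x
        by (intro continuous_intros)
    qed (use l rd in auto)
    then have "(\<lambda>n. \<phi> (Suc (r n)) l) \<longlonglongrightarrow> (LINT x|N. exp (- l * max 0 x))"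
      using lap_n[OF l] by simp
    moreover have "(\<lambda>n. \<phi> n l) \<longlonglongrightarrow> exp (- t * l powr \<beta>)"
      using LIMSEQ_sibuya[OF \<beta> t l] by (simp add: \<phi>_def e_def)
    then have "(\<lambda>n. \<phi> (Suc (r n)) l) \<longlonglongrightarrow> exp (- t * l powr \<beta>)"
      using LIMSEQ_subseq_LIMSEQ[of "\<lambda>n. \<phi> n l" _ "Suc \<circ> r"] r
      by (auto simp: strict_mono_def o_def)
    ultimately show ?thesis by (rule LIMSEQ_unique)
  qed
  with N show ?thesis by blast
qed

lemma nn_integral_powr_exp:
  fixes a u :: real
  assumes "0 < a" "0 < u"
  shows "(\<integral>\<^sup>+x. ennreal (indicator {0<..} x * (x powr (a - 1) * exp (- u * x))) \<partial>lborel)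
    = ennreal (Gamma a * u powr (- a))"
proof -
  define I where "I = (\<integral>\<^sup>+x. ennreal (indicator {0<..} x * (x powr (a - 1) * exp (- u * x))) \<partial>lborel)"
  have "ennreal (Gamma a) = (\<integral>\<^sup>+t. ennreal (indicator {0..} t * t powr (a - 1) / exp t) \<partial>lborel)"
    by (rule Gamma_conv_nn_integral_real[OF assms(1)])
  also have "\<dots> = ennreal \<bar>u\<bar> * (\<integral>\<^sup>+x. ennreal (indicator {0..} (0 + u * x) * (0 + u * x) powr (a - 1) / exp (0 + u * x)) \<partial>lborel)"
    using assms by (intro nn_integral_real_affine) auto
  also have "(\<integral>\<^sup>+x. ennreal (indicator {0..} (0 + u * x) * (0 + u * x) powr (a - 1) / exp (0 + u * x)) \<partial>lborel)
    = (\<integral>\<^sup>+x. ennreal (u powr (a - 1)) * ennreal (indicator {0<..} x * (x powr (a - 1) * exp (- u * x))) \<partial>lborel)"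
    using assms
    by (intro nn_integral_cong) (auto simp: indicator_def powr_mult exp_minus field_simps zero_le_mult_iff ennreal_mult[symmetric])
  also have "\<dots> = ennreal (u powr (a - 1)) * I"
    unfolding I_def by (intro nn_integral_cmult) auto
  also have "ennreal \<bar>u\<bar> * (ennreal (u powr (a - 1)) * I) = ennreal (u powr a) * I"
    using assms by (simp add: mult.assoc[symmetric] ennreal_mult[symmetric] powr_mult_base)
  finally have "ennreal (u powr (- a)) * ennreal (Gamma a) = ennreal (u powr (- a)) * (ennreal (u powr a) * I)"
    by simp
  also have "\<dots> = I"
    using assms by (simp add: mult.assoc[symmetric] ennreal_mult[symmetric] powr_add[symmetric])
  finally show ?thesis
    using assms by (simp add: I_def ennreal_mult[symmetric] Gamma_real_pos less_imp_le mult.commute)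
qed

text \<open>The guiding identity is minus the derivative of exp(-t u^\<beta>), namely t \<beta>
  u^(\<beta> - 1) exp(-t u^\<beta>). Its first factor is the transform of \<open>k\<close>, its
  second that of the limit law, so the product is the transform of a convolution with a function and
  hence of a function. The density is built rather than recognised: the convolution is divided by x,
  and the transform of the quotient is computed by Tonelli.\<close>

theorem exists_stable_density:
  fixes \<beta> t :: real
  assumes \<beta>: "0 < \<beta>" "\<beta> < 1" and t: "0 < t"
  shows "\<exists>f. f \<in> borel_measurable lborel \<and> (\<forall>\<tau>. 0 \<le> f \<tau>) \<and> set_integrable lborel {0<..} f \<and>
      (\<forall>l\<ge>0. exp (- t * l powr \<beta>) = (LINT \<tau>:{0<..}|lborel. exp (- \<tau> * l) * f \<tau>))"
proof -
  obtain M where M: "real_distribution M"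
    and lap: "\<And>l. 0 < l \<Longrightarrow> (LINT x|M. exp (- l * max 0 x)) = exp (- t * l powr \<beta>)"
    using exists_stable_law[OF assms] by blast
  interpret real_distribution M by (rule M)
  interpret P: pair_sigma_finite lborel M ..
  have gm: "0 < Gamma (1 - \<beta>)" using \<beta> by (intro Gamma_real_pos) auto
  then have gm_nz: "Gamma (1 - \<beta>) \<noteq> 0" by linarith
  \<comment> \<open>Normalised so that its Laplace transform is t \<beta> u^(\<beta> - 1), the
    derivative of t u^\<beta>; the factor Gamma(1 - \<beta>) cancels the Gamma integral of
    x^(-\<beta>).\<close>
  define k where "k u = t * \<beta> / Gamma (1 - \<beta>) * (indicator {0<..} u * u powr (- \<beta>))" for u :: real
  have k0: "0 \<le> k u" for u using \<beta> t gm by (simp add: k_def)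
  have k_meas [measurable]: "k \<in> borel_measurable borel" unfolding k_def by measurable
  have klap: "(\<integral>\<^sup>+x. ennreal (exp (- u * x) * k x) \<partial>lborel) = ennreal (t * \<beta> * u powr (\<beta> - 1))" if u: "0 < u" for u
  proof -
    have "(\<integral>\<^sup>+x. ennreal (exp (- u * x) * k x) \<partial>lborel)
      = (\<integral>\<^sup>+x. ennreal (t * \<beta> / Gamma (1 - \<beta>)) * ennreal (indicator {0<..} x * (x powr ((1 - \<beta>) - 1) * exp (- u * x))) \<partial>lborel)"
      using \<beta> t gm by (intro nn_integral_cong) (auto simp: k_def ennreal_mult[symmetric] indicator_def mult_ac)
    also have "\<dots> = ennreal (t * \<beta> / Gamma (1 - \<beta>)) * ennreal (Gamma (1 - \<beta>) * u powr (- (1 - \<beta>)))"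
      using \<beta> u by (subst nn_integral_cmult) (auto simp: nn_integral_powr_exp[of "1 - \<beta>" u, simplified])
    also have "\<dots> = ennreal (t * \<beta> * u powr (\<beta> - 1))"
    proof -
      have "a / g * (g * b) = a * b" if "g \<noteq> 0" for a b g :: real
        using that by simp
      from this[OF gm_nz] have "t * \<beta> / Gamma (1 - \<beta>) * (Gamma (1 - \<beta>) * u powr (- (1 - \<beta>))) = t * \<beta> * u powr (\<beta> - 1)"
        by (simp only: minus_diff_eq)
      moreover have "0 \<le> t * \<beta> / Gamma (1 - \<beta>)" "0 \<le> Gamma (1 - \<beta>) * u powr (- (1 - \<beta>))"
        using gm \<beta> t by auto
      ultimately show ?thesis by (metis ennreal_mult)
    qed
    finally show ?thesis .
  qed
  \<comment> \<open>The convolution of \<open>k\<close> with the image of \<open>M\<close> under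
    \<open>max 0\<close>, the law whose Laplace transform is known. It vanishes for x \<le> 0
    because \<open>k\<close> does.\<close>
  define G where "G x = (\<integral>\<^sup>+y. ennreal (k (x - max 0 y)) \<partial>M)" for x
  have [measurable]: "G \<in> borel_measurable borel" unfolding G_def by measurable
  have Glap: "(\<integral>\<^sup>+x. ennreal (exp (- u * x)) * G x \<partial>lborel) = ennreal (t * \<beta> * u powr (\<beta> - 1) * exp (- t * u powr \<beta>))"
    if u: "0 < u" for u
  proof -
    have "(\<integral>\<^sup>+x. ennreal (exp (- u * x)) * G x \<partial>lborel)
      = (\<integral>\<^sup>+x. \<integral>\<^sup>+y. ennreal (exp (- u * x)) * ennreal (k (x - max 0 y)) \<partial>M \<partial>lborel)"
      unfolding G_def by (intro nn_integral_cong nn_integral_cmult[symmetric]) auto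
    also have "\<dots> = (\<integral>\<^sup>+y. \<integral>\<^sup>+x. ennreal (exp (- u * x)) * ennreal (k (x - max 0 y)) \<partial>lborel \<partial>M)"
      by (rule P.Fubini'[symmetric]) measurable
    also have "\<dots> = (\<integral>\<^sup>+y. ennreal (t * \<beta> * u powr (\<beta> - 1)) * ennreal (exp (- u * max 0 y)) \<partial>M)"
    proof (intro nn_integral_cong)
      fix y :: real
      have "(\<integral>\<^sup>+x. ennreal (exp (- u * x)) * ennreal (k (x - max 0 y)) \<partial>lborel)
        = ennreal \<bar>1\<bar> * (\<integral>\<^sup>+x. ennreal (exp (- u * (max 0 y + 1 * x))) * ennreal (k ((max 0 y + 1 * x) - max 0 y)) \<partial>lborel)"
        by (intro nn_integral_real_affine) auto
      also have "\<dots> = (\<integral>\<^sup>+x. ennreal (exp (- u * max 0 y)) * ennreal (exp (- u * x) * k x) \<partial>lborel)"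
        using k0 by (auto intro!: nn_integral_cong simp: ennreal_mult[symmetric] exp_add[symmetric] algebra_simps)
      also have "\<dots> = ennreal (exp (- u * max 0 y)) * ennreal (t * \<beta> * u powr (\<beta> - 1))"
        by (subst nn_integral_cmult) (auto simp: klap[OF u, simplified])
      finally show "(\<integral>\<^sup>+x. ennreal (exp (- u * x)) * ennreal (k (x - max 0 y)) \<partial>lborel)
        = ennreal (t * \<beta> * u powr (\<beta> - 1)) * ennreal (exp (- u * max 0 y))" by (simp add: mult.commute)
    qed
    also have "\<dots> = ennreal (t * \<beta> * u powr (\<beta> - 1)) * (\<integral>\<^sup>+y. ennreal (exp (- u * max 0 y)) \<partial>M)"
      by (intro nn_integral_cmult) auto
    also have "(\<integral>\<^sup>+y. ennreal (exp (- u * max 0 y)) \<partial>M) = ennreal (LINT y|M. exp (- u * max 0 y))"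
      using u by (intro nn_integral_eq_integral integrable_const_bound[where B = 1]) auto
    finally show ?thesis
      using lap[OF u] t \<beta> by (simp add: ennreal_mult[symmetric])
  qed
  \<comment> \<open>\<open>exp (- l * x) / x\<close> is the integral of \<open>exp (- u * x)\<close> over \<open>u \<ge> l\<close>, so the Laplace transform of
    \<open>H\<close> is recovered by integrating minus the derivative of \<open>exp (- t * u powr \<beta>)\<close>.\<close>
  define H where "H x = indicator {0<..} x * ennreal (1 / x) * G x" for x
  have [measurable]: "H \<in> borel_measurable borel" unfolding H_def by measurable
  have Hlap: "(\<integral>\<^sup>+x. ennreal (exp (- l * x)) * H x \<partial>lborel) = ennreal (exp (- t * l powr \<beta>))" if l: "0 < l" for l
  proof -
    have "(\<integral>\<^sup>+x. ennreal (exp (- l * x)) * H x \<partial>lborel)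
      = (\<integral>\<^sup>+x. \<integral>\<^sup>+u. ennreal (exp (- u * x)) * indicator {l..} u * (indicator {0<..} x * G x) \<partial>lborel \<partial>lborel)"
    proof (intro nn_integral_cong)
      fix x :: real
      show "ennreal (exp (- l * x)) * H x
        = (\<integral>\<^sup>+u. ennreal (exp (- u * x)) * indicator {l..} u * (indicator {0<..} x * G x) \<partial>lborel)"
      proof (cases "0 < x")
        case True
        have "(\<integral>\<^sup>+u. ennreal (exp (- u * x)) * indicator {l..} u \<partial>lborel) = ennreal (0 - (- (exp (- l * x) / x)))"
        proof (rule nn_integral_FTC_atLeast)
          show "((\<lambda>u. - (exp (- u * x) / x)) \<longlongrightarrow> 0) at_top"
            using True by real_asymp
          show "DERIV (\<lambda>u. - (exp (- u * x) / x)) u :> exp (- u * x)" for u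
            using True by (auto intro!: derivative_eq_intros)
        qed auto
        then show ?thesis
          using True by (subst nn_integral_multc) (auto simp: H_def ennreal_mult[symmetric] mult.assoc[symmetric])
      qed (simp add: H_def)
    qed
    also have "\<dots> = (\<integral>\<^sup>+u. \<integral>\<^sup>+x. ennreal (exp (- u * x)) * indicator {l..} u * (indicator {0<..} x * G x) \<partial>lborel \<partial>lborel)"
      by (rule lborel_pair.Fubini'[symmetric]) measurable
    also have "\<dots> = (\<integral>\<^sup>+u. ennreal (t * \<beta> * u powr (\<beta> - 1) * exp (- t * u powr \<beta>)) * indicator {l..} u \<partial>lborel)"
    proof (intro nn_integral_cong)
      fix u :: real
      have G0: "G x = 0" if "x \<le> 0" for x
      proof -
        have "ennreal (k (x - max 0 y)) = 0" for y using that by (simp add: k_def indicator_def)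
        then show ?thesis by (simp add: G_def)
      qed
      have "(\<integral>\<^sup>+x. ennreal (exp (- u * x)) * indicator {l..} u * (indicator {0<..} x * G x) \<partial>lborel)
        = (\<integral>\<^sup>+x. (ennreal (exp (- u * x)) * G x) * indicator {l..} u \<partial>lborel)"
        using G0 by (intro nn_integral_cong) (auto simp: indicator_def)
      also have "\<dots> = (\<integral>\<^sup>+x. ennreal (exp (- u * x)) * G x \<partial>lborel) * indicator {l..} u"
        by (intro nn_integral_multc) auto
      also have "\<dots> = ennreal (t * \<beta> * u powr (\<beta> - 1) * exp (- t * u powr \<beta>)) * indicator {l..} u"
        using Glap[of u] l by (auto simp: indicator_def)
      finally show "(\<integral>\<^sup>+x. ennreal (exp (- u * x)) * indicator {l..} u * (indicator {0<..} x * G x) \<partial>lborel)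
        = ennreal (t * \<beta> * u powr (\<beta> - 1) * exp (- t * u powr \<beta>)) * indicator {l..} u" .
    qed
    also have "\<dots> = ennreal (0 - (- exp (- t * l powr \<beta>)))"
    proof (rule nn_integral_FTC_atLeast)
      show "((\<lambda>u. - exp (- t * u powr \<beta>)) \<longlongrightarrow> 0) at_top"
        using \<beta> t by real_asymp
      show "DERIV (\<lambda>u. - exp (- t * u powr \<beta>)) u :> t * \<beta> * u powr (\<beta> - 1) * exp (- t * u powr \<beta>)" if "l \<le> u" for u
        using that l by (auto intro!: derivative_eq_intros)
    qed (use t \<beta> in auto)
    finally show ?thesis by simp
  qed
  \<comment> \<open>The formula for the transform was obtained for l > 0, so the total mass is
    reached by monotone convergence along l = 1 / (n + 1). Since \<beta> > 0, the value
    \<open>0 powr \<beta> = 0\<close> gives the limit exp 0.\<close>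
  have H1: "(\<integral>\<^sup>+x. H x \<partial>lborel) = 1"
  proof (rule LIMSEQ_unique)
    show "(\<lambda>n. \<integral>\<^sup>+x. ennreal (exp (- (1 / real (Suc n)) * x)) * H x \<partial>lborel) \<longlonglongrightarrow> (\<integral>\<^sup>+x. H x \<partial>lborel)"
    proof (rule nn_integral_LIMSEQ)
      show "incseq (\<lambda>n x. ennreal (exp (- (1 / real (Suc n)) * x)) * H x)"
        by (intro incseq_SucI le_funI) (auto simp: H_def indicator_def field_simps intro!: mult_right_mono mult_left_mono)
      show "(\<lambda>n. ennreal (exp (- (1 / real (Suc n)) * x)) * H x) \<longlonglongrightarrow> H x" for x
      proof -
        have "(\<lambda>n. exp (- (1 / real (Suc n)) * x)) \<longlonglongrightarrow> exp (- 0 * x)"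
          by (intro tendsto_intros LIMSEQ_Suc[OF lim_1_over_n])
        then have "(\<lambda>n. ennreal (exp (- (1 / real (Suc n)) * x)) * H x) \<longlonglongrightarrow> ennreal (exp (- 0 * x)) * H x"
          by (intro tendsto_mult_ennreal tendsto_ennrealI tendsto_const) auto
        then show ?thesis by simp
      qed
    qed auto
    have "(\<lambda>n. ennreal (exp (- t * (1 / real (Suc n)) powr \<beta>))) \<longlonglongrightarrow> ennreal (exp (- t * 0 powr \<beta>))"
      using \<beta> by (intro tendsto_ennrealI tendsto_intros tendsto_powr' LIMSEQ_Suc[OF lim_1_over_n]) auto
    then show "(\<lambda>n. \<integral>\<^sup>+x. ennreal (exp (- (1 / real (Suc n)) * x)) * H x \<partial>lborel) \<longlonglongrightarrow> 1"
      by (subst Hlap) auto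
  qed
  \<comment> \<open>\<open>enn2real\<close> sends infinity to 0. As \<open>H\<close> has total mass
    1, it is infinite only on a null set, and no integral changes.\<close>
  define f where "f x = enn2real (H x)" for x
  have [measurable]: "f \<in> borel_measurable borel" unfolding f_def by measurable
  have f0: "0 \<le> f x" for x by (simp add: f_def)
  have "AE x in lborel. H x \<noteq> \<infinity>"
    by (rule nn_integral_PInf_AE) (use H1 in auto)
  then have fH: "AE x in lborel. ennreal (f x) = H x"
    by eventually_elim (auto simp: f_def less_top)
  have Hlap': "(\<integral>\<^sup>+x. ennreal (exp (- x * l) * f x) \<partial>lborel) = ennreal (exp (- t * l powr \<beta>))" if "0 \<le> l" for l
  proof -
    have "(\<integral>\<^sup>+x. ennreal (exp (- x * l) * f x) \<partial>lborel) = (\<integral>\<^sup>+x. ennreal (exp (- l * x)) * H x \<partial>lborel)"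
      using fH by (intro nn_integral_cong_AE) (auto simp: ennreal_mult f0 mult.commute elim!: eventually_mono)
    also have "\<dots> = ennreal (exp (- t * l powr \<beta>))"
      using that H1 Hlap[of l] by (cases "l = 0") auto
    finally show ?thesis .
  qed
  have fset: "indicator {0<..} x * f x = f x" for x
    by (auto simp: f_def H_def indicator_def)
  have "set_integrable lborel {0<..} f"
    unfolding set_integrable_def using f0 Hlap'[of 0]
    by (intro integrableI_nonneg) (auto simp: fset)
  moreover have "exp (- t * l powr \<beta>) = (LINT \<tau>:{0<..}|lborel. exp (- \<tau> * l) * f \<tau>)" if "0 \<le> l" for l
  proof -
    have "(LINT \<tau>:{0<..}|lborel. exp (- \<tau> * l) * f \<tau>) = (LINT \<tau>|lborel. exp (- \<tau> * l) * f \<tau>)"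
      unfolding set_lebesgue_integral_def using fset
      by (intro Bochner_Integration.integral_cong) (auto simp: mult.left_commute[of "indicator {0<..} _"])
    also have "\<dots> = enn2real (\<integral>\<^sup>+x. ennreal (exp (- x * l) * f x) \<partial>lborel)"
      using f0 by (intro integral_eq_nn_integral) auto
    finally show ?thesis using Hlap'[OF that] by simp
  qed
  ultimately show ?thesis using f0 by (intro exI[of _ f]) auto
qed

section \<open>The modified Bessel function\<close>

text \<open>Replaces monotonicity of powers where the sign of the exponent is unknown, as for
  -\<zeta>: if two positive numbers agree up to a factor M in both directions, their powers agree up
  to \<open>M powr \<bar>p\<bar>\<close>.\<close>

lemma powr_comparable:
  fixes a b M p :: real
  assumes "0 < a" "0 < b" "1 \<le> M" "a \<le> M * b" "b \<le> M * a"
  shows "a powr p \<le> M powr \<bar>p\<bar> * b powr p"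
proof (cases "0 \<le> p")
  case True
  then have "a powr p \<le> (M * b) powr p"
    using assms by (intro powr_mono2) auto
  then show ?thesis using assms True by (simp add: powr_mult)
next
  case False
  have "b / M \<le> a" using assms by (simp add: field_simps)
  then have "a powr p \<le> (b / M) powr p"
    using assms False by (intro powr_mono2') auto
  then show ?thesis using assms False by (simp add: powr_divide powr_minus field_simps)
qed

lemma powr_le_exp:
  fixes p \<epsilon> :: real
  assumes "0 < \<epsilon>"
  shows "\<exists>K>0. \<forall>x\<ge>0. (1 + x) powr p \<le> K * exp (\<epsilon> * x)"
proof -
  \<comment> \<open>The bound \<eta> \<le> 1 gives \<eta> (1 + x) \<le> 1 + \<eta> x \<le>
    exp(\<eta> x), and \<eta> |p| \<le> \<epsilon> keeps the exponential within budget after raising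
    to the power |p|.\<close>
  define \<eta> where "\<eta> = min 1 (\<epsilon> / (\<bar>p\<bar> + 1))"
  have \<eta>: "0 < \<eta>" "\<eta> \<le> 1" "\<eta> * \<bar>p\<bar> \<le> \<epsilon>"
  proof -
    show "0 < \<eta>" "\<eta> \<le> 1" using assms by (auto simp: \<eta>_def)
    have "\<eta> * \<bar>p\<bar> \<le> \<epsilon> / (\<bar>p\<bar> + 1) * \<bar>p\<bar>"
      by (intro mult_right_mono) (auto simp: \<eta>_def)
    also have "\<dots> \<le> \<epsilon>" using assms by (simp add: field_simps)
    finally show "\<eta> * \<bar>p\<bar> \<le> \<epsilon>" .
  qed
  have "(1 + x) powr p \<le> (1 / \<eta>) powr \<bar>p\<bar> * exp (\<epsilon> * x)" if "0 \<le> x" for x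
  proof -
    have "(1 + x) powr p \<le> (1 + x) powr \<bar>p\<bar>"
      using that by (intro powr_mono) auto
    also have "1 + x \<le> (1 / \<eta>) * exp (\<eta> * x)"
    proof -
      have "\<eta> * (1 + x) \<le> 1 + \<eta> * x" using \<eta> by (simp add: algebra_simps)
      also have "\<dots> \<le> exp (\<eta> * x)" by simp
      finally show ?thesis using \<eta> by (simp add: field_simps)
    qed
    then have "(1 + x) powr \<bar>p\<bar> \<le> ((1 / \<eta>) * exp (\<eta> * x)) powr \<bar>p\<bar>"
      using that by (intro powr_mono2) auto
    also have "\<dots> = (1 / \<eta>) powr \<bar>p\<bar> * exp (\<eta> * \<bar>p\<bar> * x)"
      using \<eta> by (subst powr_mult) (auto simp: exp_powr_real mult_ac)
    also have "\<dots> \<le> (1 / \<eta>) powr \<bar>p\<bar> * exp (\<epsilon> * x)"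
      using \<eta> that by (intro mult_left_mono) (auto intro!: mult_right_mono)
    finally show ?thesis .
  qed
  then show ?thesis using \<eta> by (intro exI[of _ "(1 / \<eta>) powr \<bar>p\<bar>"]) auto
qed

text \<open>This is \<open>exp w\<close> times the moment E[(N + 1)^a] of a Poisson variable N with
  mean w. As N concentrates near w, the expected order of magnitude is
  \<open>exp w * (1 + w) powr a\<close>.\<close>

definition exp_sum :: "real \<Rightarrow> real \<Rightarrow> real" where
  "exp_sum a w = (\<Sum>n. w ^ n / fact n * (real n + 1) powr a)"

lemma summable_exp_sum: "summable (\<lambda>n. w ^ n / fact n * (real n + 1) powr a)" if "0 \<le> w" for w a :: real
proof -
  obtain K where K: "\<And>x. 0 \<le> x \<Longrightarrow> (1 + x) powr a \<le> K * exp (1 * x)"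
    using powr_le_exp[of 1 a] by auto
  have "summable (\<lambda>n. K * ((w * exp 1) ^ n / fact n))"
    using summable_exp[of "w * exp 1"] by (intro summable_mult) (simp add: field_simps)
  then show ?thesis
  proof (rule summable_comparison_test[rotated], intro exI[of _ 0] allI impI)
    fix n :: nat
    have "w ^ n / fact n * (real n + 1) powr a \<le> w ^ n / fact n * (K * exp (1 * real n))"
      using K[of "real n"] that by (intro mult_left_mono) (auto simp: add.commute)
    also have "\<dots> = K * ((w * exp 1) ^ n / fact n)"
      by (simp add: power_mult_distrib exp_of_nat_mult[symmetric])
    finally show "norm (w ^ n / fact n * (real n + 1) powr a) \<le> K * ((w * exp 1) ^ n / fact n)"
      using that by simp
  qed
qed

lemma exp_sum_nonneg: "0 \<le> w \<Longrightarrow> 0 \<le> exp_sum a w"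
  unfolding exp_sum_def by (intro suminf_nonneg summable_exp_sum) auto

text \<open>The additional factor n + 1 is split as n plus 1. The factor n cancels in the factorial
  and shifts the index, producing w; the shift changes n + 1 into n + 2 inside the power, which
  costs at most \<open>2 powr \<bar>a\<bar>\<close>.\<close>

lemma exp_sum_succ_le:
  fixes a :: real
  assumes w: "0 \<le> w"
  shows "exp_sum (a + 1) w \<le> 2 powr \<bar>a\<bar> * (1 + w) * exp_sum a w"
proof -
  have two: "1 \<le> (2::real) powr \<bar>a\<bar>" by (intro ge_one_powr_ge_zero) auto
  let ?g = "\<lambda>n. w ^ n / fact n * (real n + 1) powr a"
  have sg: "summable ?g" by (rule summable_exp_sum[OF w])
  \<comment> \<open>The term at n = 0 is set to 0, so that the series may be shifted by one without
    changing its sum.\<close>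
  define F where "F n = (if n = 0 then 0 else w * (w ^ (n - 1) / fact (n - 1)) * (real n + 1) powr a)" for n :: nat
  have s2: "F sums (exp_sum (a + 1) w - exp_sum a w)"
  proof -
    have "(\<lambda>n. w ^ n / fact n * (real n + 1) powr (a + 1) - ?g n) sums (exp_sum (a + 1) w - exp_sum a w)"
      unfolding exp_sum_def by (intro sums_diff summable_sums summable_exp_sum w)
    moreover have "w ^ n / fact n * (real n + 1) powr (a + 1) - ?g n
      = F n" for n
    proof (cases n)
      case (Suc m)
      have "w ^ n / fact n * (real n + 1) powr (a + 1) - ?g n = w ^ n / fact n * real n * (real n + 1) powr a"
        by (simp add: powr_add algebra_simps)
      also have "w ^ n / fact n * real n = w * (w ^ m / fact m)"
        using Suc by (simp add: field_simps del: of_nat_Suc)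
      finally show ?thesis using Suc by (simp add: F_def)
    qed (simp add: F_def)
    ultimately show ?thesis by simp
  qed
  then have "F sums (exp_sum (a + 1) w - exp_sum a w + F 0)" by (simp add: F_def)
  then have "(\<lambda>n. F (Suc n)) sums (exp_sum (a + 1) w - exp_sum a w)"
    by (simp only: sums_Suc_iff)
  then have *: "(\<lambda>n. w * (w ^ n / fact n) * (real (Suc n) + 1) powr a) sums (exp_sum (a + 1) w - exp_sum a w)"
    by (simp add: F_def)
  have **: "(\<lambda>n. w * 2 powr \<bar>a\<bar> * ?g n) sums (w * 2 powr \<bar>a\<bar> * exp_sum a w)"
    unfolding exp_sum_def by (intro sums_mult summable_sums sg)
  have "w * (w ^ n / fact n) * (real (Suc n) + 1) powr a \<le> w * 2 powr \<bar>a\<bar> * ?g n" for n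
  proof -
    have "(real (Suc n) + 1) powr a \<le> 2 powr \<bar>a\<bar> * (real n + 1) powr a"
      by (rule powr_comparable) auto
    then have "w * (w ^ n / fact n) * (real (Suc n) + 1) powr a \<le> w * (w ^ n / fact n) * (2 powr \<bar>a\<bar> * (real n + 1) powr a)"
      using w by (intro mult_left_mono) auto
    then show ?thesis by (simp add: mult_ac)
  qed
  then have "exp_sum (a + 1) w - exp_sum a w \<le> w * 2 powr \<bar>a\<bar> * exp_sum a w"
    by (rule sums_le[OF _ * **])
  moreover have "exp_sum a w \<le> 2 powr \<bar>a\<bar> * exp_sum a w"
    using two exp_sum_nonneg[OF w, of a] by (simp add: mult_le_cancel_right1)
  ultimately show ?thesis by (simp add: algebra_simps)
qed

text \<open>The same index shift read backwards: w * w^n / n! equals (n + 1) times the next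
  exponential term, which supplies the additional power of n + 1.\<close>

lemma exp_sum_le_succ:
  fixes a :: real
  assumes w: "0 \<le> w"
  shows "(1 + w) * exp_sum a w \<le> (1 + 2 powr \<bar>a + 1\<bar>) * exp_sum (a + 1) w"
proof -
  let ?h = "\<lambda>n. w ^ n / fact n * (real n + 1) powr (a + 1)"
  have h0: "0 \<le> ?h n" for n using w by simp
  have sh: "summable ?h" by (rule summable_exp_sum[OF w])
  have 1: "exp_sum a w \<le> exp_sum (a + 1) w"
    unfolding exp_sum_def using w
    by (intro suminf_le summable_exp_sum mult_left_mono powr_mono) auto
  have "w * exp_sum a w = (\<Sum>n. w * (w ^ n / fact n * (real n + 1) powr a))"
    unfolding exp_sum_def by (rule suminf_mult[symmetric, OF summable_exp_sum[OF w]])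
  also have "\<dots> \<le> (\<Sum>n. 2 powr \<bar>a + 1\<bar> * ?h (Suc n))"
  proof (intro suminf_le summable_mult summable_exp_sum[OF w])
    show "summable (\<lambda>n. ?h (Suc n))" using sh by (subst summable_Suc_iff)
    fix n :: nat
    have "w * (w ^ n / fact n * (real n + 1) powr a) = w ^ Suc n / fact (Suc n) * (real n + 1) powr (a + 1)"
    proof -
      have "w ^ Suc n / fact (Suc n) * real (Suc n) = w * (w ^ n / fact n)"
        by (simp add: field_simps del: of_nat_Suc)
      moreover have "(real n + 1) powr (a + 1) = real (Suc n) * (real n + 1) powr a"
        by (simp add: powr_add add.commute mult.commute)
      ultimately show ?thesis by (simp only: mult.assoc[symmetric])
    qed
    also have "(real n + 1) powr (a + 1) \<le> 2 powr \<bar>a + 1\<bar> * (real (Suc n) + 1) powr (a + 1)"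
      by (rule powr_comparable) auto
    then have "w ^ Suc n / fact (Suc n) * (real n + 1) powr (a + 1)
      \<le> w ^ Suc n / fact (Suc n) * (2 powr \<bar>a + 1\<bar> * (real (Suc n) + 1) powr (a + 1))"
      using w by (intro mult_left_mono) auto
    finally show "w * (w ^ n / fact n * (real n + 1) powr a) \<le> 2 powr \<bar>a + 1\<bar> * ?h (Suc n)"
      by (simp add: mult_ac)
  qed
  also have "\<dots> = 2 powr \<bar>a + 1\<bar> * (\<Sum>n. ?h (Suc n))"
    using sh by (intro suminf_mult) (subst summable_Suc_iff)
  also have "(\<Sum>n. ?h (Suc n)) \<le> suminf ?h"
    using suminf_split_head[OF sh] h0[of 0] by linarith
  finally have "w * exp_sum a w \<le> 2 powr \<bar>a + 1\<bar> * exp_sum (a + 1) w"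
    by (simp add: exp_sum_def)
  with 1 show ?thesis by (simp add: algebra_simps)
qed

text \<open>Induction in both directions from the exponent 0, where the series is the exponential
  itself; the two shift lemmas are the upward and the downward step.\<close>

lemma exp_sum_int_le:
  "\<exists>K>0. \<forall>w\<ge>0. exp_sum (real_of_int m) w \<le> K * exp w * (1 + w) powr real_of_int m"
proof (induction m rule: int_induct[where k = 0])
  case base
  have "exp_sum 0 w = exp w" for w
    by (simp add: exp_sum_def exp_def divide_inverse mult.commute)
  then show ?case by (intro exI[of _ 1]) auto
next
  case (step1 m)
  then obtain K where K: "K > 0" "\<And>w. 0 \<le> w \<Longrightarrow> exp_sum (real_of_int m) w \<le> K * exp w * (1 + w) powr real_of_int m"
    by auto
  let ?L = "2 powr \<bar>real_of_int m\<bar>"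
  have "exp_sum (real_of_int (m + 1)) w \<le> (?L * K) * exp w * (1 + w) powr real_of_int (m + 1)" if w: "0 \<le> w" for w
  proof -
    have "exp_sum (real_of_int m + 1) w \<le> ?L * (1 + w) * exp_sum (real_of_int m) w"
      by (rule exp_sum_succ_le[OF w])
    also have "\<dots> \<le> ?L * (1 + w) * (K * exp w * (1 + w) powr real_of_int m)"
      using w K(2)[OF w] by (intro mult_left_mono) auto
    also have "\<dots> = (?L * K) * exp w * (1 + w) powr (real_of_int m + 1)"
      using w by (simp add: powr_add)
    finally show ?thesis by simp
  qed
  then show ?case using K(1) by (intro exI[of _ "?L * K"]) auto
next
  case (step2 m)
  then obtain K where K: "K > 0" "\<And>w. 0 \<le> w \<Longrightarrow> exp_sum (real_of_int m) w \<le> K * exp w * (1 + w) powr real_of_int m"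
    by auto
  let ?L = "1 + 2 powr \<bar>real_of_int m\<bar>"
  have L: "0 < ?L" by (simp add: add_pos_nonneg)
  have "exp_sum (real_of_int (m - 1)) w \<le> (?L * K) * exp w * (1 + w) powr real_of_int (m - 1)" if w: "0 \<le> w" for w
  proof -
    have "(1 + w) * exp_sum (real_of_int m - 1) w \<le> ?L * exp_sum (real_of_int m) w"
      using exp_sum_le_succ[OF w, of "real_of_int m - 1"] by simp
    also have "\<dots> \<le> ?L * (K * exp w * (1 + w) powr real_of_int m)"
      using K(2)[OF w] L by (intro mult_left_mono) auto
    also have "\<dots> = (1 + w) * ((?L * K) * exp w * (1 + w) powr (real_of_int m - 1))"
      using w by (simp add: powr_diff)
    finally show ?thesis using w by simp
  qed
  then show ?case using K(1) L by (intro exI[of _ "?L * K"]) auto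
qed

text \<open>Interpolation between the neighbouring integers m \<le> a \<le> m + 1. With x = n + 1
  and threshold 1 + w, x^a is at most (1 + w)^(a - m) x^m below the threshold and at most (1 + w)^(a
  - m - 1) x^(m + 1) above it. After summation both terms have the order (1 + w)^a exp(w).\<close>

lemma exp_sum_le:
  fixes a :: real
  shows "\<exists>K>0. \<forall>w\<ge>0. exp_sum a w \<le> K * exp w * (1 + w) powr a"
proof -
  define m where "m = \<lfloor>a\<rfloor>"
  have m: "real_of_int m \<le> a" "a \<le> real_of_int m + 1" by (auto simp: m_def)
  obtain K1 where K1: "K1 > 0" "\<And>w. 0 \<le> w \<Longrightarrow> exp_sum (real_of_int m) w \<le> K1 * exp w * (1 + w) powr real_of_int m"
    using exp_sum_int_le[of m] by auto
  obtain K2 where K2: "K2 > 0" "\<And>w. 0 \<le> w \<Longrightarrow> exp_sum (real_of_int m + 1) w \<le> K2 * exp w * (1 + w) powr (real_of_int m + 1)"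
    using exp_sum_int_le[of "m + 1"] by auto
  have "exp_sum a w \<le> (K1 + K2) * exp w * (1 + w) powr a" if w: "0 \<le> w" for w
  proof -
    define p q where "p = (1 + w) powr (a - m)" and "q = (1 + w) powr (a - (m + 1))"
    have pq: "0 \<le> p" "0 \<le> q" by (auto simp: p_def q_def)
    have pt: "(real n + 1) powr a \<le> p * (real n + 1) powr m + q * (real n + 1) powr (real_of_int m + 1)" for n
    proof -
      show ?thesis
      proof (cases "real n + 1 \<le> 1 + w")
        case True
        have "(real n + 1) powr a = (real n + 1) powr (a - m) * (real n + 1) powr m"
          by (simp add: powr_add[symmetric])
        also have "\<dots> \<le> p * (real n + 1) powr m"
          unfolding p_def using True m by (intro mult_right_mono powr_mono2) auto
        finally show ?thesis using pq by (smt (verit) mult_nonneg_nonneg powr_ge_zero)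
      next
        case False
        have "(real n + 1) powr a = (real n + 1) powr (a - (m + 1)) * (real n + 1) powr (real_of_int m + 1)"
          by (simp add: powr_add[symmetric])
        also have "\<dots> \<le> q * (real n + 1) powr (real_of_int m + 1)"
          unfolding q_def using False m w by (intro mult_right_mono powr_mono2') auto
        finally show ?thesis using pq by (smt (verit) mult_nonneg_nonneg powr_ge_zero)
      qed
    qed
    let ?g = "\<lambda>b n. w ^ n / fact n * (real n + 1) powr b"
    have "exp_sum a w \<le> p * exp_sum m w + q * exp_sum (real_of_int m + 1) w"
    proof (rule sums_le)
      show "?g a sums exp_sum a w"
        unfolding exp_sum_def by (intro summable_sums summable_exp_sum w)
      show "(\<lambda>n. p * ?g m n + q * ?g (real_of_int m + 1) n) sums (p * exp_sum m w + q * exp_sum (real_of_int m + 1) w)"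
        unfolding exp_sum_def by (intro sums_add sums_mult summable_sums summable_exp_sum w)
      fix n
      have "?g a n \<le> w ^ n / fact n * (p * (real n + 1) powr m + q * (real n + 1) powr (real_of_int m + 1))"
        using w by (intro mult_left_mono pt) auto
      then show "?g a n \<le> p * ?g m n + q * ?g (real_of_int m + 1) n" by (simp add: algebra_simps)
    qed
    also have "\<dots> \<le> p * (K1 * exp w * (1 + w) powr m) + q * (K2 * exp w * (1 + w) powr (real_of_int m + 1))"
      using pq K1(2)[OF w] K2(2)[OF w] by (intro add_mono mult_left_mono) auto
    also have "\<dots> = K1 * exp w * (p * (1 + w) powr m) + K2 * exp w * (q * (1 + w) powr (real_of_int m + 1))"
      by (simp add: mult_ac)
    also have "p * (1 + w) powr m = (1 + w) powr a" by (simp add: p_def powr_add[symmetric])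
    also have "q * (1 + w) powr (real_of_int m + 1) = (1 + w) powr a" by (simp add: q_def powr_add[symmetric])
    finally show ?thesis by (simp add: algebra_simps)
  qed
  then show ?thesis using K1(1) K2(1) by (intro exI[of _ "K1 + K2"]) auto
qed

text \<open>Bessel series contain only even powers. For the upper bound the even terms are part of
  the full series. For the lower bound they must carry a fixed share of the mass, which is the case
  a = 0: cosh w \<ge> exp(w) / 2.\<close>

lemma even_exp_sum_bounds:
  fixes a :: real
  shows "\<exists>K>0. \<forall>w\<ge>0. summable (\<lambda>k. w ^ (2 * k) / fact (2 * k) * (real (2 * k) + 1) powr a)
    \<and> (\<Sum>k. w ^ (2 * k) / fact (2 * k) * (real (2 * k) + 1) powr a) \<le> K * (exp w * (1 + w) powr a)
    \<and> exp w * (1 + w) powr a \<le> K * (\<Sum>k. w ^ (2 * k) / fact (2 * k) * (real (2 * k) + 1) powr a)"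
proof -
  define E where "E b w = (\<Sum>k. w ^ (2 * k) / fact (2 * k) * (real (2 * k) + 1) powr b)" for b w :: real
  have inj2: "inj (\<lambda>k::nat. 2 * k)" by (auto simp: inj_def)
  have sm: "summable (\<lambda>k. w ^ (2 * k) / fact (2 * k) * (real (2 * k) + 1) powr b)" if "0 \<le> w" for w b
    using summable_reindex[OF summable_exp_sum[OF that, of b] inj2] that by (simp add: o_def)
  have le: "E b w \<le> exp_sum b w" if "0 \<le> w" for w b
    using suminf_reindex_mono[OF summable_exp_sum[OF that, of b] inj2] that
    by (simp add: o_def E_def exp_sum_def)
  have E0: "E 0 w = cosh w" for w
  proof -
    have "(\<lambda>k. (\<lambda>n. if even n then w ^ n /\<^sub>R fact n else 0) (2 * k)) sums cosh w"
      using cosh_converges[of w] by (subst sums_mono_reindex) (auto simp: strict_mono_def elim!: evenE)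
    then show ?thesis by (simp add: E_def sums_iff divide_inverse mult.commute)
  qed
  have E0_ge: "exp w / 2 \<le> E 0 w" for w by (simp add: E0 cosh_def)
  obtain K1 where K1: "0 < K1" "\<And>w. 0 \<le> w \<Longrightarrow> exp_sum a w \<le> K1 * exp w * (1 + w) powr a"
    using exp_sum_le by blast
  obtain K2 where K2: "0 < K2" "\<And>w. 0 \<le> w \<Longrightarrow> exp_sum (- a) w \<le> K2 * exp w * (1 + w) powr (- a)"
    using exp_sum_le by blast
  have up: "E a w \<le> K1 * (exp w * (1 + w) powr a)" if "0 \<le> w" for w
    using le[OF that, of a] K1(2)[OF that] by (simp add: mult_ac)
  have lo: "exp w * (1 + w) powr a \<le> 4 * K2 * E a w" if w: "0 \<le> w" for w
  proof -
    \<comment> \<open>Chosen so that the subtracted term \<delta>^2 q K2 exp(w) is exactly half of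
      the main term \<delta> q exp(w).\<close>
    define \<delta> where "\<delta> = 1 / (2 * K2)"
    define q where "q = (1 + w) powr a"
    have q: "0 < q" "(1 + w) powr (- a) = 1 / q" using w by (auto simp: q_def powr_minus field_simps)
    have d: "0 < \<delta>" using K2 by (simp add: \<delta>_def)
    \<comment> \<open>\<open>2 * \<delta> \<le> y + \<delta>\<^sup>2 / y\<close> turns the upper bound for the exponent \<open>- a\<close> into a lower bound for \<open>a\<close>.\<close>
    have pt: "2 * \<delta> * q * (real (2 * k) + 1) powr 0 - \<delta>\<^sup>2 * q\<^sup>2 * (real (2 * k) + 1) powr (- a) \<le> (real (2 * k) + 1) powr a" for k
    proof -
      define y where "y = (real (2 * k) + 1) powr a"
      have y: "0 < y" "(real (2 * k) + 1) powr (- a) = 1 / y" by (auto simp: y_def powr_minus field_simps)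
      have "0 \<le> (y - \<delta> * q)\<^sup>2 / y" using y by simp
      also have "\<dots> = y - 2 * \<delta> * q + \<delta>\<^sup>2 * q\<^sup>2 / y"
        using y(1) by (simp add: power2_eq_square field_simps)
      finally show ?thesis unfolding y(2) unfolding y_def[symmetric] by simp
    qed
    have "2 * \<delta> * q * E 0 w - \<delta>\<^sup>2 * q\<^sup>2 * E (- a) w \<le> E a w"
    proof (rule sums_le)
      show "(\<lambda>k. 2 * \<delta> * q * (w ^ (2 * k) / fact (2 * k) * (real (2 * k) + 1) powr 0)
          - \<delta>\<^sup>2 * q\<^sup>2 * (w ^ (2 * k) / fact (2 * k) * (real (2 * k) + 1) powr (- a))) sums (2 * \<delta> * q * E 0 w - \<delta>\<^sup>2 * q\<^sup>2 * E (- a) w)"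
        unfolding E_def by (intro sums_diff sums_mult summable_sums sm w)
      show "(\<lambda>k. w ^ (2 * k) / fact (2 * k) * (real (2 * k) + 1) powr a) sums E a w"
        unfolding E_def by (intro summable_sums sm w)
      fix k
      have "w ^ (2 * k) / fact (2 * k) * (2 * \<delta> * q * (real (2 * k) + 1) powr 0 - \<delta>\<^sup>2 * q\<^sup>2 * (real (2 * k) + 1) powr (- a))
        \<le> w ^ (2 * k) / fact (2 * k) * (real (2 * k) + 1) powr a"
        using w by (intro mult_left_mono pt) auto
      then show "2 * \<delta> * q * (w ^ (2 * k) / fact (2 * k) * (real (2 * k) + 1) powr 0)
          - \<delta>\<^sup>2 * q\<^sup>2 * (w ^ (2 * k) / fact (2 * k) * (real (2 * k) + 1) powr (- a))
          \<le> w ^ (2 * k) / fact (2 * k) * (real (2 * k) + 1) powr a"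
        by (simp add: right_diff_distrib mult_ac)
    qed
    moreover have "\<delta> * q * exp w \<le> 2 * \<delta> * q * E 0 w"
      using mult_left_mono[OF E0_ge[of w], of "2 * \<delta> * q"] d q by simp
    moreover have "\<delta>\<^sup>2 * q\<^sup>2 * E (- a) w \<le> \<delta>\<^sup>2 * q\<^sup>2 * (K2 * exp w * (1 / q))"
      using le[OF w, of "- a"] K2(2)[OF w] q by (intro mult_left_mono) auto
    ultimately have "\<delta> * q * exp w - \<delta>\<^sup>2 * q\<^sup>2 * (K2 * exp w * (1 / q)) \<le> E a w"
      by linarith
    also have "\<delta>\<^sup>2 * q\<^sup>2 * (K2 * exp w * (1 / q)) = \<delta> * q * exp w / 2"
      using q(1) K2(1) by (simp add: \<delta>_def power2_eq_square field_simps)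
    finally have "\<delta> * q * exp w / 2 \<le> E a w" by simp
    then show ?thesis using K2(1) by (simp add: \<delta>_def q_def field_simps)
  qed
  have "E a w \<le> (K1 + 4 * K2) * (exp w * (1 + w) powr a)" "exp w * (1 + w) powr a \<le> (K1 + 4 * K2) * E a w"
    if w: "0 \<le> w" for w
  proof -
    have Ea: "0 \<le> E a w" unfolding E_def by (intro suminf_nonneg sm w) (use w in auto)
    have "K1 * (exp w * (1 + w) powr a) \<le> (K1 + 4 * K2) * (exp w * (1 + w) powr a)"
      using K2 w by (intro mult_right_mono) auto
    with up[OF w] show "E a w \<le> (K1 + 4 * K2) * (exp w * (1 + w) powr a)" by linarith
    have "4 * K2 * E a w \<le> (K1 + 4 * K2) * E a w"
      using K1 Ea by (intro mult_right_mono) auto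
    with lo[OF w] show "exp w * (1 + w) powr a \<le> (K1 + 4 * K2) * E a w" by linarith
  qed
  then show ?thesis
    using sm K1(1) K2(1) by (intro exI[of _ "K1 + 4 * K2"]) (auto simp: E_def)
qed

text \<open>The quotient \<open>X\<close> converges to Gamma z, which is not zero. A positive
  sequence with such a limit is bounded, and so is its reciprocal; this gives both inequalities for
  all n at once.\<close>

lemma pochhammer_bounds:
  fixes z :: real
  assumes z: "0 < z"
  shows "\<exists>K>0. \<forall>n. pochhammer z n \<le> K * (fact n * (real n + 1) powr (z - 1))
    \<and> fact n * (real n + 1) powr (z - 1) \<le> K * pochhammer z n"
proof -
  define X where "X n = fact n * (real n + 1) powr (z - 1) / pochhammer z n" for n
  have pos: "0 < pochhammer z n" for n using z by (rule pochhammer_pos)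
  have Xpos: "0 < X n" for n using pos by (simp add: X_def)
  \<comment> \<open>\<open>Gamma_series'\<close> contains n^z (n - 1)!, that is n^(z - 1) n!. The
    correction factor, which tends to 1, replaces n by n + 1 in the power, so that the bounds make
    sense at n = 0 too.\<close>
  have "(\<lambda>n. Gamma_series' z n * ((real n + 1) / real n) powr (z - 1)) \<longlonglongrightarrow> Gamma z * 1"
  proof (intro tendsto_mult Gamma_series'_LIMSEQ)
    show "(\<lambda>n. ((real n + 1) / real n) powr (z - 1)) \<longlonglongrightarrow> 1" by real_asymp
  qed
  moreover have "\<forall>\<^sub>F n in sequentially. Gamma_series' z n * ((real n + 1) / real n) powr (z - 1) = X n"
    using eventually_gt_at_top[of 0]
  proof eventually_elim
    case (elim n)
    have "real n powr z = real n * real n powr (z - 1)"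
      using elim by (simp add: powr_diff)
    moreover have "fact (n - 1) * real n = fact n"
      using elim by (cases n) (auto simp: mult.commute)
    moreover have "exp (z * ln (real n)) = real n powr z"
      using elim by (simp add: powr_def)
    ultimately show ?case
      using elim by (simp add: Gamma_series'_def X_def powr_divide mult.assoc[symmetric])
  qed
  ultimately have lim: "X \<longlonglongrightarrow> Gamma z"
    by (simp add: tendsto_cong)
  have Gz: "Gamma z \<noteq> 0" using Gamma_real_pos[OF z] by linarith
  have "Bseq X" using lim by (intro convergent_imp_Bseq convergentI)
  then obtain K1 where K1: "0 < K1" "\<And>n. norm (X n) \<le> K1" by (auto elim: BseqE)
  have "Bseq (\<lambda>n. inverse (X n))"
    using tendsto_inverse[OF lim Gz] by (intro convergent_imp_Bseq convergentI)
  then obtain K2 where K2: "0 < K2" "\<And>n. norm (inverse (X n)) \<le> K2" by (auto elim: BseqE)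
  have "pochhammer z n \<le> (K1 + K2) * (fact n * (real n + 1) powr (z - 1))
    \<and> fact n * (real n + 1) powr (z - 1) \<le> (K1 + K2) * pochhammer z n" for n
  proof
    have "inverse (X n) \<le> K1 + K2" using K2(2)[of n] K1(1) Xpos[of n] by simp
    then show "pochhammer z n \<le> (K1 + K2) * (fact n * (real n + 1) powr (z - 1))"
      by (simp add: X_def divide_simps mult_ac)
    have "X n \<le> K1 + K2" using K1(2)[of n] K2(1) Xpos[of n] by simp
    then show "fact n * (real n + 1) powr (z - 1) \<le> (K1 + K2) * pochhammer z n"
      using pos[of n] by (simp add: X_def divide_simps mult_ac)
  qed
  then show ?thesis using K1 K2 by (intro exI[of _ "K1 + K2"]) auto
qed

text \<open>With z = \<zeta> + 1/2 the Gamma value is the rising factorial of z times Gamma z, and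
  the duplication formula writes (2k)! as 4^k k! times the rising factorial of 1/2. The coefficient
  is thus 4^k / (2k)! times a quotient of two rising factorials, of order (k + 1)^((1/2 - 1) - (z -
  1)) = (k + 1)^(-\<zeta>).\<close>

lemma bessel_coeff_bounds:
  fixes \<zeta> :: real
  assumes \<zeta>: "\<zeta> > -1/2"
  shows "\<exists>K>0. \<forall>k. 1 / (fact k * Gamma (real k + (\<zeta> - 1/2) + 1)) \<le> K * (4 ^ k / fact (2 * k) * (real (2 * k) + 1) powr (- \<zeta>))
    \<and> 4 ^ k / fact (2 * k) * (real (2 * k) + 1) powr (- \<zeta>) \<le> K * (1 / (fact k * Gamma (real k + (\<zeta> - 1/2) + 1)))"
proof -
  define z where "z = \<zeta> + 1/2"
  have z: "0 < z" using \<zeta> by (simp add: z_def)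
  have Gz: "0 < Gamma z" using z by (rule Gamma_real_pos)
  obtain K1 where K1: "0 < K1" "\<And>n. pochhammer z n \<le> K1 * (fact n * (real n + 1) powr (z - 1))"
    "\<And>n. fact n * (real n + 1) powr (z - 1) \<le> K1 * pochhammer z n"
    using pochhammer_bounds[OF z] by blast
  obtain K2 where K2: "0 < K2" "\<And>n. pochhammer (1/2) n \<le> K2 * (fact n * (real n + 1) powr (1/2 - 1))"
    "\<And>n. fact n * (real n + 1) powr (1/2 - 1) \<le> K2 * pochhammer (1/2) n"
    using pochhammer_bounds[of "1/2"] by (auto simp del: One_nat_def)
  define L where "L = 2 powr \<bar>- \<zeta>\<bar>"
  have L: "0 < L" by (simp add: L_def)
  define K where "K = K1 * K2 * L * (Gamma z + 1 / Gamma z)"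
  have K: "0 < K" using K1 K2 L Gz by (simp add: K_def add_pos_pos)
  have "1 / (fact k * Gamma (real k + (\<zeta> - 1/2) + 1)) \<le> K * (4 ^ k / fact (2 * k) * (real (2 * k) + 1) powr (- \<zeta>))
    \<and> 4 ^ k / fact (2 * k) * (real (2 * k) + 1) powr (- \<zeta>) \<le> K * (1 / (fact k * Gamma (real k + (\<zeta> - 1/2) + 1)))" for k
  proof -
    define P where "P = pochhammer z k"
    define H where "H = pochhammer (1/2 :: real) k"
    define c where "c = (4 ^ k / fact (2 * k) :: real)"
    have P: "0 < P" using z by (simp add: P_def pochhammer_pos)
    have H: "0 < H" by (simp add: H_def pochhammer_pos)
    have c: "0 < c" by (simp add: c_def)
    have "P = Gamma (z + real k) / Gamma z"
      unfolding P_def using z by (intro pochhammer_Gamma) (auto simp: nonpos_Ints_def)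
    then have "Gamma (z + real k) = P * Gamma z" using Gz by (simp add: field_simps)
    then have G: "Gamma (real k + (\<zeta> - 1/2) + 1) = P * Gamma z"
      by (simp add: z_def algebra_simps)
    have ck: "1 / fact k = c * H"
    proof -
      have "fact (2 * k) = (4 ^ k * H * fact k :: real)"
        using fact_double[of k, where 'a = real] by (simp add: H_def power_mult)
      then show ?thesis using H by (simp add: c_def field_simps)
    qed
    define v where "v = real k + 1"
    have v: "0 < v" by (simp add: v_def)
    have f: "0 < (fact k :: real)" by simp
    have z1: "z - 1 = \<zeta> - 1/2" by (simp add: z_def)
    have vq: "v powr (1/2 - 1) / v powr (z - 1) = v powr (- \<zeta>)"
      unfolding powr_diff[symmetric] by (simp add: z1)
    have ratio1: "H / P \<le> K1 * K2 * v powr (- \<zeta>)"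
    proof -
      have "H / P \<le> (K2 * (fact k * v powr (1/2 - 1))) / (fact k * v powr (z - 1) / K1)"
        using K1 K2 P H v f
        by (intro frac_le) (auto simp: v_def P_def H_def field_simps)
      also have "\<dots> = K1 * K2 * (v powr (1/2 - 1) / v powr (z - 1))"
        using K1 by (simp add: field_simps)
      also have "\<dots> = K1 * K2 * v powr (- \<zeta>)"
        by (simp only: vq)
      finally show ?thesis .
    qed
    have ratio2: "v powr (- \<zeta>) \<le> K1 * K2 * (H / P)"
    proof -
      have "v powr (- \<zeta>) = (fact k * v powr (1/2 - 1)) / (fact k * v powr (z - 1))"
        unfolding vq[symmetric] by simp
      also have "\<dots> \<le> (K2 * H) / (P / K1)"
        using K1 K2 P H v f by (intro frac_le) (auto simp: v_def P_def H_def field_simps)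
      also have "\<dots> = K1 * K2 * (H / P)" by simp
      finally show ?thesis .
    qed
    have v1: "v powr (- \<zeta>) \<le> L * (real (2 * k) + 1) powr (- \<zeta>)"
      unfolding L_def by (rule powr_comparable) (auto simp: v_def)
    have v2: "(real (2 * k) + 1) powr (- \<zeta>) \<le> L * v powr (- \<zeta>)"
      unfolding L_def by (rule powr_comparable) (auto simp: v_def)
    have KK: "K1 * K2 * L * Gamma z \<le> K" "K1 * K2 * L * (1 / Gamma z) \<le> K"
      unfolding K_def using K1(1) K2(1) L Gz by (intro mult_left_mono; simp)+
    have B: "1 / (fact k * Gamma (real k + (\<zeta> - 1/2) + 1)) = c * (H / P) / Gamma z"
    proof -
      have "1 / (fact k * (P * Gamma z)) = 1 / fact k / P / Gamma z" by simp
      then show ?thesis unfolding G ck by simp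
    qed
    have "c * (H / P) / Gamma z \<le> c * (K1 * K2 * (L * (real (2 * k) + 1) powr (- \<zeta>))) / Gamma z"
    proof -
      have "H / P \<le> K1 * K2 * (L * (real (2 * k) + 1) powr (- \<zeta>))"
        using K1(1) K2(1) by (intro order_trans[OF ratio1 mult_left_mono[OF v1]]) auto
      then show ?thesis using c Gz by (intro divide_right_mono mult_left_mono) auto
    qed
    also have "\<dots> = (K1 * K2 * L * (1 / Gamma z)) * (c * (real (2 * k) + 1) powr (- \<zeta>))" by (simp add: mult_ac)
    also have "\<dots> \<le> K * (c * (real (2 * k) + 1) powr (- \<zeta>))"
      using KK c by (intro mult_right_mono) auto
    finally have 1: "c * (H / P) / Gamma z \<le> K * (c * (real (2 * k) + 1) powr (- \<zeta>))" .
    have "c * (real (2 * k) + 1) powr (- \<zeta>) \<le> c * (L * (K1 * K2 * (H / P)))"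
      using v2 mult_left_mono[OF ratio2, of L] L c by (intro mult_left_mono) auto
    also have "\<dots> = (K1 * K2 * L * Gamma z) * (c * (H / P) / Gamma z)"
    proof -
      have "c * (L * (K1 * K2 * x)) = (K1 * K2 * L * g) * (c * x / g)" if "0 < g" for x g
        using that by simp
      from this[OF Gz] show ?thesis .
    qed
    also have "\<dots> \<le> K * (c * (H / P) / Gamma z)"
      using KK c H P Gz by (intro mult_right_mono) auto
    finally have 2: "c * (real (2 * k) + 1) powr (- \<zeta>) \<le> K * (c * (H / P) / Gamma z)" .
    show ?thesis using 1 2 unfolding B c_def by simp
  qed
  then show ?thesis using K by blast
qed

text \<open>The factor 4^k in the coefficient bounds cancels the halving in (w/2)^(2k), so after
  removing the common power (w/2)^(\<zeta> - 1/2) the series is comparable, term by term, with the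
  even exponential sum for the exponent -\<zeta>.\<close>

lemma bessel_I_bounds:
  fixes \<zeta> :: real
  assumes \<zeta>: "\<zeta> > -1/2"
  shows "\<exists>K>0. \<forall>w>0. bessel_I (\<zeta> - 1/2) w \<le> K * (w powr (\<zeta> - 1/2) * (exp w * (1 + w) powr (- \<zeta>)))
    \<and> w powr (\<zeta> - 1/2) * (exp w * (1 + w) powr (- \<zeta>)) \<le> K * bessel_I (\<zeta> - 1/2) w"
proof -
  obtain K1 where K1: "0 < K1" "\<And>w. 0 \<le> w \<Longrightarrow> summable (\<lambda>k. w ^ (2 * k) / fact (2 * k) * (real (2 * k) + 1) powr (- \<zeta>))"
    "\<And>w. 0 \<le> w \<Longrightarrow> (\<Sum>k. w ^ (2 * k) / fact (2 * k) * (real (2 * k) + 1) powr (- \<zeta>)) \<le> K1 * (exp w * (1 + w) powr (- \<zeta>))"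
    "\<And>w. 0 \<le> w \<Longrightarrow> exp w * (1 + w) powr (- \<zeta>) \<le> K1 * (\<Sum>k. w ^ (2 * k) / fact (2 * k) * (real (2 * k) + 1) powr (- \<zeta>))"
    using even_exp_sum_bounds[of "- \<zeta>"] by blast
  obtain K2 where K2: "0 < K2"
    "\<And>k. 1 / (fact k * Gamma (real k + (\<zeta> - 1/2) + 1)) \<le> K2 * (4 ^ k / fact (2 * k) * (real (2 * k) + 1) powr (- \<zeta>))"
    "\<And>k. 4 ^ k / fact (2 * k) * (real (2 * k) + 1) powr (- \<zeta>) \<le> K2 * (1 / (fact k * Gamma (real k + (\<zeta> - 1/2) + 1)))"
    using bessel_coeff_bounds[OF \<zeta>] by blast
  define N where "N = (2::real) powr (\<zeta> - 1/2)"
  have N: "0 < N" by (simp add: N_def)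
  define K where "K = K1 * K2 * (N + 1 / N)"
  have K: "0 < K" using K1 K2 N by (simp add: K_def add_pos_pos)
  have KK: "K1 * K2 / N \<le> K" "K1 * K2 * N \<le> K"
    unfolding K_def using K1(1) K2(1) N by (auto simp: distrib_left)
  have "bessel_I (\<zeta> - 1/2) w \<le> K * (w powr (\<zeta> - 1/2) * (exp w * (1 + w) powr (- \<zeta>)))
    \<and> w powr (\<zeta> - 1/2) * (exp w * (1 + w) powr (- \<zeta>)) \<le> K * bessel_I (\<zeta> - 1/2) w" if w: "0 < w" for w
  proof -
    define h where "h k = w ^ (2 * k) / fact (2 * k) * (real (2 * k) + 1) powr (- \<zeta>)" for k
    define g where "g k = (w / 2) ^ (2 * k) * (1 / (fact k * Gamma (real k + (\<zeta> - 1/2) + 1)))" for k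
    define W where "W = w powr (\<zeta> - 1/2)"
    have W: "0 < W" using w by (simp add: W_def)
    have w4: "(w / 2) ^ (2 * k) * (4 ^ k / fact (2 * k) * y) = w ^ (2 * k) / fact (2 * k) * y" for k y
      by (simp add: power_divide power_mult)
    have sh: "summable h" unfolding h_def using K1(2) w by simp
    have gpos: "0 \<le> g k" for k
    proof -
      have "0 < Gamma (real k + (\<zeta> - 1/2) + 1)" using \<zeta> by (intro Gamma_real_pos) auto
      then show ?thesis using w by (simp add: g_def)
    qed
    have w2: "0 \<le> (w / 2) ^ (2 * k)" for k using w by simp
    have gh: "g k \<le> K2 * h k" for k
      using mult_left_mono[OF K2(2)[of k] w2[of k]] unfolding g_def h_def w4[symmetric]
      by (simp only: mult.left_commute[of K2])
    have hg: "h k \<le> K2 * g k" for k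
      using mult_left_mono[OF K2(3)[of k] w2[of k]] unfolding g_def h_def w4[symmetric]
      by (simp only: mult.left_commute[of K2])
    have sg: "summable g"
      by (rule summable_comparison_test[of _ "\<lambda>k. K2 * h k"]) (use gh gpos sh in \<open>auto intro: summable_mult\<close>)
    have "bessel_I (\<zeta> - 1/2) w = (\<Sum>k. W / N * g k)"
      unfolding bessel_I_def
    proof (intro suminf_cong)
      fix k
      have "(w / 2) powr (2 * real k + (\<zeta> - 1/2)) = (w / 2) powr real (2 * k) * (w / 2) powr (\<zeta> - 1/2)"
        by (simp add: powr_add)
      also have "\<dots> = (w / 2) ^ (2 * k) * (W / N)"
        using w by (subst powr_realpow) (auto simp: W_def N_def powr_divide)
      finally show "(w / 2) powr (2 * real k + (\<zeta> - 1/2)) / (fact k * Gamma (real k + (\<zeta> - 1/2) + 1)) = W / N * g k"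
        by (simp add: g_def)
    qed
    also have "\<dots> = W / N * suminf g" by (rule suminf_mult[OF sg])
    finally have B: "bessel_I (\<zeta> - 1/2) w = W / N * suminf g" .
    have hs: "suminf h = (\<Sum>k. w ^ (2 * k) / fact (2 * k) * (real (2 * k) + 1) powr (- \<zeta>))"
      by (intro suminf_cong) (simp only: h_def)
    define e where "e = exp w * (1 + w) powr (- \<zeta>)"
    have e: "0 \<le> e" using w by (simp add: e_def)
    have g1: "suminf g \<le> K2 * (K1 * e)"
    proof -
      have "suminf g \<le> (\<Sum>k. K2 * h k)" by (intro suminf_le gh sg summable_mult sh)
      also have "\<dots> = K2 * suminf h" by (rule suminf_mult[OF sh])
      also have "\<dots> \<le> K2 * (K1 * e)" using K1(3)[of w] K2(1) w unfolding hs e_def by (intro mult_left_mono) auto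
      finally show ?thesis .
    qed
    have g2: "e \<le> K1 * (K2 * suminf g)"
    proof -
      have "e \<le> K1 * suminf h" using K1(4)[of w] w unfolding hs e_def by simp
      also have "suminf h \<le> (\<Sum>k. K2 * g k)" by (intro suminf_le hg sh summable_mult sg)
      then have "K1 * suminf h \<le> K1 * (K2 * suminf g)" using K1(1) suminf_mult[OF sg, of K2] by simp
      finally show ?thesis .
    qed
    have sg0: "0 \<le> suminf g" by (intro suminf_nonneg sg gpos)
    have "bessel_I (\<zeta> - 1/2) w \<le> W / N * (K2 * (K1 * e))"
      unfolding B using W N g1 by (intro mult_left_mono) auto
    also have "\<dots> = (K1 * K2 / N) * (W * e)" by simp
    also have "\<dots> \<le> K * (W * e)" using KK W e by (intro mult_right_mono) auto
    finally have 1: "bessel_I (\<zeta> - 1/2) w \<le> K * (W * e)" .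
    have "W * e \<le> W * (K1 * (K2 * suminf g))" using W g2 by (intro mult_left_mono) auto
    also have "\<dots> = (K1 * K2 * N) * (W / N * suminf g)" using N by simp
    also have "\<dots> \<le> K * (W / N * suminf g)" using KK W N sg0 by (intro mult_right_mono) auto
    finally have 2: "W * e \<le> K * bessel_I (\<zeta> - 1/2) w" unfolding B .
    from 1 2 show ?thesis by (simp add: W_def e_def)
  qed
  then show ?thesis using K by blast
qed

section \<open>Two-sided kernel bounds\<close>

text \<open>Covers both regimes in one formula: where r s is small against t it behaves like
  t^(-\<zeta> - 1/2), where r s is large like a one-dimensional Gaussian times (r
  s)^(-\<zeta>).\<close>

definition heat_kernel :: "real \<Rightarrow> real \<Rightarrow> real \<Rightarrow> real \<Rightarrow> real" where
  "heat_kernel \<zeta> t r s = t powr (-1/2) * (t + r * s) powr (- \<zeta>) * exp (- (r - s)\<^sup>2 / (4 * t))"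

text \<open>What a single subordinator time contributes: with T = t^(2/\<alpha>), times of order M =
  T + (r - s)^2 have probability of order t M^(-\<alpha>/2), and there the heat kernel has order
  M^(-1/2) (M + r s)^(-\<zeta>). Finally M + 4 r s = T + (r + s)^2.\<close>

definition stable_kernel :: "real \<Rightarrow> real \<Rightarrow> real \<Rightarrow> real \<Rightarrow> real \<Rightarrow> real" where
  "stable_kernel \<zeta> \<alpha> t r s = t * (t powr (2 / \<alpha>) + (r - s)\<^sup>2) powr (- (1 + \<alpha>) / 2)
     * (t powr (2 / \<alpha>) + (r + s)\<^sup>2) powr (- \<zeta>)"

lemma heat_kernel_pos: "0 < t \<Longrightarrow> 0 < r \<Longrightarrow> 0 < s \<Longrightarrow> 0 < heat_kernel \<zeta> t r s"
  unfolding heat_kernel_def by (intro mult_pos_pos) (auto simp: add_pos_pos less_imp_neq[symmetric])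

text \<open>With w = r s / (2t), the factor exp(w) from the Bessel function completes the square in
  the Gaussian, the powers of r s cancel, and (2t)^(-\<zeta>) (1 + w)^(-\<zeta>) merges into (2t + r
  s)^(-\<zeta>). Only the factor 2 in front of t remains to be removed.\<close>

lemma p2_bounds:
  fixes \<zeta> :: real
  assumes \<zeta>: "\<zeta> > -1/2"
  shows "\<exists>K>0. \<forall>t r s. 0 < t \<and> 0 < r \<and> 0 < s \<longrightarrow>
    p2 \<zeta> t r s \<le> K * heat_kernel \<zeta> t r s \<and> heat_kernel \<zeta> t r s \<le> K * p2 \<zeta> t r s"
proof -
  obtain K1 where K1: "0 < K1"
    "\<And>w. 0 < w \<Longrightarrow> bessel_I (\<zeta> - 1/2) w \<le> K1 * (w powr (\<zeta> - 1/2) * (exp w * (1 + w) powr (- \<zeta>)))"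
    "\<And>w. 0 < w \<Longrightarrow> w powr (\<zeta> - 1/2) * (exp w * (1 + w) powr (- \<zeta>)) \<le> K1 * bessel_I (\<zeta> - 1/2) w"
    using bessel_I_bounds[OF \<zeta>] by blast
  define L where "L = (2::real) powr \<bar>- \<zeta>\<bar>"
  define d where "d = (2::real) powr (-1/2)"
  have L: "0 < L" by (simp add: L_def)
  have d: "0 < d" by (simp add: d_def)
  define K where "K = K1 * L * (d + 1 / d)"
  have K: "0 < K" using K1 L d by (simp add: K_def add_pos_pos)
  have KK: "K1 * L * d \<le> K" "K1 * L * (1 / d) \<le> K"
    unfolding K_def using K1(1) L d by (intro mult_left_mono; simp)+
  have "p2 \<zeta> t r s \<le> K * heat_kernel \<zeta> t r s \<and> heat_kernel \<zeta> t r s \<le> K * p2 \<zeta> t r s"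
    if t: "0 < t" and r: "0 < r" and s: "0 < s" for t r s
  proof -
    define w where "w = r * s / (2 * t)"
    define A where "A = (r * s) powr (1/2 - \<zeta>) / (2 * t) * exp (- (r\<^sup>2 + s\<^sup>2) / (4 * t))"
    define g where "g = exp (- (r - s)\<^sup>2 / (4 * t))"
    have w: "0 < w" using t r s by (simp add: w_def)
    have A: "0 \<le> A" using t by (simp add: A_def)
    have g: "0 < g" by (simp add: g_def)
    have p2: "p2 \<zeta> t r s = A * bessel_I (\<zeta> - 1/2) w"
      by (simp add: p2_def A_def w_def)
    have "A * (w powr (\<zeta> - 1/2) * (exp w * (1 + w) powr (- \<zeta>)))
      = ((r * s) powr (1/2 - \<zeta>) * w powr (\<zeta> - 1/2) / (2 * t)) * (exp (- (r\<^sup>2 + s\<^sup>2) / (4 * t)) * exp w) * (1 + w) powr (- \<zeta>)"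
      by (simp add: A_def mult_ac)
    also have "exp (- (r\<^sup>2 + s\<^sup>2) / (4 * t)) * exp w = g"
    proof -
      have "- (r\<^sup>2 + s\<^sup>2) / (4 * t) + w = - (r - s)\<^sup>2 / (4 * t)"
        using t by (simp add: w_def field_simps power2_eq_square)
      then show ?thesis by (simp add: g_def exp_add[symmetric])
    qed
    also have "(r * s) powr (1/2 - \<zeta>) * w powr (\<zeta> - 1/2) / (2 * t) = (2 * t) powr (-1/2) * (2 * t) powr (- \<zeta>)"
    proof -
      have "w powr (\<zeta> - 1/2) = (r * s) powr (\<zeta> - 1/2) / (2 * t) powr (\<zeta> - 1/2)"
        unfolding w_def using t r s by (subst powr_divide) auto
      then have "(r * s) powr (1/2 - \<zeta>) * w powr (\<zeta> - 1/2) / (2 * t)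
        = ((r * s) powr (1/2 - \<zeta>) * (r * s) powr (\<zeta> - 1/2)) * ((1 / (2 * t)) * (1 / (2 * t) powr (\<zeta> - 1/2)))"
        by simp
      also have "(r * s) powr (1/2 - \<zeta>) * (r * s) powr (\<zeta> - 1/2) = 1"
        unfolding powr_add[symmetric] using r s by simp
      also have "(1 / (2 * t)) * (1 / (2 * t) powr (\<zeta> - 1/2)) = (2 * t) powr (- 1) * (2 * t) powr (- (\<zeta> - 1/2))"
      proof -
        have "(2 * t) powr (- 1) = 1 / (2 * t)"
          using powr_minus_divide[of "2 * t" 1] t by simp
        then show ?thesis by (simp only: powr_minus_divide)
      qed
      also have "\<dots> = (2 * t) powr (-1/2) * (2 * t) powr (- \<zeta>)"
      proof -
        have "- 1 + - (\<zeta> - 1/2) = -1/2 + - \<zeta>" by simp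
        then show ?thesis by (simp only: powr_add[symmetric])
      qed
      finally show ?thesis by (simp only: mult_1)
    qed
    also have "(2 * t) powr (-1/2) = d * t powr (-1/2)"
      unfolding d_def by (rule powr_mult)
    finally have "A * (w powr (\<zeta> - 1/2) * (exp w * (1 + w) powr (- \<zeta>)))
      = d * (t powr (-1/2) * ((2 * t) powr (- \<zeta>) * (1 + w) powr (- \<zeta>)) * g)"
      by (simp add: mult_ac)
    also have "(2 * t) powr (- \<zeta>) * (1 + w) powr (- \<zeta>) = (2 * t + r * s) powr (- \<zeta>)"
    proof -
      have "2 * t * (1 + w) = 2 * t + r * s" using t by (simp add: w_def field_simps)
      moreover have "(2 * t * (1 + w)) powr (- \<zeta>) = (2 * t) powr (- \<zeta>) * (1 + w) powr (- \<zeta>)"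
        by (rule powr_mult)
      ultimately show ?thesis by simp
    qed
    finally have eq: "A * (w powr (\<zeta> - 1/2) * (exp w * (1 + w) powr (- \<zeta>)))
      = d * (t powr (-1/2) * (2 * t + r * s) powr (- \<zeta>) * g)" .
    have rs: "0 < r * s" using r s by simp
    have c1: "(2 * t + r * s) powr (- \<zeta>) \<le> L * (t + r * s) powr (- \<zeta>)"
      unfolding L_def using t rs by (intro powr_comparable) auto
    have c2: "(t + r * s) powr (- \<zeta>) \<le> L * (2 * t + r * s) powr (- \<zeta>)"
      unfolding L_def using t rs by (intro powr_comparable) auto
    have hk: "0 < heat_kernel \<zeta> t r s" using t r s by (rule heat_kernel_pos)
    have "p2 \<zeta> t r s \<le> A * (K1 * (w powr (\<zeta> - 1/2) * (exp w * (1 + w) powr (- \<zeta>))))"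
      unfolding p2 using A by (intro mult_left_mono K1(2) w)
    also have "\<dots> = K1 * d * (t powr (-1/2) * (2 * t + r * s) powr (- \<zeta>) * g)"
      unfolding mult.left_commute[of A K1] eq by simp
    also have "\<dots> \<le> K1 * d * (t powr (-1/2) * (L * (t + r * s) powr (- \<zeta>)) * g)"
      using K1(1) d g c1 by (intro mult_left_mono mult_right_mono) auto
    also have "\<dots> = K1 * L * d * heat_kernel \<zeta> t r s"
      by (simp add: heat_kernel_def g_def mult_ac)
    also have "\<dots> \<le> K * heat_kernel \<zeta> t r s"
      using KK hk by (intro mult_right_mono) auto
    finally have 1: "p2 \<zeta> t r s \<le> K * heat_kernel \<zeta> t r s" .
    have le2: "A * (w powr (\<zeta> - 1/2) * (exp w * (1 + w) powr (- \<zeta>))) \<le> K1 * p2 \<zeta> t r s"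
      unfolding p2 mult.left_commute[of K1 A] using A by (intro mult_left_mono K1(3) w)
    have "heat_kernel \<zeta> t r s \<le> t powr (-1/2) * (L * (2 * t + r * s) powr (- \<zeta>)) * g"
      unfolding heat_kernel_def g_def[symmetric] using c2 g by (intro mult_left_mono mult_right_mono) auto
    also have "\<dots> = L * (1 / d) * (d * (t powr (-1/2) * (2 * t + r * s) powr (- \<zeta>) * g))"
      using d by simp
    also have "\<dots> \<le> L * (1 / d) * (K1 * p2 \<zeta> t r s)"
      unfolding eq[symmetric] using L d le2 by (intro mult_left_mono) auto
    finally have h2: "heat_kernel \<zeta> t r s \<le> K1 * L * (1 / d) * p2 \<zeta> t r s" by (simp add: mult_ac)
    have "0 \<le> K1 * L * (1 / d) * p2 \<zeta> t r s" using h2 hk by linarith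
    then have "0 \<le> p2 \<zeta> t r s"
      by (rule zero_le_mult_imp_nonneg) (use K1(1) L d in simp)
    then have "K1 * L * (1 / d) * p2 \<zeta> t r s \<le> K * p2 \<zeta> t r s"
      using KK by (intro mult_right_mono) auto
    with h2 1 show ?thesis by linarith
  qed
  then show ?thesis using K by blast
qed

lemma p2_measurable [measurable]: "(\<lambda>t. p2 \<zeta> t r s) \<in> borel_measurable borel"
  unfolding p2_def bessel_I_def by measurable

text \<open>The subordinator at time \<open>t\<close>; only its Laplace transform enters the estimates.\<close>

definition stable_law :: "real \<Rightarrow> real \<Rightarrow> real measure \<Rightarrow> bool" where
  "stable_law \<beta> t N \<longleftrightarrow> prob_space N \<and> sets N = sets borel \<and> (AE \<tau> in N. 0 < \<tau>) \<and>
     (\<forall>l\<ge>0. (LINT \<tau>|N. exp (- l * \<tau>)) = exp (- t * l powr \<beta>))"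

text \<open>The only place where the Hilbert choice is opened. Afterwards integrals against the
  density are expectations, and the chosen function does not appear again.\<close>

lemma stable_law_of_stable_density:
  assumes \<alpha>: "0 < \<alpha>" "\<alpha> < 2" and t: "0 < t"
  shows "\<exists>N. stable_law (\<alpha> / 2) t N \<and>
    (\<forall>h\<in>borel_measurable borel. (LINT \<tau>:{0<..}|lborel. h \<tau> * stable_density \<alpha> t \<tau>) = (LINT \<tau>|N. h \<tau> :: real))"
proof -
  define f where "f = stable_density \<alpha> t"
  have ex: "\<exists>f. f \<in> borel_measurable lborel \<and> (\<forall>\<tau>. 0 \<le> f \<tau>) \<and> set_integrable lborel {0<..} f \<and>
      (\<forall>l\<ge>0. exp (- t * l powr (\<alpha> / 2)) = (LINT \<tau>:{0<..}|lborel. exp (- \<tau> * l) * f \<tau>))"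
    using \<alpha> t by (intro exists_stable_density) auto
  from someI_ex[OF ex, folded stable_density_def f_def]
  have [measurable]: "f \<in> borel_measurable borel" and f0: "\<And>\<tau>. 0 \<le> f \<tau>" and fi: "set_integrable lborel {0<..} f"
    and fl: "\<And>l. 0 \<le> l \<Longrightarrow> exp (- t * l powr (\<alpha> / 2)) = (LINT \<tau>:{0<..}|lborel. exp (- \<tau> * l) * f \<tau>)"
    by auto
  define g where "g \<tau> = indicator {0<..} \<tau> * f \<tau>" for \<tau>
  have [measurable]: "g \<in> borel_measurable borel" unfolding g_def by measurable
  have g0: "0 \<le> g \<tau>" for \<tau> using f0 by (simp add: g_def)
  have gi: "integrable lborel g" using fi by (simp add: set_integrable_def g_def[abs_def])
  define N where "N = density lborel (\<lambda>\<tau>. ennreal (g \<tau>))"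
  have int: "(LINT \<tau>:{0<..}|lborel. h \<tau> * f \<tau>) = (LINT \<tau>|N. h \<tau>)"
    if [measurable]: "h \<in> borel_measurable borel" for h :: "real \<Rightarrow> real"
    unfolding N_def set_lebesgue_integral_def using g0
    by (subst integral_density) (auto simp: g_def mult_ac)
  have lap: "(LINT \<tau>|N. exp (- l * \<tau>)) = exp (- t * l powr (\<alpha> / 2))" if "0 \<le> l" for l
    using fl[OF that] by (subst int[symmetric]) (auto simp: mult.commute)
  have "prob_space N"
  proof
    have "emeasure N (space N) = (\<integral>\<^sup>+\<tau>. ennreal (g \<tau>) \<partial>lborel)"
      by (simp add: N_def emeasure_density)
    also have "\<dots> = ennreal (LINT \<tau>|lborel. g \<tau>)"
      using gi g0 by (intro nn_integral_eq_integral) auto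
    \<comment> \<open>The Laplace identity at l = 0, where \<open>0 powr (\<alpha> / 2) = 0\<close>,
      is the statement of total mass one.\<close>
    also have "(LINT \<tau>|lborel. g \<tau>) = 1"
      using fl[of 0] by (simp add: set_lebesgue_integral_def g_def)
    finally show "emeasure N (space N) = 1" by simp
  qed
  moreover have "AE \<tau> in N. 0 < \<tau>"
    unfolding N_def by (subst AE_density) (auto simp: g_def indicator_def)
  ultimately have "stable_law (\<alpha> / 2) t N"
    unfolding stable_law_def using lap by (auto simp: N_def)
  then show ?thesis using int unfolding f_def by blast
qed

section \<open>Expectations under the subordinator\<close>

lemma stable_law_integrable_exp:
  assumes "stable_law \<beta> t N" "0 \<le> l"
  shows "integrable N (\<lambda>\<tau>. exp (- l * \<tau>))"
proof -
  interpret prob_space N using assms by (simp add: stable_law_def)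
  have [measurable_cong]: "sets N = sets borel" using assms by (simp add: stable_law_def)
  have "AE \<tau> in N. 0 < \<tau>" using assms by (simp add: stable_law_def)
  then have "AE \<tau> in N. norm (exp (- l * \<tau>)) \<le> 1"
    by eventually_elim (use assms in auto)
  then show ?thesis by (intro integrable_const_bound[where B = 1]) auto
qed

lemma stable_law_one_minus_exp:
  assumes "stable_law \<beta> t N" "0 \<le> l"
  shows "integrable N (\<lambda>\<tau>. 1 - exp (- l * \<tau>))"
    and "(LINT \<tau>|N. 1 - exp (- l * \<tau>)) = 1 - exp (- t * l powr \<beta>)"
proof -
  interpret prob_space N using assms by (simp add: stable_law_def)
  have i: "integrable N (\<lambda>\<tau>. exp (- l * \<tau>))" by (rule stable_law_integrable_exp[OF assms])
  show "integrable N (\<lambda>\<tau>. 1 - exp (- l * \<tau>))" using i by (intro Bochner_Integration.integrable_diff) auto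
  have "(LINT \<tau>|N. 1 - exp (- l * \<tau>)) = (LINT \<tau>|N. 1) - (LINT \<tau>|N. exp (- l * \<tau>))"
    using i by (intro Bochner_Integration.integral_diff) auto
  then show "(LINT \<tau>|N. 1 - exp (- l * \<tau>)) = 1 - exp (- t * l powr \<beta>)"
    using assms by (simp add: stable_law_def prob_space)
qed

text \<open>Both sides are compared with min(1, x): the left one is bounded for x \<ge> 1 and
  vanishes faster than x at 0, where the exponential beats every power of 1/x. The right-hand
  function is the one with known expectation.\<close>

lemma powr_exp_inverse_le:
  fixes a :: real
  assumes a: "0 < a"
  shows "\<exists>C>0. \<forall>x>0. x powr (- a) * exp (- 1 / (4 * x)) \<le> C * (1 - exp (- x))"
proof -
  obtain K where K: "0 < K" "\<And>x. 0 \<le> x \<Longrightarrow> (1 + x) powr (a + 1) \<le> K * exp (1/4 * x)"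
    using powr_le_exp[of "1/4" "a + 1"] by auto
  have "x powr (- a) * exp (- 1 / (4 * x)) \<le> 2 * (1 + K) * (1 - exp (- x))" if x: "0 < x" for x
  proof -
    have "x powr (- a) * exp (- 1 / (4 * x)) \<le> (1 + K) * min 1 x"
    proof (cases "1 \<le> x")
      case True
      have "x powr (- a) \<le> 1 powr (- a)" using True a by (intro powr_mono2') auto
      moreover have "exp (- 1 / (4 * x)) \<le> 1" using x by simp
      ultimately have "x powr (- a) * exp (- 1 / (4 * x)) \<le> 1 * 1" by (intro mult_mono) auto
      then show ?thesis using True K(1) by simp
    next
      case False
      have "(1 / x) powr (a + 1) \<le> (1 + 1 / x) powr (a + 1)" using x a by (intro powr_mono2) auto
      also have "\<dots> \<le> K * exp (1/4 * (1 / x))" using K(2)[of "1 / x"] x by simp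
      finally have "(1 / x) powr (a + 1) * exp (- 1 / (4 * x)) \<le> K * exp (1/4 * (1 / x)) * exp (- 1 / (4 * x))"
        by (intro mult_right_mono) auto
      also have "\<dots> = K" by (simp add: mult.assoc exp_add[symmetric])
      finally have *: "(1 / x) powr (a + 1) * exp (- 1 / (4 * x)) \<le> K" .
      have "x powr (- a) = x * (1 / x) powr (a + 1)"
        using x by (simp add: powr_divide powr_minus powr_add field_simps)
      then have "x powr (- a) * exp (- 1 / (4 * x)) = x * ((1 / x) powr (a + 1) * exp (- 1 / (4 * x)))" by simp
      also have "\<dots> \<le> x * K" using * x by (intro mult_left_mono) auto
      finally show ?thesis using False x by (simp add: algebra_simps)
    qed
    also have "\<dots> \<le> (1 + K) * (2 * (1 - exp (- x)))"
      using one_minus_exp_minus_ge[of x] x K(1) by (intro mult_left_mono) auto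
    finally show ?thesis by (simp add: algebra_simps)
  qed
  then show ?thesis using K(1) by (intro exI[of _ "2 * (1 + K)"]) auto
qed

text \<open>The pointwise bound at x = \<tau> / D, followed by E[1 - exp(-\<tau> / D)] \<le> t
  D^(-\<beta>). The result has the right order when D is at least the natural scale t^(1/\<beta>) of
  the subordinator.\<close>

lemma stable_law_far_moment:
  fixes a \<beta> :: real
  assumes a: "0 < a"
  shows "\<exists>C>0. \<forall>t N D. 0 < t \<and> 0 < D \<and> stable_law \<beta> t N \<longrightarrow>
    (\<integral>\<^sup>+\<tau>. ennreal (\<tau> powr (- a) * exp (- D / (4 * \<tau>))) \<partial>N) \<le> ennreal (C * (t * D powr (- a - \<beta>)))"
proof -
  obtain C where C: "0 < C" "\<And>x. 0 < x \<Longrightarrow> x powr (- a) * exp (- 1 / (4 * x)) \<le> C * (1 - exp (- x))"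
    using powr_exp_inverse_le[OF a] by auto
  have "(\<integral>\<^sup>+\<tau>. ennreal (\<tau> powr (- a) * exp (- D / (4 * \<tau>))) \<partial>N) \<le> ennreal (C * (t * D powr (- a - \<beta>)))"
    if t: "0 < t" and D: "0 < D" and N: "stable_law \<beta> t N" for t N D
  proof -
    have AE0: "AE \<tau> in N. 0 < \<tau>" using N by (simp add: stable_law_def)
    have nn: "AE \<tau> in N. 0 \<le> C * D powr (- a) * (1 - exp (- (1 / D) * \<tau>))"
      using AE0 by eventually_elim (use C(1) D in \<open>intro mult_nonneg_nonneg; simp\<close>)
    from AE0 have pt: "AE \<tau> in N. \<tau> powr (- a) * exp (- D / (4 * \<tau>)) \<le> C * D powr (- a) * (1 - exp (- (1 / D) * \<tau>)) \<and> 0 < \<tau>"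
    proof eventually_elim
      case (elim \<tau>)
      have "(\<tau> / D) powr (- a) * exp (- 1 / (4 * (\<tau> / D))) \<le> C * (1 - exp (- (\<tau> / D)))"
        using C(2)[of "\<tau> / D"] elim D by simp
      then have "D powr (- a) * ((\<tau> / D) powr (- a) * exp (- 1 / (4 * (\<tau> / D)))) \<le> D powr (- a) * (C * (1 - exp (- (\<tau> / D))))"
        by (intro mult_left_mono) auto
      also have "D powr (- a) * ((\<tau> / D) powr (- a) * exp (- 1 / (4 * (\<tau> / D)))) = \<tau> powr (- a) * exp (- D / (4 * \<tau>))"
        using D elim by (simp add: powr_divide)
      finally show ?case using elim by (simp add: mult_ac)
    qed
    have "(\<integral>\<^sup>+\<tau>. ennreal (\<tau> powr (- a) * exp (- D / (4 * \<tau>))) \<partial>N)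
      \<le> (\<integral>\<^sup>+\<tau>. ennreal (C * D powr (- a) * (1 - exp (- (1 / D) * \<tau>))) \<partial>N)"
      using pt by (intro nn_integral_mono_AE) (auto elim!: eventually_mono intro!: ennreal_leI)
    also have "\<dots> = ennreal (LINT \<tau>|N. C * D powr (- a) * (1 - exp (- (1 / D) * \<tau>)))"
      using stable_law_one_minus_exp(1)[OF N, of "1 / D"] D nn
      by (intro nn_integral_eq_integral integrable_mult_right) auto
    also have "(LINT \<tau>|N. C * D powr (- a) * (1 - exp (- (1 / D) * \<tau>))) = C * D powr (- a) * (1 - exp (- t * (1 / D) powr \<beta>))"
      using stable_law_one_minus_exp[OF N, of "1 / D"] D by simp
    also have "\<dots> \<le> C * D powr (- a) * (t * (1 / D) powr \<beta>)"
      using C(1) exp_ge_add_one_self[of "- t * (1 / D) powr \<beta>"] by (intro mult_left_mono) auto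
    also have "\<dots> = C * (t * D powr (- a - \<beta>))"
      using D by (simp add: powr_divide powr_diff)
    finally show ?thesis by (simp add: ennreal_leI)
  qed
  then show ?thesis using C(1) by blast
qed

text \<open>Near 0 the integrand, possibly singular, is dominated by a multiple of the Gamma
  integrand; on x \<ge> 1 the stretched exponential beats x^(a + 1) and leaves a multiple of 1 /
  x^2.\<close>

lemma nn_integral_powr_exp_powr_finite:
  fixes a \<beta> :: real
  assumes a: "0 < a" and \<beta>: "0 < \<beta>"
  shows "(\<integral>\<^sup>+x. ennreal (indicator {0<..} x * (x powr (a - 1) * exp (- (x powr \<beta>)))) \<partial>lborel) < \<infinity>"
proof -
  obtain K where K: "0 < K" "\<And>x. 0 \<le> x \<Longrightarrow> (1 + x) powr ((a + 1) / \<beta>) \<le> K * exp (1 * x)"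
    using powr_le_exp[of 1 "(a + 1) / \<beta>"] by auto
  have pt: "indicator {0<..} x * (x powr (a - 1) * exp (- (x powr \<beta>)))
    \<le> exp 1 * (indicator {0<..} x * (x powr (a - 1) * exp (- 1 * x))) + K * (1 / x\<^sup>2) * indicator {1..} x" for x :: real
  proof (cases "0 < x")
    case True
    show ?thesis
    proof (cases "x < 1")
      case lt: True
      have "exp (- (x powr \<beta>)) \<le> exp 1 * exp (- 1 * x)"
        using lt True by (simp add: exp_add[symmetric]) (smt (verit) powr_ge_zero)
      then have "x powr (a - 1) * exp (- (x powr \<beta>)) \<le> x powr (a - 1) * (exp 1 * exp (- 1 * x))"
        by (intro mult_left_mono) auto
      then show ?thesis using True lt by (simp add: mult_ac)
    next
      case False
      have "(x powr \<beta>) powr ((a + 1) / \<beta>) \<le> (1 + x powr \<beta>) powr ((a + 1) / \<beta>)"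
        using a \<beta> by (intro powr_mono2) auto
      also have "\<dots> \<le> K * exp (x powr \<beta>)" using K(2)[of "x powr \<beta>"] by simp
      finally have "x powr (a + 1) * exp (- (x powr \<beta>)) \<le> K * exp (x powr \<beta>) * exp (- (x powr \<beta>))"
        using \<beta> by (intro mult_right_mono) (auto simp: powr_powr)
      then have "x powr (a + 1) * exp (- (x powr \<beta>)) \<le> K" by (simp add: mult.assoc exp_add[symmetric])
      moreover have "x powr (a + 1) = x\<^sup>2 * x powr (a - 1)"
        using True by (simp add: powr_add powr_diff power2_eq_square)
      ultimately have "x powr (a - 1) * exp (- (x powr \<beta>)) \<le> K * (1 / x\<^sup>2)"
        using True by (simp add: field_simps)
      then show ?thesis using True False by (simp add: add_increasing)
    qed
  qed auto
  have "(\<integral>\<^sup>+x. ennreal (indicator {0<..} x * (x powr (a - 1) * exp (- (x powr \<beta>)))) \<partial>lborel)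
    \<le> (\<integral>\<^sup>+x. ennreal (exp 1) * ennreal (indicator {0<..} x * (x powr (a - 1) * exp (- 1 * x)))
        + ennreal (K * (1 / x\<^sup>2)) * indicator {1..} x \<partial>lborel)"
  proof (intro nn_integral_mono)
    fix x :: real
    have "ennreal (indicator {0<..} x * (x powr (a - 1) * exp (- (x powr \<beta>))))
      \<le> ennreal (exp 1 * (indicator {0<..} x * (x powr (a - 1) * exp (- 1 * x))) + K * (1 / x\<^sup>2) * indicator {1..} x)"
      by (rule ennreal_leI[OF pt])
    also have "\<dots> = ennreal (exp 1) * ennreal (indicator {0<..} x * (x powr (a - 1) * exp (- 1 * x)))
        + ennreal (K * (1 / x\<^sup>2)) * indicator {1..} x"
      using K(1) by (subst ennreal_plus) (auto simp: ennreal_mult indicator_def)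
    finally show "ennreal (indicator {0<..} x * (x powr (a - 1) * exp (- (x powr \<beta>))))
      \<le> ennreal (exp 1) * ennreal (indicator {0<..} x * (x powr (a - 1) * exp (- 1 * x)))
        + ennreal (K * (1 / x\<^sup>2)) * indicator {1..} x" .
  qed
  also have "\<dots> = ennreal (exp 1) * (\<integral>\<^sup>+x. ennreal (indicator {0<..} x * (x powr (a - 1) * exp (- 1 * x))) \<partial>lborel)
    + (\<integral>\<^sup>+x. ennreal (K * (1 / x\<^sup>2)) * indicator {1..} x \<partial>lborel)"
    by (subst nn_integral_add) (auto simp: nn_integral_cmult)
  also have "(\<integral>\<^sup>+x. ennreal (K * (1 / x\<^sup>2)) * indicator {1..} x \<partial>lborel) = ennreal (0 - (- K / 1))"
  proof (rule nn_integral_FTC_atLeast)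
    show "((\<lambda>x. - K / x) \<longlongrightarrow> 0) at_top" by real_asymp
    show "DERIV (\<lambda>x. - K / x) x :> K * (1 / x\<^sup>2)" if "1 \<le> x" for x
      using that by (auto intro!: derivative_eq_intros simp: power2_eq_square)
  qed (use K(1) in auto)
  also have "(\<integral>\<^sup>+x. ennreal (indicator {0<..} x * (x powr (a - 1) * exp (- 1 * x))) \<partial>lborel) = ennreal (Gamma a * 1 powr (- a))"
    using a by (intro nn_integral_powr_exp) auto
  also have "ennreal (exp 1) * \<dots> + ennreal (0 - (- K / 1)) < \<infinity>"
    by (simp add: ennreal_mult_less_top)
  finally show ?thesis .
qed

text \<open>A negative power is a Gamma integral of exponentials in \<tau>. Tonelli brings in the
  Laplace transform, and rescaling by T = t^(1/\<beta>) extracts T^(-a), leaving a finite integral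
  independent of t.\<close>

lemma stable_law_negative_moment:
  fixes a \<beta> :: real
  assumes a: "0 < a" and \<beta>: "0 < \<beta>"
  shows "\<exists>C>0. \<forall>t N. 0 < t \<and> stable_law \<beta> t N \<longrightarrow>
    (\<integral>\<^sup>+\<tau>. ennreal (\<tau> powr (- a)) \<partial>N) \<le> ennreal (C * (t powr (1 / \<beta>)) powr (- a))"
proof -
  define I where "I = (\<integral>\<^sup>+x. ennreal (indicator {0<..} x * (x powr (a - 1) * exp (- (x powr \<beta>)))) \<partial>lborel)"
  have I: "I < \<infinity>" unfolding I_def by (rule nn_integral_powr_exp_powr_finite[OF assms])
  have Ga: "0 < Gamma a" using a by (rule Gamma_real_pos)
  define C where "C = enn2real I / Gamma a"
  have C: "0 \<le> C" using Ga by (simp add: C_def)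
  have "(\<integral>\<^sup>+\<tau>. ennreal (\<tau> powr (- a)) \<partial>N) \<le> ennreal ((C + 1) * (t powr (1 / \<beta>)) powr (- a))"
    if t: "0 < t" and N: "stable_law \<beta> t N" for t N
  proof -
    interpret prob_space N using N by (simp add: stable_law_def)
    have [measurable_cong]: "sets N = sets borel" using N by (simp add: stable_law_def)
    interpret P: pair_sigma_finite lborel N ..
    define T where "T = t powr (1 / \<beta>)"
    have T: "0 < T" "T powr \<beta> = t" using t \<beta> by (auto simp: T_def powr_powr)
    have AE0: "AE \<tau> in N. 0 < \<tau>" using N by (simp add: stable_law_def)
    have "ennreal (Gamma a) * (\<integral>\<^sup>+\<tau>. ennreal (\<tau> powr (- a)) \<partial>N) = (\<integral>\<^sup>+\<tau>. ennreal (Gamma a) * ennreal (\<tau> powr (- a)) \<partial>N)"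
      by (intro nn_integral_cmult[symmetric]) measurable
    also have "\<dots> = (\<integral>\<^sup>+\<tau>. \<integral>\<^sup>+x. ennreal (indicator {0<..} x * (x powr (a - 1) * exp (- \<tau> * x))) \<partial>lborel \<partial>N)"
    proof (rule nn_integral_cong_AE, rule AE_mp[OF AE0], rule AE_I2, rule impI)
      fix \<tau> :: real assume \<tau>: "0 < \<tau>"
      have "ennreal (Gamma a) * ennreal (\<tau> powr (- a)) = ennreal (Gamma a * \<tau> powr (- a))"
        using Ga by (intro ennreal_mult[symmetric]) auto
      then show "ennreal (Gamma a) * ennreal (\<tau> powr (- a))
        = (\<integral>\<^sup>+x. ennreal (indicator {0<..} x * (x powr (a - 1) * exp (- \<tau> * x))) \<partial>lborel)"
        unfolding nn_integral_powr_exp[OF a \<tau>] .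
    qed
    also have "\<dots> = (\<integral>\<^sup>+x. \<integral>\<^sup>+\<tau>. ennreal (indicator {0<..} x * (x powr (a - 1) * exp (- \<tau> * x))) \<partial>N \<partial>lborel)"
      by (rule P.Fubini') measurable
    also have "\<dots> = (\<integral>\<^sup>+x. ennreal (indicator {0<..} x * (x powr (a - 1) * exp (- t * x powr \<beta>))) \<partial>lborel)"
    proof (intro nn_integral_cong)
      fix x :: real
      show "(\<integral>\<^sup>+\<tau>. ennreal (indicator {0<..} x * (x powr (a - 1) * exp (- \<tau> * x))) \<partial>N)
        = ennreal (indicator {0<..} x * (x powr (a - 1) * exp (- t * x powr \<beta>)))"
      proof (cases "0 < x")
        case True
        have "(\<integral>\<^sup>+\<tau>. ennreal (indicator {0<..} x * (x powr (a - 1) * exp (- \<tau> * x))) \<partial>N)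
          = (\<integral>\<^sup>+\<tau>. ennreal (x powr (a - 1)) * ennreal (exp (- x * \<tau>)) \<partial>N)"
          using True by (intro nn_integral_cong) (auto simp: ennreal_mult mult.commute)
        also have "\<dots> = ennreal (x powr (a - 1)) * (\<integral>\<^sup>+\<tau>. ennreal (exp (- x * \<tau>)) \<partial>N)"
          by (intro nn_integral_cmult) measurable
        also have "(\<integral>\<^sup>+\<tau>. ennreal (exp (- x * \<tau>)) \<partial>N) = ennreal (LINT \<tau>|N. exp (- x * \<tau>))"
          using True by (intro nn_integral_eq_integral stable_law_integrable_exp[OF N]) auto
        also have "(LINT \<tau>|N. exp (- x * \<tau>)) = exp (- t * x powr \<beta>)"
          using N True by (simp add: stable_law_def)
        finally show ?thesis using True by (simp add: ennreal_mult)
      qed simp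
    qed
    also have "\<dots> = ennreal \<bar>1 / T\<bar> * (\<integral>\<^sup>+x. ennreal (indicator {0<..} (0 + 1 / T * x)
        * ((0 + 1 / T * x) powr (a - 1) * exp (- t * (0 + 1 / T * x) powr \<beta>))) \<partial>lborel)"
      using T by (intro nn_integral_real_affine) auto
    also have "(\<integral>\<^sup>+x. ennreal (indicator {0<..} (0 + 1 / T * x)
        * ((0 + 1 / T * x) powr (a - 1) * exp (- t * (0 + 1 / T * x) powr \<beta>))) \<partial>lborel)
      = (\<integral>\<^sup>+x. ennreal ((1 / T) powr (a - 1)) * ennreal (indicator {0<..} x * (x powr (a - 1) * exp (- (x powr \<beta>)))) \<partial>lborel)"
    proof (intro nn_integral_cong)
      fix x :: real
      show "ennreal (indicator {0<..} (0 + 1 / T * x) * ((0 + 1 / T * x) powr (a - 1) * exp (- t * (0 + 1 / T * x) powr \<beta>)))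
        = ennreal ((1 / T) powr (a - 1)) * ennreal (indicator {0<..} x * (x powr (a - 1) * exp (- (x powr \<beta>))))"
      proof (cases "0 < x")
        case True
        have "t * (1 / T * x) powr \<beta> = x powr \<beta>"
          using T True t by (simp add: powr_divide)
        moreover have "(1 / T * x) powr (a - 1) = (1 / T) powr (a - 1) * x powr (a - 1)"
          by (rule powr_mult)
        ultimately show ?thesis using True T by (simp add: ennreal_mult[symmetric] mult_ac)
      qed (use T in \<open>simp add: indicator_def zero_less_divide_iff\<close>)
    qed
    also have "\<dots> = ennreal ((1 / T) powr (a - 1)) * I"
      unfolding I_def by (intro nn_integral_cmult) measurable
    also have "ennreal \<bar>1 / T\<bar> * (ennreal ((1 / T) powr (a - 1)) * I) = ennreal (T powr (- a)) * I"
    proof -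
      have "(1 / T) * (1 / T) powr (a - 1) = (1 / T) powr a"
        using T powr_mult_base[of "1 / T" "a - 1"] by simp
      also have "\<dots> = T powr (- a)" using T by (simp add: powr_divide powr_minus_divide)
      finally show ?thesis using T by (simp add: mult.assoc[symmetric] ennreal_mult[symmetric])
    qed
    also have "I = ennreal (Gamma a * C)"
    proof -
      have "g * (x / g) = x" if "0 < g" for g x :: real using that by simp
      from this[OF Ga] have "Gamma a * C = enn2real I" unfolding C_def .
      then show ?thesis using I by (simp add: less_top)
    qed
    also have "ennreal (T powr (- a)) * ennreal (Gamma a * C) = ennreal (T powr (- a) * (Gamma a * C))"
      using Ga C by (intro ennreal_mult[symmetric]) auto
    also have "T powr (- a) * (Gamma a * C) = Gamma a * (C * T powr (- a))"
      by (simp only: mult_ac)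
    also have "ennreal \<dots> = ennreal (Gamma a) * ennreal (C * T powr (- a))"
      using Ga C by (intro ennreal_mult) auto
    finally have "ennreal (Gamma a) * (\<integral>\<^sup>+\<tau>. ennreal (\<tau> powr (- a)) \<partial>N) = ennreal (Gamma a) * ennreal (C * T powr (- a))" .
    then have "(\<integral>\<^sup>+\<tau>. ennreal (\<tau> powr (- a)) \<partial>N) = ennreal (C * T powr (- a))"
      using Ga by (subst (asm) ennreal_mult_cancel_left) auto
    also have "\<dots> \<le> ennreal ((C + 1) * T powr (- a))"
      by (intro ennreal_leI mult_right_mono) auto
    finally show ?thesis by (simp add: T_def)
  qed
  then show ?thesis using C by (intro exI[of _ "C + 1"]) auto
qed

text \<open>The larger of T and D decides. For D \<le> T the exponential is dropped, and T^\<beta> =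
  t turns T^(-a) into t T^(-a - \<beta>), the shape of the other regime; for D > T the far moment
  applies. In each case the larger of the two is comparable with T + D.\<close>

lemma stable_law_moment:
  fixes a \<beta> :: real
  assumes a: "0 < a" and \<beta>: "0 < \<beta>"
  shows "\<exists>C>0. \<forall>t N D. 0 < t \<and> 0 \<le> D \<and> stable_law \<beta> t N \<longrightarrow>
    (\<integral>\<^sup>+\<tau>. ennreal (\<tau> powr (- a) * exp (- D / (4 * \<tau>))) \<partial>N)
      \<le> ennreal (C * (t * (t powr (1 / \<beta>) + D) powr (- a - \<beta>)))"
proof -
  obtain C1 where C1: "0 < C1" "\<And>t N D. 0 < t \<and> 0 < D \<and> stable_law \<beta> t N \<Longrightarrow>
    (\<integral>\<^sup>+\<tau>. ennreal (\<tau> powr (- a) * exp (- D / (4 * \<tau>))) \<partial>N) \<le> ennreal (C1 * (t * D powr (- a - \<beta>)))"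
    using stable_law_far_moment[OF a] by blast
  obtain C2 where C2: "0 < C2" "\<And>t N. 0 < t \<and> stable_law \<beta> t N \<Longrightarrow>
    (\<integral>\<^sup>+\<tau>. ennreal (\<tau> powr (- a)) \<partial>N) \<le> ennreal (C2 * (t powr (1 / \<beta>)) powr (- a))"
    using stable_law_negative_moment[OF a \<beta>] by blast
  define L where "L = (2::real) powr \<bar>- a - \<beta>\<bar>"
  have L: "0 < L" by (simp add: L_def)
  have "(\<integral>\<^sup>+\<tau>. ennreal (\<tau> powr (- a) * exp (- D / (4 * \<tau>))) \<partial>N)
      \<le> ennreal ((C1 + C2) * L * (t * (t powr (1 / \<beta>) + D) powr (- a - \<beta>)))"
    if t: "0 < t" and D: "0 \<le> D" and N: "stable_law \<beta> t N" for t N D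
  proof -
    define T where "T = t powr (1 / \<beta>)"
    have T: "0 < T" "T powr \<beta> = t" using t \<beta> by (auto simp: T_def powr_powr)
    have mono: "C * (t * x powr (- a - \<beta>)) \<le> (C1 + C2) * L * (t * (T + D) powr (- a - \<beta>))"
      if "C \<le> C1 + C2" "0 < C" "0 < x" "x \<le> T + D" "T + D \<le> 2 * x" for C x
    proof -
      have "x powr (- a - \<beta>) \<le> L * (T + D) powr (- a - \<beta>)"
        unfolding L_def using that T D by (intro powr_comparable) auto
      then have "C * (t * x powr (- a - \<beta>)) \<le> (C1 + C2) * (t * (L * (T + D) powr (- a - \<beta>)))"
        using that t by (intro mult_mono) auto
      then show ?thesis by (simp add: mult_ac)
    qed
    show ?thesis
    proof (cases "D \<le> T")
      case True
      have AE0: "AE \<tau> in N. 0 < \<tau>" using N by (simp add: stable_law_def)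
      have "(\<integral>\<^sup>+\<tau>. ennreal (\<tau> powr (- a) * exp (- D / (4 * \<tau>))) \<partial>N) \<le> (\<integral>\<^sup>+\<tau>. ennreal (\<tau> powr (- a)) \<partial>N)"
      proof (rule nn_integral_mono_AE, rule AE_mp[OF AE0], rule AE_I2, rule impI)
        fix \<tau> :: real assume "0 < \<tau>"
        then show "ennreal (\<tau> powr (- a) * exp (- D / (4 * \<tau>))) \<le> ennreal (\<tau> powr (- a))"
          using D by (intro ennreal_leI mult_left_le) auto
      qed
      also have "\<dots> \<le> ennreal (C2 * T powr (- a))"
        using C2(2)[of t N] t N by (simp add: T_def)
      also have "T powr (- a) = t * T powr (- a - \<beta>)"
        using T t by (simp add: powr_diff)
      also have "ennreal (C2 * (t * T powr (- a - \<beta>))) \<le> ennreal ((C1 + C2) * L * (t * (T + D) powr (- a - \<beta>)))"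
        using True C1(1) C2(1) T D by (intro ennreal_leI mono) auto
      finally show ?thesis by (simp add: T_def)
    next
      case False
      then have "0 < D" using T by simp
      then have "(\<integral>\<^sup>+\<tau>. ennreal (\<tau> powr (- a) * exp (- D / (4 * \<tau>))) \<partial>N) \<le> ennreal (C1 * (t * D powr (- a - \<beta>)))"
        using C1(2)[of t D N] t N by simp
      also have "\<dots> \<le> ennreal ((C1 + C2) * L * (t * (T + D) powr (- a - \<beta>)))"
        using False C1(1) C2(1) T D by (intro ennreal_leI mono) auto
      finally show ?thesis by (simp add: T_def)
    qed
  qed
  then show ?thesis using C1(1) C2(1) L by (intro exI[of _ "(C1 + C2) * L"]) auto
qed

text \<open>Lower bounds need the subordinator to be of order M with probability of order t
  M^(-\<beta>), the size of a stable tail. The window is cut out by a difference: one term sees all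
  \<tau> of order at least M, and the two subtracted terms remove values far below and far above
  M.\<close>

lemma stable_law_mass:
  fixes \<beta> :: real
  assumes \<beta>: "0 < \<beta>" "\<beta> < 1"
  shows "\<exists>\<delta> L. 0 < \<delta> \<and> \<delta> \<le> 1 \<and> 1 \<le> L \<and> (\<forall>t N M. 0 < t \<and> t powr (1 / \<beta>) \<le> M \<and> stable_law \<beta> t N \<longrightarrow>
    t * M powr (- \<beta>) / 4 \<le> measure N {\<delta> * M..L * M})"
proof -
  \<comment> \<open>Both constants make a subtracted expectation small: \<delta>^(1 - \<beta>) =
    1/16, possible because \<beta> < 1, and L^(-\<beta>) = 1/16.\<close>
  define \<delta> where "\<delta> = (1/16::real) powr (1 / (1 - \<beta>))"
  define L where "L = (16::real) powr (1 / \<beta>)"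
  have \<delta>: "0 < \<delta>" "\<delta> \<le> 1" "\<delta> * (1 / \<delta>) powr \<beta> = 1/16"
  proof -
    show d: "0 < \<delta>" "\<delta> \<le> 1" using \<beta> by (auto simp: \<delta>_def intro!: powr_le1)
    have "\<delta> * (1 / \<delta>) powr \<beta> = \<delta> powr (1 - \<beta>)" using d by (simp add: powr_divide powr_diff)
    also have "\<dots> = 1/16" using \<beta> by (simp add: \<delta>_def powr_powr)
    finally show "\<delta> * (1 / \<delta>) powr \<beta> = 1/16" .
  qed
  have L: "1 \<le> L" "(1 / L) powr \<beta> = 1/16"
  proof -
    show "1 \<le> L" using \<beta> by (auto simp: L_def intro!: ge_one_powr_ge_zero)
    show "(1 / L) powr \<beta> = 1/16" using \<beta> by (simp add: L_def powr_divide powr_powr)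
  qed
  have "t * M powr (- \<beta>) / 4 \<le> measure N {\<delta> * M..L * M}"
    if t: "0 < t" and M: "t powr (1 / \<beta>) \<le> M" and N: "stable_law \<beta> t N" for t N M
  proof -
    interpret prob_space N using N by (simp add: stable_law_def)
    have [measurable_cong]: "sets N = sets borel" using N by (simp add: stable_law_def)
    have AE0: "AE \<tau> in N. 0 < \<tau>" using N by (simp add: stable_law_def)
    have M0: "0 < M" using M t by (smt (verit) powr_gt_zero)
    define u where "u = t * M powr (- \<beta>)"
    have u: "0 < u" "u \<le> 1"
    proof -
      show "0 < u" using t M0 by (simp add: u_def)
      have "t = (t powr (1 / \<beta>)) powr \<beta>" using t \<beta> by (simp add: powr_powr)
      also have "\<dots> \<le> M powr \<beta>" using M \<beta> by (intro powr_mono2) auto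
      finally show "u \<le> 1" using M0 by (simp add: u_def powr_minus field_simps)
    qed
    define E where "E l = (LINT \<tau>|N. 1 - exp (- (l / M) * \<tau>))" for l
    have Ei: "integrable N (\<lambda>\<tau>. 1 - exp (- (l / M) * \<tau>))" if "0 \<le> l" for l
      using that M0 by (intro stable_law_one_minus_exp(1)[OF N]) auto
    have E: "E l = 1 - exp (- u * l powr \<beta>)" if "0 \<le> l" for l
    proof -
      have "t * (l / M) powr \<beta> = u * l powr \<beta>"
        using that M0 by (simp add: u_def powr_divide powr_minus_divide)
      then show ?thesis
        using stable_law_one_minus_exp(2)[OF N, of "l / M"] that M0 by (simp add: E_def)
    qed
    have E_le: "E l \<le> u * l powr \<beta>" if "0 \<le> l" for l
      using E[OF that] exp_ge_add_one_self[of "- u * l powr \<beta>"] by simp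
    have E1: "u / 2 \<le> E 1" using E[of 1] one_minus_exp_minus_ge[of u] u by simp
    \<comment> \<open>a combination of functions with known expectation that is dominated by the indicator\<close>
    have pt: "(1 - exp (- (1 / M) * \<tau>)) - 2 * \<delta> * (1 - exp (- ((1 / \<delta>) / M) * \<tau>)) - 2 * (1 - exp (- ((1 / L) / M) * \<tau>))
      \<le> indicator {\<delta> * M..L * M} \<tau>" if \<tau>: "0 < \<tau>" for \<tau>
    proof -
      define y where "y = \<tau> / M"
      have y: "0 < y" "\<tau> = y * M" using \<tau> M0 by (auto simp: y_def)
      have e: "exp (- (1 / M) * \<tau>) = exp (- y)" "exp (- ((1 / \<delta>) / M) * \<tau>) = exp (- (y / \<delta>))"
        "exp (- ((1 / L) / M) * \<tau>) = exp (- (y / L))"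
        using y M0 by simp_all
      have nn: "0 \<le> 2 * \<delta> * (1 - exp (- (y / \<delta>)))" "0 \<le> 2 * (1 - exp (- (y / L)))"
        using y \<delta> L by (auto intro!: mult_nonneg_nonneg)
      have "(1 - exp (- y)) - 2 * \<delta> * (1 - exp (- (y / \<delta>))) - 2 * (1 - exp (- (y / L))) \<le> indicator {\<delta>..L} y"
      proof -
        consider "y < \<delta>" | "\<delta> \<le> y" "y \<le> L" | "L < y" by linarith
        then show ?thesis
        proof cases
          case 1
          then have "y / \<delta> \<le> 2 * (1 - exp (- (y / \<delta>)))"
            using one_minus_exp_minus_ge[of "y / \<delta>"] y \<delta> by (simp add: min_def split: if_splits)
          then have "\<delta> * (y / \<delta>) \<le> \<delta> * (2 * (1 - exp (- (y / \<delta>))))"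
            using \<delta> by (intro mult_left_mono) auto
          then have "y \<le> 2 * \<delta> * (1 - exp (- (y / \<delta>)))" using \<delta> by (simp add: mult_ac)
          moreover have "1 - exp (- y) \<le> y" using exp_ge_add_one_self[of "- y"] by linarith
          ultimately have "(1 - exp (- y)) - 2 * \<delta> * (1 - exp (- (y / \<delta>))) - 2 * (1 - exp (- (y / L))) \<le> 0"
            using nn by linarith
          then show ?thesis using 1 by simp
        next
          case 2
          have "1 - exp (- y) \<le> 1" by simp
          then have "(1 - exp (- y)) - 2 * \<delta> * (1 - exp (- (y / \<delta>))) - 2 * (1 - exp (- (y / L))) \<le> 1"
            using nn by linarith
          then show ?thesis using 2 by simp
        next
          case 3
          have "1 \<le> 2 * (1 - exp (- (y / L)))"
            using 3 one_minus_exp_minus_ge[of "y / L"] y L by (simp add: min_def split: if_splits)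
          moreover have "1 - exp (- y) \<le> 1" by simp
          ultimately have "(1 - exp (- y)) - 2 * \<delta> * (1 - exp (- (y / \<delta>))) - 2 * (1 - exp (- (y / L))) \<le> 0"
            using nn by linarith
          then show ?thesis using 3 by simp
        qed
      qed
      moreover have "(indicator {\<delta>..L} y :: real) = indicator {\<delta> * M..L * M} \<tau>"
        using M0 by (simp add: y indicator_def)
      ultimately show ?thesis unfolding e by simp
    qed
    have i1: "integrable N (\<lambda>\<tau>. 1 - exp (- (1 / M) * \<tau>))" using Ei[of 1] by simp
    have i2: "integrable N (\<lambda>\<tau>. 2 * \<delta> * (1 - exp (- ((1 / \<delta>) / M) * \<tau>)))"
      using \<delta> by (intro integrable_mult_right Ei) auto
    have i3: "integrable N (\<lambda>\<tau>. 2 * (1 - exp (- ((1 / L) / M) * \<tau>)))"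
      using L by (intro integrable_mult_right Ei) auto
    \<comment> \<open>The main term is at least u / 2, and each correction, weighted by 2, is at
      most u / 8.\<close>
    have "u / 4 \<le> E 1 - 2 * \<delta> * E (1 / \<delta>) - 2 * E (1 / L)"
    proof -
      have "\<delta> * E (1 / \<delta>) \<le> \<delta> * (u * (1 / \<delta>) powr \<beta>)"
        using E_le[of "1 / \<delta>"] \<delta> by (intro mult_left_mono) auto
      also have "\<dots> = u * (\<delta> * (1 / \<delta>) powr \<beta>)" by simp
      also have "\<dots> = u / 16" unfolding \<delta>(3) by simp
      finally have "\<delta> * E (1 / \<delta>) \<le> u / 16" .
      moreover have "E (1 / L) \<le> u / 16" using E_le[of "1 / L"] L by simp
      ultimately show ?thesis using E1 by linarith
    qed
    also have "\<dots> = (LINT \<tau>|N. (1 - exp (- (1 / M) * \<tau>)) - 2 * \<delta> * (1 - exp (- ((1 / \<delta>) / M) * \<tau>)) - 2 * (1 - exp (- ((1 / L) / M) * \<tau>)))"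
      unfolding E_def
      by (simp only: Bochner_Integration.integral_diff[OF Bochner_Integration.integrable_diff[OF i1 i2] i3]
          Bochner_Integration.integral_diff[OF i1 i2] Bochner_Integration.integral_mult_right_zero)
    also have "\<dots> \<le> (LINT \<tau>|N. indicator {\<delta> * M..L * M} \<tau>)"
    proof (rule integral_mono_AE)
      show "integrable N (\<lambda>\<tau>. (1 - exp (- (1 / M) * \<tau>)) - 2 * \<delta> * (1 - exp (- ((1 / \<delta>) / M) * \<tau>)) - 2 * (1 - exp (- ((1 / L) / M) * \<tau>)))"
        by (intro Bochner_Integration.integrable_diff i1 i2 i3)
      show "integrable N (indicator {\<delta> * M..L * M} :: real \<Rightarrow> real)"
        by (intro integrable_const_bound[where B = 1]) (auto simp: indicator_def)
      show "AE \<tau> in N. (1 - exp (- (1 / M) * \<tau>)) - 2 * \<delta> * (1 - exp (- ((1 / \<delta>) / M) * \<tau>)) - 2 * (1 - exp (- ((1 / L) / M) * \<tau>))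
        \<le> indicator {\<delta> * M..L * M} \<tau>"
        using AE0 by eventually_elim (rule pt)
    qed
    also have "\<dots> = measure N {\<delta> * M..L * M}"
      using sets_eq_imp_space_eq[of N borel] N by (simp add: stable_law_def)
    finally show ?thesis by (simp add: u_def)
  qed
  then show ?thesis using \<delta> L by blast
qed

text \<open>The quotient (x + w) / (M + w) lies between 1 and x / M, so its power is at most the
  larger of the two powers, whatever the sign of p. This separates the random time from r s in the
  factor (\<tau> + r s)^(-\<zeta>).\<close>

lemma powr_between_le:
  fixes x M w p :: real
  assumes "0 < x" "0 < M" "0 \<le> w"
  shows "(x + w) powr p \<le> (M + w) powr p * (1 + (x / M) powr p)"
proof -
  define q where "q = (x + w) / (M + w)"
  have q0: "0 < q" using assms by (simp add: q_def)
  have q: "x \<le> M \<Longrightarrow> x / M \<le> q \<and> q \<le> 1" "M \<le> x \<Longrightarrow> 1 \<le> q \<and> q \<le> x / M"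
    using assms by (auto simp: q_def field_simps) (simp_all add: mult.commute[of w] mult_right_mono)
  have "q powr p \<le> 1 + (x / M) powr p"
  proof (cases "(0 \<le> p) = (x \<le> M)")
    case True
    have "q powr p \<le> 1"
    proof (cases "0 \<le> p")
      case p: True
      then show ?thesis using True q q0 by (intro powr_le1) auto
    next
      case False
      then show ?thesis using True q(2) powr_mono2'[of p 1 q] by simp
    qed
    then show ?thesis using powr_ge_zero[of "x / M" p] by linarith
  next
    case False
    have "q powr p \<le> (x / M) powr p"
    proof (cases "0 \<le> p")
      case True
      then show ?thesis using False q q0 by (intro powr_mono2) auto
    next
      case p: False
      then show ?thesis using False q(1) assms by (intro powr_mono2') auto
    qed
    then show ?thesis by linarith
  qed
  then have "(M + w) powr p * q powr p \<le> (M + w) powr p * (1 + (x / M) powr p)"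
    by (intro mult_left_mono) auto
  moreover have "(M + w) powr p * q powr p = (x + w) powr p"
    using assms by (simp add: q_def powr_divide)
  ultimately show ?thesis by simp
qed

text \<open>After the separation the heat kernel is bounded by two moments, of orders 1/2 and 1/2 +
  \<zeta>; the second is positive by the hypothesis on \<zeta>. The weight M^\<zeta> in front of the
  second moment makes both terms of the same size.\<close>

lemma nn_integral_heat_kernel_le:
  fixes \<zeta> \<alpha> :: real
  assumes \<zeta>: "\<zeta> > -1/2" and \<alpha>: "0 < \<alpha>" "\<alpha> < 2"
  shows "\<exists>C>0. \<forall>t N r s. 0 < t \<and> 0 < r \<and> 0 < s \<and> stable_law (\<alpha> / 2) t N \<longrightarrow>
    (\<integral>\<^sup>+\<tau>. ennreal (heat_kernel \<zeta> \<tau> r s) \<partial>N) \<le> ennreal (C * stable_kernel \<zeta> \<alpha> t r s)"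
proof -
  define \<beta> where "\<beta> = \<alpha> / 2"
  have \<beta>: "0 < \<beta>" "1 / \<beta> = 2 / \<alpha>" using \<alpha> by (auto simp: \<beta>_def)
  have z1: "0 < 1/2 + \<zeta>" using \<zeta> by simp
  obtain C1 where C1: "0 < C1" "\<And>t N D. 0 < t \<and> 0 \<le> D \<and> stable_law \<beta> t N \<Longrightarrow>
    (\<integral>\<^sup>+\<tau>. ennreal (\<tau> powr (- (1/2)) * exp (- D / (4 * \<tau>))) \<partial>N) \<le> ennreal (C1 * (t * (t powr (2 / \<alpha>) + D) powr (- (1/2) - \<beta>)))"
    using stable_law_moment[of "1/2" \<beta>] \<beta>(1) unfolding \<beta>(2) by auto
  obtain C2 where C2: "0 < C2" "\<And>t N D. 0 < t \<and> 0 \<le> D \<and> stable_law \<beta> t N \<Longrightarrow>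
    (\<integral>\<^sup>+\<tau>. ennreal (\<tau> powr (- (1/2 + \<zeta>)) * exp (- D / (4 * \<tau>))) \<partial>N) \<le> ennreal (C2 * (t * (t powr (2 / \<alpha>) + D) powr (- (1/2 + \<zeta>) - \<beta>)))"
    using stable_law_moment[OF z1 \<beta>(1)] unfolding \<beta>(2) by blast
  define L where "L = (4::real) powr \<bar>- \<zeta>\<bar>"
  have L: "0 < L" by (simp add: L_def)
  have "(\<integral>\<^sup>+\<tau>. ennreal (heat_kernel \<zeta> \<tau> r s) \<partial>N) \<le> ennreal ((C1 + C2) * L * stable_kernel \<zeta> \<alpha> t r s)"
    if t: "0 < t" and r: "0 < r" and s: "0 < s" and N: "stable_law (\<alpha> / 2) t N" for t N r s
  proof -
    have N': "stable_law \<beta> t N" using N by (simp add: \<beta>_def)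
    have [measurable_cong]: "sets N = sets borel" using N by (simp add: stable_law_def)
    have AE0: "AE \<tau> in N. 0 < \<tau>" using N by (simp add: stable_law_def)
    define D where "D = (r - s)\<^sup>2"
    define M where "M = t powr (2 / \<alpha>) + D"
    have D: "0 \<le> D" by (simp add: D_def)
    have M: "0 < M" unfolding M_def using t D by (intro add_pos_nonneg) auto
    have rs: "0 < r * s" using r s by simp
    define W where "W = (M + r * s) powr (- \<zeta>)"
    have W: "0 \<le> W" by (simp add: W_def)
    have pt: "heat_kernel \<zeta> \<tau> r s \<le> W * (\<tau> powr (- (1/2)) * exp (- D / (4 * \<tau>)))
        + W * M powr \<zeta> * (\<tau> powr (- (1/2 + \<zeta>)) * exp (- D / (4 * \<tau>)))" if \<tau>: "0 < \<tau>" for \<tau>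
    proof -
      have "(\<tau> + r * s) powr (- \<zeta>) \<le> W * (1 + (\<tau> / M) powr (- \<zeta>))"
        unfolding W_def using \<tau> M rs by (intro powr_between_le) auto
      then have "heat_kernel \<zeta> \<tau> r s \<le> \<tau> powr (-1/2) * (W * (1 + (\<tau> / M) powr (- \<zeta>))) * exp (- D / (4 * \<tau>))"
        unfolding heat_kernel_def D_def by (intro mult_left_mono mult_right_mono) auto
      also have "(\<tau> / M) powr (- \<zeta>) = M powr \<zeta> * \<tau> powr (- \<zeta>)"
        using \<tau> M by (simp add: powr_divide powr_minus_divide)
      also have "\<tau> powr (-1/2) * (W * (1 + M powr \<zeta> * \<tau> powr (- \<zeta>))) * exp (- D / (4 * \<tau>))
        = W * (\<tau> powr (- (1/2)) * exp (- D / (4 * \<tau>))) + W * M powr \<zeta> * ((\<tau> powr (- (1/2)) * \<tau> powr (- \<zeta>)) * exp (- D / (4 * \<tau>)))"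
        by (simp add: algebra_simps)
      also have "\<tau> powr (- (1/2)) * \<tau> powr (- \<zeta>) = \<tau> powr (- (1/2 + \<zeta>))"
        by (simp add: powr_add[symmetric])
      finally show ?thesis .
    qed
    have "(\<integral>\<^sup>+\<tau>. ennreal (heat_kernel \<zeta> \<tau> r s) \<partial>N)
      \<le> (\<integral>\<^sup>+\<tau>. ennreal W * ennreal (\<tau> powr (- (1/2)) * exp (- D / (4 * \<tau>)))
        + ennreal (W * M powr \<zeta>) * ennreal (\<tau> powr (- (1/2 + \<zeta>)) * exp (- D / (4 * \<tau>))) \<partial>N)"
    proof (rule nn_integral_mono_AE, rule AE_mp[OF AE0], rule AE_I2, rule impI)
      fix \<tau> :: real assume \<tau>: "0 < \<tau>"
      have "ennreal (heat_kernel \<zeta> \<tau> r s) \<le> ennreal (W * (\<tau> powr (- (1/2)) * exp (- D / (4 * \<tau>)))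
        + W * M powr \<zeta> * (\<tau> powr (- (1/2 + \<zeta>)) * exp (- D / (4 * \<tau>))))"
        by (rule ennreal_leI[OF pt[OF \<tau>]])
      also have "\<dots> = ennreal W * ennreal (\<tau> powr (- (1/2)) * exp (- D / (4 * \<tau>)))
        + ennreal (W * M powr \<zeta>) * ennreal (\<tau> powr (- (1/2 + \<zeta>)) * exp (- D / (4 * \<tau>)))"
        using W by (subst ennreal_plus) (auto simp: ennreal_mult)
      finally show "ennreal (heat_kernel \<zeta> \<tau> r s) \<le> ennreal W * ennreal (\<tau> powr (- (1/2)) * exp (- D / (4 * \<tau>)))
        + ennreal (W * M powr \<zeta>) * ennreal (\<tau> powr (- (1/2 + \<zeta>)) * exp (- D / (4 * \<tau>)))" .
    qed
    also have "\<dots> = ennreal W * (\<integral>\<^sup>+\<tau>. ennreal (\<tau> powr (- (1/2)) * exp (- D / (4 * \<tau>))) \<partial>N)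
        + ennreal (W * M powr \<zeta>) * (\<integral>\<^sup>+\<tau>. ennreal (\<tau> powr (- (1/2 + \<zeta>)) * exp (- D / (4 * \<tau>))) \<partial>N)"
      by (subst nn_integral_add) (auto simp: nn_integral_cmult)
    also have "\<dots> \<le> ennreal W * ennreal (C1 * (t * M powr (- (1/2) - \<beta>)))
        + ennreal (W * M powr \<zeta>) * ennreal (C2 * (t * M powr (- (1/2 + \<zeta>) - \<beta>)))"
      unfolding M_def using C1(2)[of t D N] C2(2)[of t D N] t D N'
      by (intro add_mono mult_left_mono) auto
    also have "\<dots> = ennreal (W * (C1 * (t * M powr (- (1/2) - \<beta>))) + W * M powr \<zeta> * (C2 * (t * M powr (- (1/2 + \<zeta>) - \<beta>))))"
      using W C1(1) C2(1) t by (subst ennreal_plus) (auto simp: ennreal_mult)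
    also have "W * (C1 * (t * M powr (- (1/2) - \<beta>))) + W * M powr \<zeta> * (C2 * (t * M powr (- (1/2 + \<zeta>) - \<beta>)))
      = (C1 + C2) * (t * M powr (- (1/2) - \<beta>)) * W"
    proof -
      have "M powr \<zeta> * M powr (- (1/2 + \<zeta>) - \<beta>) = M powr (- (1/2) - \<beta>)"
        by (simp add: powr_add[symmetric])
      then have "W * M powr \<zeta> * (C2 * (t * M powr (- (1/2 + \<zeta>) - \<beta>))) = W * C2 * t * M powr (- (1/2) - \<beta>)"
        by (simp add: mult_ac)
      then show ?thesis by (simp add: algebra_simps)
    qed
    also have "ennreal ((C1 + C2) * (t * M powr (- (1/2) - \<beta>)) * W) \<le> ennreal ((C1 + C2) * L * stable_kernel \<zeta> \<alpha> t r s)"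
    proof (rule ennreal_leI)
      have "t powr (2 / \<alpha>) + (r + s)\<^sup>2 = M + 4 * (r * s)"
        by (simp add: M_def D_def power2_eq_square algebra_simps)
      then have "W \<le> L * (t powr (2 / \<alpha>) + (r + s)\<^sup>2) powr (- \<zeta>)"
        unfolding W_def L_def using M rs by (intro powr_comparable) auto
      then have "(C1 + C2) * (t * M powr (- (1/2) - \<beta>)) * W
        \<le> (C1 + C2) * (t * M powr (- (1/2) - \<beta>)) * (L * (t powr (2 / \<alpha>) + (r + s)\<^sup>2) powr (- \<zeta>))"
        using C1(1) C2(1) t by (intro mult_left_mono) auto
      also have "\<dots> = (C1 + C2) * L * stable_kernel \<zeta> \<alpha> t r s"
      proof -
        have "- (1/2) - \<beta> = - (1 + \<alpha>) / 2" by (simp add: \<beta>_def field_simps)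
        then show ?thesis unfolding stable_kernel_def M_def D_def by (simp only: mult_ac)
      qed
      finally show "(C1 + C2) * (t * M powr (- (1/2) - \<beta>)) * W \<le> (C1 + C2) * L * stable_kernel \<zeta> \<alpha> t r s" .
    qed
    finally show ?thesis .
  qed
  then show ?thesis using C1(1) C2(1) L by (intro exI[of _ "(C1 + C2) * L"]) auto
qed

section \<open>Transfer of the bounds to the subordinated kernel\<close>

lemma p2_nonneg:
  assumes "\<zeta> > -1/2" "0 < t" "0 < r" "0 < s"
  shows "0 \<le> p2 \<zeta> t r s"
proof -
  obtain K where K: "0 < K" "heat_kernel \<zeta> t r s \<le> K * p2 \<zeta> t r s"
    using p2_bounds[OF assms(1)] assms by blast
  have "0 \<le> K * p2 \<zeta> t r s" using K(2) heat_kernel_pos[OF assms(2-4), of \<zeta>] by linarith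
  then show ?thesis using K(1) by (rule zero_le_mult_imp_nonneg)
qed

lemma stable_law_p2_upper:
  fixes \<zeta> \<alpha> :: real
  assumes \<zeta>: "\<zeta> > -1/2" and \<alpha>: "0 < \<alpha>" "\<alpha> < 2"
  shows "\<exists>C>0. \<forall>t N r s. 0 < t \<and> 0 < r \<and> 0 < s \<and> stable_law (\<alpha> / 2) t N \<longrightarrow>
    integrable N (\<lambda>\<tau>. p2 \<zeta> \<tau> r s) \<and> (LINT \<tau>|N. p2 \<zeta> \<tau> r s) \<le> C * stable_kernel \<zeta> \<alpha> t r s"
proof -
  obtain C where C: "0 < C" "\<And>t N r s. 0 < t \<and> 0 < r \<and> 0 < s \<and> stable_law (\<alpha> / 2) t N \<Longrightarrow>
    (\<integral>\<^sup>+\<tau>. ennreal (heat_kernel \<zeta> \<tau> r s) \<partial>N) \<le> ennreal (C * stable_kernel \<zeta> \<alpha> t r s)"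
    using nn_integral_heat_kernel_le[OF \<zeta> \<alpha>] by blast
  obtain K where K: "0 < K" "\<And>t r s. 0 < t \<and> 0 < r \<and> 0 < s \<Longrightarrow> p2 \<zeta> t r s \<le> K * heat_kernel \<zeta> t r s"
    using p2_bounds[OF \<zeta>] by blast
  have "integrable N (\<lambda>\<tau>. p2 \<zeta> \<tau> r s) \<and> (LINT \<tau>|N. p2 \<zeta> \<tau> r s) \<le> (K * C) * stable_kernel \<zeta> \<alpha> t r s"
    if t: "0 < t" and r: "0 < r" and s: "0 < s" and N: "stable_law (\<alpha> / 2) t N" for t N r s
  proof -
    have [measurable_cong]: "sets N = sets borel" using N by (simp add: stable_law_def)
    have AE0: "AE \<tau> in N. 0 < \<tau>" using N by (simp add: stable_law_def)
    have hm: "(\<lambda>\<tau>. ennreal (heat_kernel \<zeta> \<tau> r s)) \<in> borel_measurable N"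
      unfolding heat_kernel_def by measurable
    have sk: "0 \<le> stable_kernel \<zeta> \<alpha> t r s" using t by (simp add: stable_kernel_def)
    have nn: "AE \<tau> in N. 0 \<le> p2 \<zeta> \<tau> r s"
      using AE0 by eventually_elim (use p2_nonneg[OF \<zeta>] r s in auto)
    have "(\<integral>\<^sup>+\<tau>. ennreal (p2 \<zeta> \<tau> r s) \<partial>N) \<le> (\<integral>\<^sup>+\<tau>. ennreal K * ennreal (heat_kernel \<zeta> \<tau> r s) \<partial>N)"
    proof (rule nn_integral_mono_AE, rule AE_mp[OF AE0], rule AE_I2, rule impI)
      fix \<tau> :: real assume \<tau>: "0 < \<tau>"
      then have "p2 \<zeta> \<tau> r s \<le> K * heat_kernel \<zeta> \<tau> r s" using K(2) r s by blast
      then show "ennreal (p2 \<zeta> \<tau> r s) \<le> ennreal K * ennreal (heat_kernel \<zeta> \<tau> r s)"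
        using K(1) heat_kernel_pos[OF \<tau> r s, of \<zeta>] by (simp add: ennreal_mult[symmetric] ennreal_leI)
    qed
    also have "\<dots> = ennreal K * (\<integral>\<^sup>+\<tau>. ennreal (heat_kernel \<zeta> \<tau> r s) \<partial>N)"
      by (rule nn_integral_cmult[OF hm])
    also have "\<dots> \<le> ennreal K * ennreal (C * stable_kernel \<zeta> \<alpha> t r s)"
      using C(2) t r s N by (intro mult_left_mono) auto
    also have "\<dots> = ennreal (K * C * stable_kernel \<zeta> \<alpha> t r s)"
      using K(1) C(1) sk by (simp add: ennreal_mult[symmetric] mult.assoc)
    finally have le: "(\<integral>\<^sup>+\<tau>. ennreal (p2 \<zeta> \<tau> r s) \<partial>N) \<le> ennreal (K * C * stable_kernel \<zeta> \<alpha> t r s)" .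
    then have "integrable N (\<lambda>\<tau>. p2 \<zeta> \<tau> r s)"
      using nn by (intro integrableI_nonneg) (auto intro: le_less_trans)
    moreover have "(LINT \<tau>|N. p2 \<zeta> \<tau> r s) = enn2real (\<integral>\<^sup>+\<tau>. ennreal (p2 \<zeta> \<tau> r s) \<partial>N)"
      using nn by (intro integral_eq_nn_integral) auto
    moreover have "enn2real (\<integral>\<^sup>+\<tau>. ennreal (p2 \<zeta> \<tau> r s) \<partial>N) \<le> K * C * stable_kernel \<zeta> \<alpha> t r s"
      using le K(1) C(1) sk by (intro enn2real_leI) auto
    ultimately show ?thesis by simp
  qed
  then show ?thesis using K(1) C(1) by (intro exI[of _ "K * C"]) auto
qed

text \<open>It suffices to integrate over times between \<delta> M and L M. There all factors of the
  heat kernel are comparable with their values at \<tau> = M, and (r - s)^2 \<le> M keeps the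
  Gaussian factor above a constant.\<close>

lemma stable_law_p2_lower:
  fixes \<zeta> \<alpha> :: real
  assumes \<zeta>: "\<zeta> > -1/2" and \<alpha>: "0 < \<alpha>" "\<alpha> < 2"
  shows "\<exists>C>0. \<forall>t N r s. 0 < t \<and> 0 < r \<and> 0 < s \<and> stable_law (\<alpha> / 2) t N \<longrightarrow>
    stable_kernel \<zeta> \<alpha> t r s \<le> C * (LINT \<tau>|N. p2 \<zeta> \<tau> r s)"
proof -
  define \<beta> where "\<beta> = \<alpha> / 2"
  have \<beta>: "0 < \<beta>" "\<beta> < 1" "1 / \<beta> = 2 / \<alpha>" using \<alpha> by (auto simp: \<beta>_def)
  obtain K where K: "0 < K" "\<And>t r s. 0 < t \<and> 0 < r \<and> 0 < s \<Longrightarrow> heat_kernel \<zeta> t r s \<le> K * p2 \<zeta> t r s"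
    using p2_bounds[OF \<zeta>] by blast
  obtain \<delta> L where \<delta>: "0 < \<delta>" "\<delta> \<le> 1" and L: "1 \<le> L" and mass: "\<And>t N M. 0 < t \<and> t powr (2 / \<alpha>) \<le> M \<and> stable_law \<beta> t N \<Longrightarrow>
    t * M powr (- \<beta>) / 4 \<le> measure N {\<delta> * M..L * M}"
    using stable_law_mass[OF \<beta>(1,2)] unfolding \<beta>(3) by blast
  have div_le: "y / K \<le> x" if "y \<le> K * x" for x y
    using that K(1) by (simp add: field_simps)
  \<comment> \<open>One constant for comparing \<tau> with M in both directions inside the window:
    \<tau> \<le> L M and M \<le> \<tau> / \<delta>.\<close>
  define G where "G = L + 1 / \<delta>"
  have G: "1 \<le> G" "L \<le> G" "1 / \<delta> \<le> G" using \<delta> L by (auto simp: G_def add_increasing2)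
  define P where "P = G powr \<bar>- \<zeta>\<bar>"
  define R where "R = (4::real) powr \<bar>- \<zeta>\<bar>"
  have P: "0 < P" using G by (simp add: P_def)
  have R: "0 < R" by (simp add: R_def)
  define c where "c = L powr (-1/2) * (exp (- 1 / (4 * \<delta>)) / P) / K"
  have c: "0 < c" using L P K(1) by (simp add: c_def)
  have "stable_kernel \<zeta> \<alpha> t r s \<le> (4 * R / c) * (LINT \<tau>|N. p2 \<zeta> \<tau> r s)"
    if t: "0 < t" and r: "0 < r" and s: "0 < s" and N: "stable_law (\<alpha> / 2) t N" for t N r s
  proof -
    have N': "stable_law \<beta> t N" using N by (simp add: \<beta>_def)
    interpret prob_space N using N by (simp add: stable_law_def)
    have [measurable_cong]: "sets N = sets borel" using N by (simp add: stable_law_def)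
    have AE0: "AE \<tau> in N. 0 < \<tau>" using N by (simp add: stable_law_def)
    define D where "D = (r - s)\<^sup>2"
    define M where "M = t powr (2 / \<alpha>) + D"
    have D: "0 \<le> D" by (simp add: D_def)
    have M: "0 < M" "D \<le> M" unfolding M_def using t D by (auto intro: add_pos_nonneg)
    have rs: "0 < r * s" using r s by simp
    define W where "W = (M + r * s) powr (- \<zeta>)"
    have W: "0 \<le> W" by (simp add: W_def)
    have pt: "c * M powr (-1/2) * W * indicator {\<delta> * M..L * M} \<tau> \<le> p2 \<zeta> \<tau> r s" if \<tau>: "0 < \<tau>" for \<tau>
    proof (cases "\<tau> \<in> {\<delta> * M..L * M}")
      case True
      have "(L * M) powr (-1/2) \<le> \<tau> powr (-1/2)" using True \<tau> by (intro powr_mono2') auto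
      then have 1: "L powr (-1/2) * M powr (-1/2) \<le> \<tau> powr (-1/2)" by (simp add: powr_mult)
      have "W \<le> P * (\<tau> + r * s) powr (- \<zeta>)"
        unfolding W_def P_def
      proof (rule powr_comparable)
        have "\<tau> \<le> G * M" using True G M by (auto intro: order_trans mult_right_mono)
        moreover have "r * s \<le> G * (r * s)" using mult_right_mono[of 1 G "r * s"] G rs by simp
        ultimately show "\<tau> + r * s \<le> G * (M + r * s)" by (simp add: algebra_simps)
        have "M = (1 / \<delta>) * (\<delta> * M)" using \<delta> by simp
        also have "\<dots> \<le> G * \<tau>" using True G \<delta> M \<tau> by (intro mult_mono) auto
        finally have "M \<le> G * \<tau>" .
        with \<open>r * s \<le> G * (r * s)\<close> show "M + r * s \<le> G * (\<tau> + r * s)" by (simp add: algebra_simps)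
      qed (use M rs \<tau> G in auto)
      then have 2: "W / P \<le> (\<tau> + r * s) powr (- \<zeta>)" using P by (simp add: field_simps)
      have 3: "exp (- 1 / (4 * \<delta>)) \<le> exp (- D / (4 * \<tau>))"
      proof -
        have "D * \<delta> \<le> \<tau>" using True M \<delta> by (auto intro: order_trans[OF mult_right_mono] simp: mult.commute)
        then have "D / (4 * \<tau>) \<le> 1 / (4 * \<delta>)" using \<tau> \<delta> by (simp add: field_simps)
        then show ?thesis by simp
      qed
      have "(L powr (-1/2) * M powr (-1/2)) * (W / P) * exp (- 1 / (4 * \<delta>)) \<le> heat_kernel \<zeta> \<tau> r s"
        unfolding heat_kernel_def D_def[symmetric] using 1 2 3 W P by (intro mult_mono) auto
      also have "\<dots> \<le> K * p2 \<zeta> \<tau> r s" using K(2) \<tau> r s by blast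
      finally have "(L powr (-1/2) * M powr (-1/2)) * (W / P) * exp (- 1 / (4 * \<delta>)) / K \<le> p2 \<zeta> \<tau> r s"
        by (rule div_le)
      then show ?thesis using True by (simp add: c_def mult_ac)
    next
      case False
      then show ?thesis using p2_nonneg[OF \<zeta> \<tau> r s] by simp
    qed
    have "c * M powr (-1/2) * W * (t * M powr (- \<beta>) / 4) \<le> c * M powr (-1/2) * W * measure N {\<delta> * M..L * M}"
      using mass[of t M N] t N' D c W by (intro mult_left_mono) (auto simp: M_def)
    also have "\<dots> = (LINT \<tau>|N. c * M powr (-1/2) * W * indicator {\<delta> * M..L * M} \<tau>)"
      using sets_eq_imp_space_eq[of N borel] N by (simp add: stable_law_def)
    also have "\<dots> \<le> (LINT \<tau>|N. p2 \<zeta> \<tau> r s)"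
    proof (rule integral_mono_AE)
      show "integrable N (\<lambda>\<tau>. c * M powr (-1/2) * W * indicator {\<delta> * M..L * M} \<tau>)"
        by (intro integrable_mult_right integrable_const_bound[where B = 1]) (auto simp: indicator_def)
      show "integrable N (\<lambda>\<tau>. p2 \<zeta> \<tau> r s)"
        using stable_law_p2_upper[OF \<zeta> \<alpha>] t r s N by blast
      show "AE \<tau> in N. c * M powr (-1/2) * W * indicator {\<delta> * M..L * M} \<tau> \<le> p2 \<zeta> \<tau> r s"
        using AE0 by eventually_elim (rule pt)
    qed
    finally have "c * M powr (-1/2) * W * (t * M powr (- \<beta>) / 4) \<le> (LINT \<tau>|N. p2 \<zeta> \<tau> r s)" .
    then have le: "(4 * R / c) * (c * M powr (-1/2) * W * (t * M powr (- \<beta>) / 4)) \<le> (4 * R / c) * (LINT \<tau>|N. p2 \<zeta> \<tau> r s)"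
      using c R by (intro mult_left_mono) auto
    have eq: "(4 * R / c) * (c * M powr (-1/2) * W * (t * M powr (- \<beta>) / 4)) = t * M powr (- (1 + \<alpha>) / 2) * (R * W)"
    proof -
      have "-1/2 + - \<beta> = - (1 + \<alpha>) / 2" by (simp add: \<beta>_def add_divide_distrib)
      then have "M powr (-1/2) * M powr (- \<beta>) = M powr (- (1 + \<alpha>) / 2)"
        by (simp only: powr_add[symmetric])
      moreover have "(4 * R / c) * (c * x * W * (t * y / 4)) = t * (x * y) * (R * W)" for x y
        using c by simp
      ultimately show ?thesis by simp
    qed
    have "t powr (2 / \<alpha>) + (r + s)\<^sup>2 = M + 4 * (r * s)"
      by (simp add: M_def D_def power2_eq_square algebra_simps)
    then have "(t powr (2 / \<alpha>) + (r + s)\<^sup>2) powr (- \<zeta>) \<le> R * W"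
      unfolding W_def R_def using M rs by (intro powr_comparable) auto
    then have "stable_kernel \<zeta> \<alpha> t r s \<le> t * M powr (- (1 + \<alpha>) / 2) * (R * W)"
      unfolding stable_kernel_def M_def D_def using t by (intro mult_left_mono) auto
    with le eq show ?thesis by simp
  qed
  then show ?thesis using c R by (intro exI[of _ "4 * R / c"]) auto
qed

lemma p_alpha_bounds:
  fixes \<zeta> \<alpha> :: real
  assumes \<zeta>: "\<zeta> > -1/2" and \<alpha>: "0 < \<alpha>" "\<alpha> < 2"
  shows "\<exists>K>0. \<forall>t r s. 0 < t \<and> 0 < r \<and> 0 < s \<longrightarrow>
    p_alpha \<zeta> \<alpha> t r s \<le> K * stable_kernel \<zeta> \<alpha> t r s \<and> stable_kernel \<zeta> \<alpha> t r s \<le> K * p_alpha \<zeta> \<alpha> t r s"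
proof -
  obtain C1 where C1: "0 < C1" "\<And>t N r s. 0 < t \<and> 0 < r \<and> 0 < s \<and> stable_law (\<alpha> / 2) t N \<Longrightarrow>
    (LINT \<tau>|N. p2 \<zeta> \<tau> r s) \<le> C1 * stable_kernel \<zeta> \<alpha> t r s"
    using stable_law_p2_upper[OF assms] by blast
  obtain C2 where C2: "0 < C2" "\<And>t N r s. 0 < t \<and> 0 < r \<and> 0 < s \<and> stable_law (\<alpha> / 2) t N \<Longrightarrow>
    stable_kernel \<zeta> \<alpha> t r s \<le> C2 * (LINT \<tau>|N. p2 \<zeta> \<tau> r s)"
    using stable_law_p2_lower[OF assms] by blast
  have "p_alpha \<zeta> \<alpha> t r s \<le> (C1 + C2) * stable_kernel \<zeta> \<alpha> t r s \<and> stable_kernel \<zeta> \<alpha> t r s \<le> (C1 + C2) * p_alpha \<zeta> \<alpha> t r s"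
    if trs: "0 < t" "0 < r" "0 < s" for t r s
  proof -
    obtain N where N: "stable_law (\<alpha> / 2) t N"
      and int: "\<And>h. h \<in> borel_measurable borel \<Longrightarrow> (LINT \<tau>:{0<..}|lborel. h \<tau> * stable_density \<alpha> t \<tau>) = (LINT \<tau>|N. h \<tau> :: real)"
      using stable_law_of_stable_density[OF \<alpha> trs(1)] by blast
    have p: "p_alpha \<zeta> \<alpha> t r s = (LINT \<tau>|N. p2 \<zeta> \<tau> r s)"
      using \<alpha> int[OF p2_measurable] by (simp add: p_alpha_def)
    have sk: "0 \<le> stable_kernel \<zeta> \<alpha> t r s" using trs by (simp add: stable_kernel_def)
    have 1: "p_alpha \<zeta> \<alpha> t r s \<le> C1 * stable_kernel \<zeta> \<alpha> t r s" unfolding p using C1(2) N trs by blast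
    have 2: "stable_kernel \<zeta> \<alpha> t r s \<le> C2 * p_alpha \<zeta> \<alpha> t r s" unfolding p using C2(2) N trs by blast
    have "0 \<le> C2 * p_alpha \<zeta> \<alpha> t r s" using 2 sk by linarith
    then have p0: "0 \<le> p_alpha \<zeta> \<alpha> t r s" using C2(1) by (rule zero_le_mult_imp_nonneg)
    have "C1 * stable_kernel \<zeta> \<alpha> t r s \<le> (C1 + C2) * stable_kernel \<zeta> \<alpha> t r s"
      "C2 * p_alpha \<zeta> \<alpha> t r s \<le> (C1 + C2) * p_alpha \<zeta> \<alpha> t r s"
      using C1(1) C2(1) sk p0 by (auto intro!: mult_right_mono)
    with 1 2 show ?thesis by linarith
  qed
  then show ?thesis using C1(1) C2(1) by (intro exI[of _ "C1 + C2"]) auto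
qed

text \<open>Subordination averages over time only, so an inequality with fixed space points and a
  constant independent of the time survives it, whatever \<alpha> is.\<close>

lemma p_alpha_mono_of_p2:
  assumes \<zeta>: "\<zeta> > -1/2" and \<alpha>: "0 < \<alpha>" "\<alpha> \<le> 2" and t: "0 < t" and pos: "0 < r" "0 < s" "0 < r'" "0 < s'"
    and le: "\<And>\<tau>. 0 < \<tau> \<Longrightarrow> p2 \<zeta> \<tau> r s \<le> K * p2 \<zeta> \<tau> r' s'"
  shows "p_alpha \<zeta> \<alpha> t r s \<le> K * p_alpha \<zeta> \<alpha> t r' s'"
proof (cases "\<alpha> = 2")
  case True
  then show ?thesis using le[OF t] by (simp add: p_alpha_def)
next
  case False
  then have a: "0 < \<alpha>" "\<alpha> < 2" using \<alpha> by auto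
  obtain N where N: "stable_law (\<alpha> / 2) t N"
    and int: "\<And>h. h \<in> borel_measurable borel \<Longrightarrow> (LINT \<tau>:{0<..}|lborel. h \<tau> * stable_density \<alpha> t \<tau>) = (LINT \<tau>|N. h \<tau> :: real)"
    using stable_law_of_stable_density[OF a t] by blast
  have i: "integrable N (\<lambda>\<tau>. p2 \<zeta> \<tau> r s)" "integrable N (\<lambda>\<tau>. p2 \<zeta> \<tau> r' s')"
    using stable_law_p2_upper[OF \<zeta> a] t pos N by blast+
  have AE0: "AE \<tau> in N. 0 < \<tau>" using N by (simp add: stable_law_def)
  have "(LINT \<tau>|N. p2 \<zeta> \<tau> r s) \<le> (LINT \<tau>|N. K * p2 \<zeta> \<tau> r' s')"
  proof (rule integral_mono_AE)
    show "AE \<tau> in N. p2 \<zeta> \<tau> r s \<le> K * p2 \<zeta> \<tau> r' s'"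
      using AE0 by eventually_elim (rule le)
  qed (use i in auto)
  then show ?thesis
    using False int[OF p2_measurable] by (simp add: p_alpha_def)
qed

section \<open>Inequalities between the comparison kernels\<close>

text \<open>The device for trading polynomial factors against Gaussians: two quantities whose ratio
  is controlled by 1 + y have powers that differ by an arbitrarily small multiple of y in the
  exponent. In the applications y is a squared distance over the time.\<close>

lemma powr_le_powr_exp:
  fixes p \<epsilon> M :: real
  assumes "0 < \<epsilon>" "1 \<le> M"
  shows "\<exists>K>0. \<forall>a b y. 0 < a \<and> 0 < b \<and> 0 \<le> y \<and> a \<le> M * b * (1 + y) \<and> b \<le> M * a * (1 + y)
    \<longrightarrow> a powr p \<le> K * b powr p * exp (\<epsilon> * y)"
proof -
  obtain K where K: "0 < K" "\<And>x. 0 \<le> x \<Longrightarrow> (1 + x) powr \<bar>p\<bar> \<le> K * exp (\<epsilon> * x)"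
    using powr_le_exp[OF assms(1)] by blast
  have "a powr p \<le> (M powr \<bar>p\<bar> * K) * b powr p * exp (\<epsilon> * y)"
    if h: "0 < a" "0 < b" "0 \<le> y" "a \<le> M * b * (1 + y)" "b \<le> M * a * (1 + y)" for a b y
  proof -
    have "1 * 1 \<le> M * (1 + y)" using assms h by (intro mult_mono) auto
    then have "a powr p \<le> (M * (1 + y)) powr \<bar>p\<bar> * b powr p"
      using h by (intro powr_comparable) (auto simp: mult_ac)
    also have "(M * (1 + y)) powr \<bar>p\<bar> = M powr \<bar>p\<bar> * (1 + y) powr \<bar>p\<bar>" by (rule powr_mult)
    also have "\<dots> * b powr p \<le> M powr \<bar>p\<bar> * (K * exp (\<epsilon> * y)) * b powr p"
      using K(2)[OF h(3)] by (intro mult_right_mono mult_left_mono) auto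
    finally show ?thesis by (simp add: mult_ac)
  qed
  then show ?thesis using K(1) assms by (intro exI[of _ "M powr \<bar>p\<bar> * K"]) auto
qed

lemma powr_neg_le:
  fixes a b M p :: real
  assumes "0 < a" "0 < b" "0 < M" "b \<le> M * a" "0 \<le> p"
  shows "a powr (- p) \<le> M powr p * b powr (- p)"
proof -
  have "b powr p \<le> (M * a) powr p" using assms by (intro powr_mono2) auto
  then have "b powr p \<le> M powr p * a powr p" by (simp add: powr_mult)
  then show ?thesis using assms by (simp add: powr_minus_divide field_simps)
qed

text \<open>The first power has a negative exponent, so a one-sided hypothesis on its base suffices;
  the base raised to -\<zeta> needs both directions.\<close>

lemma stable_kernel_le:
  assumes \<alpha>: "0 < \<alpha>" and M: "1 \<le> M" and t: "0 < t" "0 < t'" "t \<le> M * t'"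
    and rs: "0 < r" "0 < s" "0 < r'" "0 < s'"
    and A: "t' powr (2 / \<alpha>) + (r' - s')\<^sup>2 \<le> M * (t powr (2 / \<alpha>) + (r - s)\<^sup>2)"
    and B: "t powr (2 / \<alpha>) + (r + s)\<^sup>2 \<le> M * (t' powr (2 / \<alpha>) + (r' + s')\<^sup>2)"
      "t' powr (2 / \<alpha>) + (r' + s')\<^sup>2 \<le> M * (t powr (2 / \<alpha>) + (r + s)\<^sup>2)"
  shows "stable_kernel \<zeta> \<alpha> t r s \<le> (M * M powr ((1 + \<alpha>) / 2) * M powr \<bar>- \<zeta>\<bar>) * stable_kernel \<zeta> \<alpha> t' r' s'"
proof -
  have pos: "0 < t powr (2 / \<alpha>) + x\<^sup>2" "0 < t' powr (2 / \<alpha>) + x\<^sup>2" for x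
    using t by (auto intro!: add_pos_nonneg)
  have e: "- (1 + \<alpha>) / 2 = - ((1 + \<alpha>) / 2)" by (rule minus_divide_left[symmetric])
  have 1: "(t powr (2 / \<alpha>) + (r - s)\<^sup>2) powr (- (1 + \<alpha>) / 2)
    \<le> M powr ((1 + \<alpha>) / 2) * (t' powr (2 / \<alpha>) + (r' - s')\<^sup>2) powr (- (1 + \<alpha>) / 2)"
    unfolding e using \<alpha> M A pos by (intro powr_neg_le) auto
  have 2: "(t powr (2 / \<alpha>) + (r + s)\<^sup>2) powr (- \<zeta>) \<le> M powr \<bar>- \<zeta>\<bar> * (t' powr (2 / \<alpha>) + (r' + s')\<^sup>2) powr (- \<zeta>)"
    using M B pos by (intro powr_comparable) auto
  have "stable_kernel \<zeta> \<alpha> t r s \<le> (M * t') * (M powr ((1 + \<alpha>) / 2) * (t' powr (2 / \<alpha>) + (r' - s')\<^sup>2) powr (- (1 + \<alpha>) / 2))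
    * (M powr \<bar>- \<zeta>\<bar> * (t' powr (2 / \<alpha>) + (r' + s')\<^sup>2) powr (- \<zeta>))"
    unfolding stable_kernel_def using 1 2 t M by (intro mult_mono) auto
  also have "\<dots> = (M * M powr ((1 + \<alpha>) / 2) * M powr \<bar>- \<zeta>\<bar>) * stable_kernel \<zeta> \<alpha> t' r' s'"
    unfolding stable_kernel_def by (simp only: mult_ac)
  finally show ?thesis .
qed

section \<open>Changes of time and of scale\<close>

lemma stable_kernel_time_le:
  assumes \<alpha>: "0 < \<alpha>" and M: "1 \<le> M"
  shows "\<exists>k>0. \<forall>t t' r s. 0 < t \<and> 0 < t' \<and> t \<le> M * t' \<and> t' \<le> M * t \<and> 0 < r \<and> 0 < s
    \<longrightarrow> stable_kernel \<zeta> \<alpha> t r s \<le> k * stable_kernel \<zeta> \<alpha> t' r s"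
proof -
  \<comment> \<open>Dominates the ratio of the times as well as the ratio of their powers with
    exponent 2 / \<alpha>.\<close>
  define L where "L = M + M powr (2 / \<alpha>)"
  have L: "1 \<le> L" "M \<le> L" "M powr (2 / \<alpha>) \<le> L" using M by (auto simp: L_def add_increasing2)
  have "stable_kernel \<zeta> \<alpha> t r s \<le> (L * L powr ((1 + \<alpha>) / 2) * L powr \<bar>- \<zeta>\<bar>) * stable_kernel \<zeta> \<alpha> t' r s"
    if h: "0 < t" "0 < t'" "t \<le> M * t'" "t' \<le> M * t" "0 < r" "0 < s" for t t' r s
  proof -
    have T: "t powr (2 / \<alpha>) \<le> L * t' powr (2 / \<alpha>)" "t' powr (2 / \<alpha>) \<le> L * t powr (2 / \<alpha>)"
    proof -
      have "t powr (2 / \<alpha>) \<le> M powr \<bar>2 / \<alpha>\<bar> * t' powr (2 / \<alpha>)" using h M by (intro powr_comparable)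
      also have "\<dots> \<le> L * t' powr (2 / \<alpha>)" using L \<alpha> by (intro mult_right_mono) auto
      finally show "t powr (2 / \<alpha>) \<le> L * t' powr (2 / \<alpha>)" .
      have "t' powr (2 / \<alpha>) \<le> M powr \<bar>2 / \<alpha>\<bar> * t powr (2 / \<alpha>)" using h M by (intro powr_comparable)
      also have "\<dots> \<le> L * t powr (2 / \<alpha>)" using L \<alpha> by (intro mult_right_mono) auto
      finally show "t' powr (2 / \<alpha>) \<le> L * t powr (2 / \<alpha>)" .
    qed
    have x: "x\<^sup>2 \<le> L * x\<^sup>2" for x :: real using mult_right_mono[of 1 L "x\<^sup>2"] L by simp
    have "M * t' \<le> L * t'" using h L by (intro mult_right_mono) auto
    then show ?thesis
      using h L T x[of "r - s"] x[of "r + s"]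
      by (intro stable_kernel_le \<alpha>; (simp only: distrib_left)?; linarith)
  qed
  then show ?thesis using L by (intro exI[of _ "L * L powr ((1 + \<alpha>) / 2) * L powr \<bar>- \<zeta>\<bar>"]) auto
qed

lemma stable_kernel_scale_le:
  assumes \<alpha>: "0 < \<alpha>" and c: "0 < c"
  shows "\<exists>k>0. \<forall>t r s. 0 < t \<and> 0 < r \<and> 0 < s
    \<longrightarrow> stable_kernel \<zeta> \<alpha> t (c * r) (c * s) \<le> k * stable_kernel \<zeta> \<alpha> t r s
      \<and> stable_kernel \<zeta> \<alpha> t r s \<le> k * stable_kernel \<zeta> \<alpha> t (c * r) (c * s)"
proof -
  \<comment> \<open>The three summands serve the unscaled time term, the factor c^2, and its inverse
    in the opposite comparison.\<close>
  define L where "L = 1 + c\<^sup>2 + 1 / c\<^sup>2"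
  have L: "1 \<le> L" by (simp add: L_def)
  have e: "(c * r - c * s)\<^sup>2 = c\<^sup>2 * (r - s)\<^sup>2" "(c * r + c * s)\<^sup>2 = c\<^sup>2 * (r + s)\<^sup>2" for r s
    by (simp_all add: power2_eq_square algebra_simps)
  have x: "c\<^sup>2 * y\<^sup>2 \<le> L * y\<^sup>2" "y\<^sup>2 \<le> L * (c\<^sup>2 * y\<^sup>2)" for y :: real
  proof -
    show "c\<^sup>2 * y\<^sup>2 \<le> L * y\<^sup>2" by (intro mult_right_mono) (auto simp: L_def)
    have "1 * y\<^sup>2 \<le> (L * c\<^sup>2) * y\<^sup>2"
    proof (intro mult_right_mono)
      have "L * c\<^sup>2 = c\<^sup>2 + c\<^sup>2 * c\<^sup>2 + 1" using c by (simp add: L_def algebra_simps)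
      then show "1 \<le> L * c\<^sup>2" by simp
    qed simp
    then show "y\<^sup>2 \<le> L * (c\<^sup>2 * y\<^sup>2)" by (simp add: mult.assoc)
  qed
  have T: "t powr (2 / \<alpha>) \<le> L * t powr (2 / \<alpha>)" for t using mult_right_mono[of 1 L "t powr (2 / \<alpha>)"] L by simp
  have tt: "t \<le> L * t" if "0 < t" for t using mult_right_mono[of 1 L t] L that by simp
  have "stable_kernel \<zeta> \<alpha> t (c * r) (c * s) \<le> (L * L powr ((1 + \<alpha>) / 2) * L powr \<bar>- \<zeta>\<bar>) * stable_kernel \<zeta> \<alpha> t r s"
    "stable_kernel \<zeta> \<alpha> t r s \<le> (L * L powr ((1 + \<alpha>) / 2) * L powr \<bar>- \<zeta>\<bar>) * stable_kernel \<zeta> \<alpha> t (c * r) (c * s)"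
    if h: "0 < t" "0 < r" "0 < s" for t r s
  proof -
    have pos: "0 < c * r" "0 < c * s" using c h by auto
    show "stable_kernel \<zeta> \<alpha> t (c * r) (c * s) \<le> (L * L powr ((1 + \<alpha>) / 2) * L powr \<bar>- \<zeta>\<bar>) * stable_kernel \<zeta> \<alpha> t r s"
      using h pos L T[of t] x[of "r - s"] x[of "r + s"] tt[of t]
      by (intro stable_kernel_le \<alpha>; (simp only: e distrib_left)?; linarith)
    show "stable_kernel \<zeta> \<alpha> t r s \<le> (L * L powr ((1 + \<alpha>) / 2) * L powr \<bar>- \<zeta>\<bar>) * stable_kernel \<zeta> \<alpha> t (c * r) (c * s)"
      using h pos L T[of t] x[of "r - s"] x[of "r + s"] tt[of t]
      by (intro stable_kernel_le \<alpha>; (simp only: e distrib_left)?; linarith)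
  qed
  then show ?thesis using L by (intro exI[of _ "L * L powr ((1 + \<alpha>) / 2) * L powr \<bar>- \<zeta>\<bar>"]) auto
qed

text \<open>Matching the Gaussians exactly would scale space by \<tau>^(-1/2). The factors sqrt(1/C)
  and sqrt(C) are the extreme values of this over the time interval, so one Gaussian decays at least
  as fast, and the other at most as fast, for all admissible \<tau>. The remaining powers are
  comparable.\<close>

lemma heat_kernel_time_le:
  assumes C: "0 < C" "C \<le> 1"
  shows "\<exists>k>0. \<forall>z s \<tau>. 0 < z \<and> 0 < s \<and> C \<le> \<tau> \<and> \<tau> \<le> 1 / C
    \<longrightarrow> heat_kernel \<zeta> 1 (sqrt (1 / C) * z) (sqrt (1 / C) * s) \<le> k * heat_kernel \<zeta> \<tau> z s
      \<and> heat_kernel \<zeta> \<tau> z s \<le> k * heat_kernel \<zeta> 1 (sqrt C * z) (sqrt C * s)"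
proof -
  define M where "M = 1 / C"
  have M: "1 \<le> M" "M * C = 1" "C \<le> M" using C by (auto simp: M_def field_simps mult_le_one)
  have hk: "heat_kernel \<zeta> 1 (sqrt a * z) (sqrt a * s) = (1 + a * (z * s)) powr (- \<zeta>) * exp (- (a * (z - s)\<^sup>2) / 4)"
    if "0 \<le> a" for a z s
  proof -
    have q: "sqrt a * sqrt a = a" using that by simp
    have "sqrt a * z * (sqrt a * s) = (sqrt a * sqrt a) * (z * s)" by (simp only: mult_ac)
    then have 1: "sqrt a * z * (sqrt a * s) = a * (z * s)" unfolding q .
    have "sqrt a * z - sqrt a * s = sqrt a * (z - s)" by (simp add: algebra_simps)
    then have "(sqrt a * z - sqrt a * s)\<^sup>2 = (sqrt a * sqrt a) * (z - s)\<^sup>2"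
      by (simp only: power2_eq_square mult_ac)
    then have 2: "(sqrt a * z - sqrt a * s)\<^sup>2 = a * (z - s)\<^sup>2" unfolding q .
    show ?thesis unfolding heat_kernel_def 1 2 by simp
  qed
  define k where "k = M powr \<bar>-1/2\<bar> * M powr \<bar>- \<zeta>\<bar>"
  have k: "0 < k" using M by (simp add: k_def)
  have "heat_kernel \<zeta> 1 (sqrt (1 / C) * z) (sqrt (1 / C) * s) \<le> k * heat_kernel \<zeta> \<tau> z s
      \<and> heat_kernel \<zeta> \<tau> z s \<le> k * heat_kernel \<zeta> 1 (sqrt C * z) (sqrt C * s)"
    if h: "0 < z" "0 < s" "C \<le> \<tau>" "\<tau> \<le> 1 / C" for z s \<tau>
  proof
    have \<tau>: "0 < \<tau>" "\<tau> \<le> M" "1 \<le> M * \<tau>" using h C by (auto simp: M_def field_simps)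
    have zs: "0 < z * s" using h by simp
    have mz: "z * s \<le> M * (z * s)" using mult_right_mono[of 1 M "z * s"] M zs by simp
    have t1: "1 \<le> M powr \<bar>-1/2\<bar> * \<tau> powr (-1/2)"
      using powr_comparable[of 1 \<tau> M "-1/2"] \<tau> M by simp
    have t2: "\<tau> powr (-1/2) \<le> M powr \<bar>-1/2\<bar>"
      using powr_comparable[of \<tau> 1 M "-1/2"] \<tau> M by simp
    have a1: "(1 + M * (z * s)) powr (- \<zeta>) \<le> M powr \<bar>- \<zeta>\<bar> * (\<tau> + z * s) powr (- \<zeta>)"
    proof (rule powr_comparable)
      show "1 + M * (z * s) \<le> M * (\<tau> + z * s)" using \<tau> by (simp add: algebra_simps)
      have "M * (z * s) \<le> M * (M * (z * s))" using mz M by (intro mult_left_mono) auto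
      then show "\<tau> + z * s \<le> M * (1 + M * (z * s))" using \<tau> mz by (simp only: distrib_left)
    qed (use M zs \<tau> in \<open>auto simp: add_pos_pos\<close>)
    have a2: "(\<tau> + z * s) powr (- \<zeta>) \<le> M powr \<bar>- \<zeta>\<bar> * (1 + C * (z * s)) powr (- \<zeta>)"
    proof (rule powr_comparable)
      have "M * (C * (z * s)) = z * s" using M by (simp add: mult.assoc[symmetric])
      then show "\<tau> + z * s \<le> M * (1 + C * (z * s))" using \<tau> by (simp only: distrib_left mult_1_right)
      have "C * (z * s) \<le> M * (z * s)" using M zs by (intro mult_right_mono) auto
      then show "1 + C * (z * s) \<le> M * (\<tau> + z * s)" using \<tau> by (simp add: distrib_left)
    qed (use M zs \<tau> C in \<open>auto simp: add_pos_pos\<close>)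
    have e1: "exp (- (M * (z - s)\<^sup>2) / 4) \<le> exp (- (z - s)\<^sup>2 / (4 * \<tau>))"
    proof -
      have "1 / \<tau> \<le> M" using \<tau> by (simp add: field_simps)
      then have "1 / \<tau> * (z - s)\<^sup>2 \<le> M * (z - s)\<^sup>2" by (intro mult_right_mono) auto
      then show ?thesis by simp
    qed
    have e2: "exp (- (z - s)\<^sup>2 / (4 * \<tau>)) \<le> exp (- (C * (z - s)\<^sup>2) / 4)"
    proof -
      have "C \<le> 1 / \<tau>" using \<tau> h C by (simp add: field_simps)
      then have "C * (z - s)\<^sup>2 \<le> 1 / \<tau> * (z - s)\<^sup>2" by (intro mult_right_mono) auto
      then show ?thesis by simp
    qed
    have "heat_kernel \<zeta> 1 (sqrt (1 / C) * z) (sqrt (1 / C) * s)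
      = 1 * (1 + M * (z * s)) powr (- \<zeta>) * exp (- (M * (z - s)\<^sup>2) / 4)"
      using C by (subst hk) (auto simp: M_def)
    also have "\<dots> \<le> (M powr \<bar>-1/2\<bar> * \<tau> powr (-1/2)) * (M powr \<bar>- \<zeta>\<bar> * (\<tau> + z * s) powr (- \<zeta>)) * exp (- (z - s)\<^sup>2 / (4 * \<tau>))"
      using t1 a1 e1 M by (intro mult_mono) auto
    also have "\<dots> = k * heat_kernel \<zeta> \<tau> z s" unfolding k_def heat_kernel_def by (simp only: mult_ac)
    finally show "heat_kernel \<zeta> 1 (sqrt (1 / C) * z) (sqrt (1 / C) * s) \<le> k * heat_kernel \<zeta> \<tau> z s" .
    have "heat_kernel \<zeta> \<tau> z s \<le> M powr \<bar>-1/2\<bar> * (M powr \<bar>- \<zeta>\<bar> * (1 + C * (z * s)) powr (- \<zeta>)) * exp (- (C * (z - s)\<^sup>2) / 4)"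
      unfolding heat_kernel_def using t2 a2 e2 by (intro mult_mono) auto
    also have "\<dots> = k * heat_kernel \<zeta> 1 (sqrt C * z) (sqrt C * s)"
      using C by (subst hk) (simp_all only: k_def mult_ac less_imp_le)
    finally show "heat_kernel \<zeta> \<tau> z s \<le> k * heat_kernel \<zeta> 1 (sqrt C * z) (sqrt C * s)" .
  qed
  then show ?thesis using k by blast
qed

text \<open>With y = s^2 / \<tau>, the distance |z - s| \<ge> s / 2 gives Gaussian decay exp(-y /
  16). Half of it pays for replacing \<tau> + z s by \<tau> + s^2, whose ratio is at most 1 + y; the
  other half is the 1/32 in the conclusion.\<close>

lemma heat_kernel_far_le:
  "\<exists>k>0. \<forall>\<tau> z s. 0 < \<tau> \<and> 0 < z \<and> z \<le> s / 2 \<longrightarrow>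
    heat_kernel \<zeta> \<tau> z s \<le> k * (\<tau> powr (-1/2) * exp (- (1/32) * s\<^sup>2 / \<tau>) / (\<tau> + s\<^sup>2) powr \<zeta>)"
proof -
  obtain K where K: "0 < K" "\<And>a b y. 0 < a \<and> 0 < b \<and> 0 \<le> y \<and> a \<le> 1 * b * (1 + y) \<and> b \<le> 1 * a * (1 + y)
    \<Longrightarrow> a powr (- \<zeta>) \<le> K * b powr (- \<zeta>) * exp (1/32 * y)"
    using powr_le_powr_exp[of "1/32" 1 "- \<zeta>"] by auto
  have "heat_kernel \<zeta> \<tau> z s \<le> K * (\<tau> powr (-1/2) * exp (- (1/32) * s\<^sup>2 / \<tau>) / (\<tau> + s\<^sup>2) powr \<zeta>)"
    if h: "0 < \<tau>" "0 < z" "z \<le> s / 2" for \<tau> z s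
  proof -
    define y where "y = s\<^sup>2 / \<tau>"
    have s: "0 < s" using h by linarith
    have y: "0 \<le> y" "\<tau> * y = s\<^sup>2" using h by (auto simp: y_def)
    have zs: "0 < z * s" "z * s \<le> s\<^sup>2" using h s by (auto simp: power2_eq_square intro!: mult_right_mono)
    have "(\<tau> + z * s) powr (- \<zeta>) \<le> K * (\<tau> + s\<^sup>2) powr (- \<zeta>) * exp (1/32 * y)"
    proof (rule K(2), intro conjI)
      have "\<tau> + s\<^sup>2 = \<tau> * (1 + y)" using y by (simp add: distrib_left)
      also have "\<dots> \<le> (\<tau> + z * s) * (1 + y)" using y zs by (intro mult_right_mono) auto
      finally show "\<tau> + s\<^sup>2 \<le> 1 * (\<tau> + z * s) * (1 + y)" by simp
      have "(\<tau> + s\<^sup>2) * 1 \<le> (\<tau> + s\<^sup>2) * (1 + y)" using y h by (intro mult_left_mono) auto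
      then show "\<tau> + z * s \<le> 1 * (\<tau> + s\<^sup>2) * (1 + y)" using zs by simp
    qed (use h s zs y in \<open>auto intro: add_pos_nonneg\<close>)
    moreover have "exp (- (z - s)\<^sup>2 / (4 * \<tau>)) \<le> exp (- (1/16) * y)"
    proof -
      have "(s / 2)\<^sup>2 \<le> (s - z)\<^sup>2" using h s by (intro power_mono) auto
      then have "s\<^sup>2 / 4 \<le> (z - s)\<^sup>2" by (simp add: power2_commute power_divide)
      then have "s\<^sup>2 / 4 / (4 * \<tau>) \<le> (z - s)\<^sup>2 / (4 * \<tau>)" using h by (intro divide_right_mono) auto
      then show ?thesis by (simp add: y_def)
    qed
    ultimately have "heat_kernel \<zeta> \<tau> z s \<le> \<tau> powr (-1/2) * (K * (\<tau> + s\<^sup>2) powr (- \<zeta>) * exp (1/32 * y)) * exp (- (1/16) * y)"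
      unfolding heat_kernel_def using K(1) by (intro mult_mono) auto
    also have "\<dots> = K * (\<tau> powr (-1/2) * (exp (1/32 * y) * exp (- (1/16) * y)) * (\<tau> + s\<^sup>2) powr (- \<zeta>))" by simp
    also have "exp (1/32 * y) * exp (- (1/16) * y) = exp (- (1/32) * s\<^sup>2 / \<tau>)"
      by (simp add: exp_add[symmetric] y_def)
    finally show ?thesis by (simp add: powr_minus_divide)
  qed
  then show ?thesis using K(1) by blast
qed

text \<open>Controls the Gaussian of a kernel at the points 1/32 and s/32 by the distance s from the
  origin, up to an additive constant. It is stated for every real s because substituting -s handles
  the sum of the points.\<close>

lemma shifted_square_le: "(1/32 - 1/32 * s)\<^sup>2 \<le> 1 + s\<^sup>2 / 32" for s :: real
proof -
  have *: "x \<le> 1 + q / 32" if "x = (1 - 2 * s + q) / 1024" "0 \<le> 1 + 2 * s + q" "0 \<le> q" for x q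
    using that by simp
  show ?thesis
  proof (rule *)
    show "(1/32 - 1/32 * s)\<^sup>2 = (1 - 2 * s + s\<^sup>2) / 1024"
      by (simp add: power2_eq_square algebra_simps)
    show "0 \<le> 1 + 2 * s + s\<^sup>2"
      using zero_le_power2[of "1 + s"] by (simp add: power2_eq_square algebra_simps)
  qed simp
qed

text \<open>Of the available exponent y / 32, one half pays for changing the base of the power with
  exponent -\<zeta>. The rest exceeds the y / 128 required by the contracted points; the additive
  constant in the shifted square costs at most 1 / C because \<tau> \<ge> C.\<close>

lemma heat_kernel_late_le:
  assumes C: "0 < C"
  shows "\<exists>k>0. \<forall>\<tau> s. C \<le> \<tau> \<and> 0 < s \<longrightarrow>
    \<tau> powr (-1/2) * exp (- (1/32) * s\<^sup>2 / \<tau>) / (\<tau> + s\<^sup>2) powr \<zeta> \<le> k * heat_kernel \<zeta> \<tau> (1/32) (1/32 * s)"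
proof -
  define M where "M = 1 + 1 / C"
  have M: "1 \<le> M" using C by (simp add: M_def)
  obtain K where K: "0 < K" "\<And>a b y. 0 < a \<and> 0 < b \<and> 0 \<le> y \<and> a \<le> M * b * (1 + y) \<and> b \<le> M * a * (1 + y)
    \<Longrightarrow> a powr (- \<zeta>) \<le> K * b powr (- \<zeta>) * exp (1/64 * y)"
    using powr_le_powr_exp[of "1/64" M "- \<zeta>"] M by auto
  have "\<tau> powr (-1/2) * exp (- (1/32) * s\<^sup>2 / \<tau>) / (\<tau> + s\<^sup>2) powr \<zeta> \<le> (K * exp (1 / C)) * heat_kernel \<zeta> \<tau> (1/32) (1/32 * s)"
    if h: "C \<le> \<tau>" "0 < s" for \<tau> s
  proof -
    define y where "y = s\<^sup>2 / \<tau>"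
    have \<tau>: "0 < \<tau>" using h C by linarith
    have y: "0 \<le> y" "\<tau> * y = s\<^sup>2" using \<tau> by (auto simp: y_def)
    define b where "b = \<tau> + 1/32 * (1/32 * s)"
    have b: "0 < b" "\<tau> \<le> b" using \<tau> h by (auto simp: b_def)
    have "(\<tau> + s\<^sup>2) powr (- \<zeta>) \<le> K * b powr (- \<zeta>) * exp (1/64 * y)"
    proof (rule K(2), intro conjI)
      have "\<tau> + s\<^sup>2 = 1 * \<tau> * (1 + y)" using y by (simp add: distrib_left)
      also have "\<dots> \<le> M * b * (1 + y)" using y b M \<tau> by (intro mult_right_mono mult_mono) auto
      finally show "\<tau> + s\<^sup>2 \<le> M * b * (1 + y)" .
      have "2 * s \<le> 1 + s\<^sup>2" using zero_le_power2[of "s - 1"] by (simp add: power2_eq_square algebra_simps)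
      moreover have "1 \<le> \<tau> / C" using h C by simp
      ultimately have "b \<le> \<tau> + (\<tau> / C + s\<^sup>2)" unfolding b_def using h by linarith
      also have "\<dots> \<le> M * (\<tau> + s\<^sup>2)" using C by (simp add: M_def algebra_simps)
      also have "\<dots> * 1 \<le> M * (\<tau> + s\<^sup>2) * (1 + y)" using y M \<tau> by (intro mult_left_mono) auto
      finally show "b \<le> M * (\<tau> + s\<^sup>2) * (1 + y)" by simp
    qed (use h \<tau> b y in \<open>auto intro: add_pos_nonneg\<close>)
    then have "\<tau> powr (-1/2) * exp (- (1/32) * y) * (\<tau> + s\<^sup>2) powr (- \<zeta>)
      \<le> \<tau> powr (-1/2) * exp (- (1/32) * y) * (K * b powr (- \<zeta>) * exp (1/64 * y))"
      by (intro mult_left_mono) auto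
    also have "\<dots> = K * (\<tau> powr (-1/2) * b powr (- \<zeta>)) * (exp (- (1/32) * y) * exp (1/64 * y))" by simp
    also have "exp (- (1/32) * y) * exp (1/64 * y) = exp (- (1/64) * y)" by (simp add: exp_add[symmetric])
    also have "\<dots> \<le> exp (1 / C) * exp (- (1/32 - 1/32 * s)\<^sup>2 / (4 * \<tau>))"
    proof -
      have "(1/32 - 1/32 * s)\<^sup>2 \<le> 1 + s\<^sup>2 / 32"
        by (rule shifted_square_le)
      then have "(1/32 - 1/32 * s)\<^sup>2 / (4 * \<tau>) \<le> (1 + s\<^sup>2 / 32) / (4 * \<tau>)" using \<tau> by (intro divide_right_mono) auto
      also have "\<dots> = 1 / (4 * \<tau>) + y / 128" using \<tau> by (simp add: y_def field_simps)
      also have "1 / (4 * \<tau>) \<le> 1 / C" using h C \<tau> by (intro divide_left_mono) auto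
      finally have "(1/32 - 1/32 * s)\<^sup>2 / (4 * \<tau>) \<le> 1 / C + y / 128" by simp
      then have "- (1/64) * y \<le> 1 / C + - (1/32 - 1/32 * s)\<^sup>2 / (4 * \<tau>)" using y(1) by simp
      then show ?thesis unfolding exp_add[symmetric] by simp
    qed
    finally have "\<tau> powr (-1/2) * exp (- (1/32) * y) * (\<tau> + s\<^sup>2) powr (- \<zeta>)
      \<le> K * (\<tau> powr (-1/2) * b powr (- \<zeta>)) * (exp (1 / C) * exp (- (1/32 - 1/32 * s)\<^sup>2 / (4 * \<tau>)))"
      using K(1) by (simp add: mult_left_mono)
    also have "\<dots> = (K * exp (1 / C)) * heat_kernel \<zeta> \<tau> (1/32) (1/32 * s)"
      unfolding heat_kernel_def b_def by (simp only: mult_ac)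
    finally show ?thesis by (simp add: powr_minus_divide y_def)
  qed
  then show ?thesis using K(1) by (intro exI[of _ "K * exp (1 / C)"]) auto
qed

text \<open>If \<tau> \<le> s^2, then \<tau>^(-1/2) is y^(1/2) / s and the exponential absorbs
  y^(1/2). If \<tau> is larger, what remains is \<tau>^(-1/2 - \<zeta>), which decreases in \<tau>
  as \<zeta> > -1/2 and is therefore largest at \<tau> = s^2.\<close>

lemma gaussian_le_powr:
  fixes \<zeta> :: real
  assumes \<zeta>: "\<zeta> > -1/2"
  shows "\<exists>k>0. \<forall>\<tau> s. 0 < \<tau> \<and> 0 < s \<longrightarrow>
    \<tau> powr (-1/2) * exp (- (1/32) * s\<^sup>2 / \<tau>) / (\<tau> + s\<^sup>2) powr \<zeta> \<le> k * s powr (- (2 * \<zeta> + 1))"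
proof -
  obtain K where K: "0 < K" "\<And>y::real. 0 \<le> y \<Longrightarrow> (1 + y) powr (1/2) \<le> K * exp (1/32 * y)"
    using powr_le_exp[of "1/32" "1/2"] by auto
  define L where "L = 2 powr \<bar>- \<zeta>\<bar>"
  have L: "0 < L" by (simp add: L_def)
  have "\<tau> powr (-1/2) * exp (- (1/32) * s\<^sup>2 / \<tau>) / (\<tau> + s\<^sup>2) powr \<zeta> \<le> ((K + 1) * L) * s powr (- (2 * \<zeta> + 1))"
    if h: "0 < \<tau>" "0 < s" for \<tau> s
  proof -
    define y where "y = s\<^sup>2 / \<tau>"
    have y: "0 < y" "\<tau> * y = s\<^sup>2" using h by (auto simp: y_def)
    have s2: "(s\<^sup>2) powr p = s powr (2 * p)" for p
      using h by (simp add: powr_powr flip: powr_numeral)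
    have "\<tau> powr (-1/2) * exp (- (1/32) * y) * (\<tau> + s\<^sup>2) powr (- \<zeta>) \<le> ((K + 1) * L) * s powr (- (2 * \<zeta> + 1))"
    proof (cases "\<tau> \<le> s\<^sup>2")
      case True
      have 1: "(\<tau> + s\<^sup>2) powr (- \<zeta>) \<le> L * (s\<^sup>2) powr (- \<zeta>)"
        unfolding L_def using True h by (intro powr_comparable) (auto intro: add_pos_nonneg)
      have 2: "\<tau> powr (-1/2) * exp (- (1/32) * y) \<le> K * (s\<^sup>2) powr (-1/2)"
      proof -
        have "(s\<^sup>2) powr (-1/2) * y powr (1/2) = \<tau> powr (-1/2)"
        proof -
          have "(\<tau> * y) powr (-1/2) * y powr (1/2) = \<tau> powr (-1/2) * (y powr (-1/2) * y powr (1/2))"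
            by (simp only: powr_mult mult.assoc)
          also have "y powr (-1/2) * y powr (1/2) = 1"
            using y by (simp add: powr_add[symmetric])
          finally show ?thesis unfolding y(2) by simp
        qed
        then have "\<tau> powr (-1/2) * exp (- (1/32) * y) = (s\<^sup>2) powr (-1/2) * (y powr (1/2) * exp (- (1/32) * y))"
          by (simp only: mult.assoc[symmetric])
        also have "\<dots> \<le> (s\<^sup>2) powr (-1/2) * K"
        proof (intro mult_left_mono)
          have "y powr (1/2) \<le> (1 + y) powr (1/2)" using y by (intro powr_mono2) auto
          also have "\<dots> \<le> K * exp (1/32 * y)" using K(2)[of y] y by simp
          finally have "y powr (1/2) * exp (- (1/32) * y) \<le> K * exp (1/32 * y) * exp (- (1/32) * y)"
            by (intro mult_right_mono) auto
          also have "\<dots> = K" by (simp add: mult.assoc exp_add[symmetric])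
          finally show "y powr (1/2) * exp (- (1/32) * y) \<le> K" .
        qed simp
        finally show ?thesis by (simp only: mult.commute)
      qed
      have "\<tau> powr (-1/2) * exp (- (1/32) * y) * (\<tau> + s\<^sup>2) powr (- \<zeta>) \<le> (K * (s\<^sup>2) powr (-1/2)) * (L * (s\<^sup>2) powr (- \<zeta>))"
        by (rule mult_mono[OF 2 1]) (use K(1) in auto)
      also have "\<dots> = K * L * ((s\<^sup>2) powr (-1/2) * (s\<^sup>2) powr (- \<zeta>))" by (simp only: mult_ac)
      also have "(s\<^sup>2) powr (-1/2) * (s\<^sup>2) powr (- \<zeta>) = s powr (- (2 * \<zeta> + 1))"
        unfolding powr_add[symmetric] s2 by (simp add: algebra_simps)
      also have "K * L * s powr (- (2 * \<zeta> + 1)) \<le> ((K + 1) * L) * s powr (- (2 * \<zeta> + 1))"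
        using L by (intro mult_right_mono) auto
      finally show ?thesis .
    next
      case False
      have 1: "(\<tau> + s\<^sup>2) powr (- \<zeta>) \<le> L * \<tau> powr (- \<zeta>)"
        unfolding L_def using False h by (intro powr_comparable) (auto intro: add_pos_nonneg)
      have 2: "\<tau> powr (-1/2) * exp (- (1/32) * y) \<le> \<tau> powr (-1/2)"
        using y by (intro mult_left_le) auto
      have "\<tau> powr (-1/2) * exp (- (1/32) * y) * (\<tau> + s\<^sup>2) powr (- \<zeta>) \<le> \<tau> powr (-1/2) * (L * \<tau> powr (- \<zeta>))"
        by (rule mult_mono[OF 2 1]) auto
      also have "\<dots> = L * \<tau> powr (-1/2 + - \<zeta>)" by (simp only: powr_add mult_ac)
      also have "\<dots> \<le> L * (s\<^sup>2) powr (-1/2 + - \<zeta>)"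
        using False h \<zeta> L by (intro mult_left_mono powr_mono2') auto
      also have "\<dots> = L * s powr (- (2 * \<zeta> + 1))" unfolding s2 by (intro arg_cong[where f = "\<lambda>e. L * s powr e"]) simp
      also have "\<dots> \<le> ((K + 1) * L) * s powr (- (2 * \<zeta> + 1))"
        using L K(1) by (intro mult_right_mono) auto
      finally show ?thesis .
    qed
    then show ?thesis by (simp add: powr_minus_divide y_def)
  qed
  then show ?thesis using K(1) L by (intro exI[of _ "(K + 1) * L"]) auto
qed

text \<open>Moving the time to 1 affects two powers, and each replacement is paid with y / 128. The
  bound s \<ge> C makes this possible: it gives 1 / \<tau> = y / s^2 \<le> y / C^2. The remaining y
  / 64 dominates the contracted Gaussian, since \<tau> \<le> 1 yields s^2 \<le> y.\<close>

lemma gaussian_le_heat_kernel_1: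
  assumes C: "0 < C"
  shows "\<exists>k>0. \<forall>\<tau> s. 0 < \<tau> \<and> \<tau> \<le> 1 \<and> C \<le> s \<longrightarrow>
    \<tau> powr (-1/2) * exp (- (1/32) * s\<^sup>2 / \<tau>) / (\<tau> + s\<^sup>2) powr \<zeta> \<le> k * heat_kernel \<zeta> 1 (1/32) (1/32 * s)"
proof -
  define M where "M = 2 + 2 / C\<^sup>2"
  have M: "1 \<le> M" using C by (simp add: M_def)
  obtain K where K: "0 < K" "\<And>a b y. 0 < a \<and> 0 < b \<and> 0 \<le> y \<and> a \<le> M * b * (1 + y) \<and> b \<le> M * a * (1 + y)
    \<Longrightarrow> a powr (- \<zeta>) \<le> K * b powr (- \<zeta>) * exp (1/128 * y)"
    using powr_le_powr_exp[of "1/128" M "- \<zeta>"] M by auto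
  define M' where "M' = 1 + 1 / C\<^sup>2"
  have M': "1 \<le> M'" using C by (simp add: M'_def)
  obtain K' where K': "0 < K'" "\<And>a b y. 0 < a \<and> 0 < b \<and> 0 \<le> y \<and> a \<le> M' * b * (1 + y) \<and> b \<le> M' * a * (1 + y)
    \<Longrightarrow> a powr (-1/2) \<le> K' * b powr (-1/2) * exp (1/128 * y)"
    using powr_le_powr_exp[of "1/128" M' "-1/2"] M' by auto
  have "\<tau> powr (-1/2) * exp (- (1/32) * s\<^sup>2 / \<tau>) / (\<tau> + s\<^sup>2) powr \<zeta> \<le> (K' * K * exp 1) * heat_kernel \<zeta> 1 (1/32) (1/32 * s)"
    if h: "0 < \<tau>" "\<tau> \<le> 1" "C \<le> s" for \<tau> s
  proof -
    define y where "y = s\<^sup>2 / \<tau>"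
    have s: "0 < s" using h C by linarith
    have y: "0 \<le> y" "\<tau> * y = s\<^sup>2" using h by (auto simp: y_def)
    have ys: "s\<^sup>2 \<le> y" using mult_right_mono[of \<tau> 1 y] h y by simp
    have Cs: "1 \<le> s\<^sup>2 / C\<^sup>2" using h C by (simp add: power_mono)
    define b where "b = 1 + 1/32 * (1/32 * s)"
    have b: "1 \<le> b" using s by (simp add: b_def)
    have 1: "(\<tau> + s\<^sup>2) powr (- \<zeta>) \<le> K * b powr (- \<zeta>) * exp (1/128 * y)"
    proof (rule K(2), intro conjI)
      have "\<tau> + s\<^sup>2 \<le> 1 * 1 * (1 + y)" using ys h by simp
      also have "\<dots> \<le> M * b * (1 + y)" using y b M by (intro mult_right_mono mult_mono) auto
      finally show "\<tau> + s\<^sup>2 \<le> M * b * (1 + y)" .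
      have "2 * s \<le> 1 + s\<^sup>2" using zero_le_power2[of "s - 1"] by (simp add: power2_eq_square algebra_simps)
      then have "b \<le> 2 + s\<^sup>2" unfolding b_def using s by linarith
      also have "\<dots> \<le> 2 * (s\<^sup>2 / C\<^sup>2) + 2 * s\<^sup>2" using Cs zero_le_power2[of s] by linarith
      also have "\<dots> = M * s\<^sup>2" by (simp add: M_def algebra_simps)
      also have "\<dots> \<le> M * (\<tau> + s\<^sup>2)" using M h by (intro mult_left_mono) auto
      also have "\<dots> * 1 \<le> M * (\<tau> + s\<^sup>2) * (1 + y)" using y M h by (intro mult_left_mono) auto
      finally show "b \<le> M * (\<tau> + s\<^sup>2) * (1 + y)" by simp
    qed (use h b y in \<open>auto intro: add_pos_nonneg\<close>)
    have 2: "\<tau> powr (-1/2) \<le> K' * 1 powr (-1/2) * exp (1/128 * y)"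
    proof (rule K'(2), intro conjI)
      have "1 * 1 \<le> M' * (1 + y)" using y M' by (intro mult_mono) auto
      then show "\<tau> \<le> M' * 1 * (1 + y)" using h by simp
      have "1 \<le> \<tau> * y / C\<^sup>2" using Cs y by simp
      also have "\<dots> \<le> M' * \<tau> * (1 + y)"
      proof -
        have "(1 / C\<^sup>2) * (\<tau> * y) \<le> M' * (\<tau> * (1 + y))"
          using h y M' by (intro mult_mono) (auto simp: M'_def)
        then show ?thesis by (simp add: mult_ac)
      qed
      finally show "1 \<le> M' * \<tau> * (1 + y)" .
    qed (use h y in auto)
    have "\<tau> powr (-1/2) * exp (- (1/32) * y) * (\<tau> + s\<^sup>2) powr (- \<zeta>)
      \<le> (K' * 1 powr (-1/2) * exp (1/128 * y)) * exp (- (1/32) * y) * (K * b powr (- \<zeta>) * exp (1/128 * y))"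
      using 1 2 K'(1) by (intro mult_mono) auto
    also have "\<dots> = K' * K * (1 powr (-1/2) * b powr (- \<zeta>)) * (exp (1/128 * y) * exp (- (1/32) * y) * exp (1/128 * y))"
      by (simp only: mult_ac)
    also have "exp (1/128 * y) * exp (- (1/32) * y) * exp (1/128 * y) = exp (- (1/64) * y)" by (simp add: exp_add[symmetric])
    also have "K' * K * (1 powr (-1/2) * b powr (- \<zeta>)) * exp (- (1/64) * y)
      \<le> K' * K * (1 powr (-1/2) * b powr (- \<zeta>)) * (exp 1 * exp (- (1/32 - 1/32 * s)\<^sup>2 / (4 * 1)))"
    proof (intro mult_left_mono)
      have "(1/32 - 1/32 * s)\<^sup>2 \<le> 1 + s\<^sup>2 / 32"
        by (rule shifted_square_le)
      then have "- (1/64) * y \<le> 1 + - (1/32 - 1/32 * s)\<^sup>2 / (4 * 1)" using ys y by simp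
      then show "exp (- (1/64) * y) \<le> exp 1 * exp (- (1/32 - 1/32 * s)\<^sup>2 / (4 * 1))"
        unfolding exp_add[symmetric] by simp
    qed (use K(1) K'(1) in auto)
    also have "\<dots> = (K' * K * exp 1) * heat_kernel \<zeta> 1 (1/32) (1/32 * s)"
      unfolding heat_kernel_def b_def by (simp only: mult_ac)
    finally show ?thesis by (simp add: powr_minus_divide y_def)
  qed
  then show ?thesis using K(1) K'(1) by (intro exI[of _ "K' * K * exp 1"]) auto
qed

text \<open>Up to a constant, the Gaussian at distance |1 - s| gives exp(-s^2 / 8). Half of this
  pays for the powers, and the other half, s^2 / 16, is the largest exponent that the target can
  have with the contraction 1/2, because |r - s| \<le> s.\<close>

lemma heat_kernel_1_1_le:
  "\<exists>k>0. \<forall>r s. 0 < r \<and> r \<le> s \<longrightarrow> heat_kernel \<zeta> 1 1 s \<le> k * heat_kernel \<zeta> 1 (1/2 * r) (1/2 * s)"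
proof -
  obtain K where K: "0 < K" "\<And>a b y. 0 < a \<and> 0 < b \<and> 0 \<le> y \<and> a \<le> 2 * b * (1 + y) \<and> b \<le> 2 * a * (1 + y)
    \<Longrightarrow> a powr (- \<zeta>) \<le> K * b powr (- \<zeta>) * exp (1/16 * y)"
    using powr_le_powr_exp[of "1/16" 2 "- \<zeta>"] by auto
  have "heat_kernel \<zeta> 1 1 s \<le> (K * exp (1/4)) * heat_kernel \<zeta> 1 (1/2 * r) (1/2 * s)"
    if h: "0 < r" "r \<le> s" for r s
  proof -
    define b where "b = 1 + 1/2 * r * (1/2 * s)"
    have rs: "0 < r * s" "r * s \<le> s\<^sup>2" using h by (auto simp: power2_eq_square intro!: mult_right_mono)
    have b: "1 \<le> b" "b \<le> 1 + s\<^sup>2" using rs by (auto simp: b_def)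
    have s2: "2 * s \<le> 1 + s\<^sup>2" using zero_le_power2[of "s - 1"] by (simp add: power2_eq_square algebra_simps)
    have "1 + s \<le> 2 * (1 + q)" if "2 * s \<le> 1 + q" "0 \<le> q" for q
      using that by simp
    from this[OF s2 zero_le_power2] have s1: "1 + s \<le> 2 * (1 + s\<^sup>2)" .
    have "(1 + 1 * s) powr (- \<zeta>) \<le> K * b powr (- \<zeta>) * exp (1/16 * s\<^sup>2)"
    proof (rule K(2), intro conjI)
      have "2 * 1 * (1 + s\<^sup>2) \<le> 2 * b * (1 + s\<^sup>2)" using b by (intro mult_right_mono) auto
      then show "1 + 1 * s \<le> 2 * b * (1 + s\<^sup>2)" using s1 by linarith
      have "1 * (1 + s\<^sup>2) \<le> 2 * (1 + 1 * s) * (1 + s\<^sup>2)" using h by (intro mult_right_mono) auto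
      then have "1 + s\<^sup>2 \<le> 2 * (1 + 1 * s) * (1 + s\<^sup>2)" by (simp only: mult_1)
      with b(2) show "b \<le> 2 * (1 + 1 * s) * (1 + s\<^sup>2)" by (rule order_trans)
    qed (use h b in auto)
    moreover have "exp (- (1 - s)\<^sup>2 / (4 * 1)) \<le> exp (1/4) * exp (- (1/8) * s\<^sup>2)"
    proof -
      have *: "- x / (4 * 1) \<le> 1/4 + - (1/8) * q" if "x = 1 - 2 * s + q" "4 * s \<le> 4 + q" for x q
        using that by simp
      have "- (1 - s)\<^sup>2 / (4 * 1) \<le> 1/4 + - (1/8) * s\<^sup>2"
      proof (rule *)
        show "(1 - s)\<^sup>2 = 1 - 2 * s + s\<^sup>2" by (simp add: power2_eq_square algebra_simps)
        show "4 * s \<le> 4 + s\<^sup>2"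
          using zero_le_power2[of "s - 2"] by (simp add: power2_eq_square algebra_simps)
      qed
      then show ?thesis unfolding exp_add[symmetric] by simp
    qed
    ultimately have "heat_kernel \<zeta> 1 1 s \<le> 1 powr (-1/2) * (K * b powr (- \<zeta>) * exp (1/16 * s\<^sup>2)) * (exp (1/4) * exp (- (1/8) * s\<^sup>2))"
      unfolding heat_kernel_def using K(1) by (intro mult_mono) auto
    also have "\<dots> = K * exp (1/4) * (1 powr (-1/2) * b powr (- \<zeta>)) * (exp (1/16 * s\<^sup>2) * exp (- (1/8) * s\<^sup>2))"
      by (simp only: mult_ac)
    also have "exp (1/16 * s\<^sup>2) * exp (- (1/8) * s\<^sup>2) = exp (- (1/16) * s\<^sup>2)" by (simp add: exp_add[symmetric])
    also have "K * exp (1/4) * (1 powr (-1/2) * b powr (- \<zeta>)) * exp (- (1/16) * s\<^sup>2)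
      \<le> K * exp (1/4) * (1 powr (-1/2) * b powr (- \<zeta>)) * exp (- (1/2 * r - 1/2 * s)\<^sup>2 / (4 * 1))"
    proof (intro mult_left_mono)
      have "(s - r)\<^sup>2 \<le> s\<^sup>2" using h by (intro power_mono) auto
      moreover have "(1/2 * r - 1/2 * s)\<^sup>2 = (s - r)\<^sup>2 / 4" by (simp add: power2_eq_square algebra_simps)
      ultimately show "exp (- (1/16) * s\<^sup>2) \<le> exp (- (1/2 * r - 1/2 * s)\<^sup>2 / (4 * 1))" by simp
    qed (use K(1) in auto)
    also have "\<dots> = (K * exp (1/4)) * heat_kernel \<zeta> 1 (1/2 * r) (1/2 * s)"
      unfolding heat_kernel_def b_def by (simp only: mult_ac)
    finally show ?thesis .
  qed
  then show ?thesis using K(1) by (intro exI[of _ "K * exp (1/4)"]) auto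
qed

text \<open>Let d = |z - s| and y = d^2 / t. If d is small against s, then z and r are comparable
  with s; otherwise z s and r s are of order d^2 = t y. So the bases of the powers agree up to a
  factor 1 + y, paid with half of the Gaussian exponent y / 4. After contraction by 1/4 the target
  needs at most y / 16, because |r - s| \<le> 2 d.\<close>

lemma heat_kernel_separated_le:
  "\<exists>k>0. \<forall>r s z t. 0 < r \<and> 0 < s \<and> 0 < z \<and> 0 < t \<and> \<bar>z - s\<bar> > \<bar>r - s\<bar> / 2 \<longrightarrow>
    heat_kernel \<zeta> t z s \<le> k * heat_kernel \<zeta> t (1/4 * r) (1/4 * s)"
proof -
  obtain K where K: "0 < K" "\<And>a b y. 0 < a \<and> 0 < b \<and> 0 \<le> y \<and> a \<le> 48 * b * (1 + y) \<and> b \<le> 48 * a * (1 + y)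
    \<Longrightarrow> a powr (- \<zeta>) \<le> K * b powr (- \<zeta>) * exp (1/8 * y)"
    using powr_le_powr_exp[of "1/8" 48 "- \<zeta>"] by auto
  have "heat_kernel \<zeta> t z s \<le> K * heat_kernel \<zeta> t (1/4 * r) (1/4 * s)"
    if h: "0 < r" "0 < s" "0 < z" "0 < t" "\<bar>z - s\<bar> > \<bar>r - s\<bar> / 2" for r s z t
  proof -
    define d where "d = \<bar>z - s\<bar>"
    define y where "y = d\<^sup>2 / t"
    define b where "b = t + 1/4 * r * (1/4 * s)"
    have d: "0 \<le> d" "\<bar>r - s\<bar> \<le> 2 * d" using h by (auto simp: d_def)
    have y: "0 \<le> y" "t * y = d\<^sup>2" using h by (auto simp: y_def)
    have pos: "0 < z * s" "0 < r * s" using h by auto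
    have dd: "0 \<le> d\<^sup>2" by simp
    have tri: "z \<le> s + d" "s \<le> z + d" "r \<le> s + 2 * d" "s \<le> r + 2 * d"
      using abs_le_D1[OF d(2)] abs_le_D2[OF d(2)] by (auto simp: d_def)
    have zs: "z * s \<le> 3 * (r * s) + 20 * d\<^sup>2"
    proof (cases "4 * d \<le> s")
      case True
      have "z \<le> 3 * r" using True tri by linarith
      then have "z * s \<le> 3 * r * s" using h by (intro mult_right_mono) auto
      then show ?thesis using dd by linarith
    next
      case False
      have "z * s \<le> (5 * d) * (4 * d)" using False h d tri by (intro mult_mono) auto
      then show ?thesis using pos by (simp add: power2_eq_square)
    qed
    have rs: "r * s \<le> 4 * (z * s) + 8 * d\<^sup>2"
    proof (cases "2 * d \<le> s")
      case True
      have "r \<le> 4 * z" using True tri by linarith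
      then have "r * s \<le> 4 * z * s" using h by (intro mult_right_mono) auto
      then show ?thesis using dd by linarith
    next
      case False
      have "r * s \<le> (4 * d) * (2 * d)" using False h d tri by (intro mult_mono) auto
      then show ?thesis using pos by (simp add: power2_eq_square)
    qed
    have "(t + z * s) powr (- \<zeta>) \<le> K * b powr (- \<zeta>) * exp (1/8 * y)"
    proof (rule K(2), intro conjI)
      \<comment> \<open>The 48 is 3 * 16: the factor 3 from the bound for z s, times 16 from
        contracting both points by 1/4. It also exceeds the 20 in front of d^2.\<close>
      have "t + p \<le> 48 * (t + q / 16) + 48 * e" if "p \<le> 3 * q + 20 * e" "0 \<le> e" for p q e
        using that h by simp
      from this[OF zs dd] have "t + z * s \<le> 48 * b + 48 * (t * y)" unfolding y(2) b_def by simp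
      also have "\<dots> \<le> 48 * b + 48 * (b * y)" using y(1) pos h by (auto simp: b_def intro!: mult_right_mono)
      finally show "t + z * s \<le> 48 * b * (1 + y)" by (simp add: algebra_simps)
      have "b \<le> (t + z * s) + t * y" using rs y(2) pos by (simp add: b_def)
      also have "\<dots> \<le> (t + z * s) + (t + z * s) * y" using y(1) pos h by (auto intro!: mult_right_mono)
      also have "\<dots> = (t + z * s) * (1 + y)" by (simp add: algebra_simps)
      also have "\<dots> \<le> (48 * (t + z * s)) * (1 + y)" using y(1) pos h by (intro mult_right_mono) auto
      finally show "b \<le> 48 * (t + z * s) * (1 + y)" .
    qed (use h y in \<open>auto simp: b_def intro!: add_pos_pos\<close>)
    then have "heat_kernel \<zeta> t z s \<le> t powr (-1/2) * (K * b powr (- \<zeta>) * exp (1/8 * y)) * exp (- (z - s)\<^sup>2 / (4 * t))"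
      unfolding heat_kernel_def by (intro mult_left_mono mult_right_mono) auto
    also have "(z - s)\<^sup>2 = d\<^sup>2" by (simp add: d_def)
    also have "t powr (-1/2) * (K * b powr (- \<zeta>) * exp (1/8 * y)) * exp (- d\<^sup>2 / (4 * t))
      = K * (t powr (-1/2) * b powr (- \<zeta>)) * (exp (1/8 * y) * exp (- d\<^sup>2 / (4 * t)))" by (simp only: mult_ac)
    also have "exp (1/8 * y) * exp (- d\<^sup>2 / (4 * t)) = exp (- (1/8) * y)"
      by (simp add: exp_add[symmetric] y_def)
    also have "K * (t powr (-1/2) * b powr (- \<zeta>)) * exp (- (1/8) * y)
      \<le> K * (t powr (-1/2) * b powr (- \<zeta>)) * exp (- (1/4 * r - 1/4 * s)\<^sup>2 / (4 * t))"
    proof (intro mult_left_mono)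
      have "(1/4 * r - 1/4 * s)\<^sup>2 = \<bar>r - s\<bar>\<^sup>2 / 16" by (simp add: power2_eq_square algebra_simps)
      also have "\<bar>r - s\<bar>\<^sup>2 \<le> (2 * d)\<^sup>2" using d by (intro power_mono) auto
      finally have "(1/4 * r - 1/4 * s)\<^sup>2 \<le> d\<^sup>2 / 4" by (simp add: power_mult_distrib)
      then have "(1/4 * r - 1/4 * s)\<^sup>2 / (4 * t) \<le> d\<^sup>2 / 4 / (4 * t)" using h by (intro divide_right_mono) auto
      also have "\<dots> = y / 16" by (simp add: y_def)
      finally have "(1/4 * r - 1/4 * s)\<^sup>2 / (4 * t) \<le> y / 16" .
      then have "- (1/8) * y \<le> - (1/4 * r - 1/4 * s)\<^sup>2 / (4 * t)" using y(1) by simp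
      then show "exp (- (1/8) * y) \<le> exp (- (1/4 * r - 1/4 * s)\<^sup>2 / (4 * t))" by simp
    qed (use K(1) in auto)
    also have "\<dots> = K * heat_kernel \<zeta> t (1/4 * r) (1/4 * s)"
      unfolding heat_kernel_def b_def by (simp only: mult_ac)
    finally show ?thesis .
  qed
  then show ?thesis using K(1) by blast
qed

text \<open>For z \<le> s / 2 both s - z and s + z are comparable with s, so the two factors acquire
  the same base and their exponents add up.\<close>

lemma stable_kernel_far_le:
  fixes \<zeta> \<alpha> :: real
  assumes \<alpha>: "0 < \<alpha>"
  shows "\<exists>k>0. \<forall>\<tau> z s. 0 < \<tau> \<and> 0 < z \<and> z \<le> s / 2 \<longrightarrow>
    stable_kernel \<zeta> \<alpha> \<tau> z s \<le> k * (\<tau> * (\<tau> powr (2 / \<alpha>) + s\<^sup>2) powr (- (2 * \<zeta> + 1 + \<alpha>) / 2))"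
proof -
  define p where "p = (1 + \<alpha>) / 2"
  have e: "- (1 + \<alpha>) / 2 = - p" unfolding p_def by (rule minus_divide_left[symmetric])
  define k where "k = 4 powr p * (4::real) powr \<bar>- \<zeta>\<bar>"
  have "stable_kernel \<zeta> \<alpha> \<tau> z s \<le> k * (\<tau> * (\<tau> powr (2 / \<alpha>) + s\<^sup>2) powr (- (2 * \<zeta> + 1 + \<alpha>) / 2))"
    if h: "0 < \<tau>" "0 < z" "z \<le> s / 2" for \<tau> z s
  proof -
    define T where "T = \<tau> powr (2 / \<alpha>)"
    have T: "0 < T" using h by (simp add: T_def)
    have s: "0 < s" using h by linarith
    have sq1: "s\<^sup>2 \<le> 4 * (z - s)\<^sup>2"
    proof -
      have "s\<^sup>2 \<le> (2 * (s - z))\<^sup>2" using h s by (intro power_mono) auto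
      also have "\<dots> = 4 * (z - s)\<^sup>2" by (simp add: power2_eq_square algebra_simps)
      finally show ?thesis .
    qed
    have sq2: "(z + s)\<^sup>2 \<le> 4 * s\<^sup>2"
    proof -
      have "(z + s)\<^sup>2 \<le> (2 * s)\<^sup>2" using h s by (intro power_mono) auto
      then show ?thesis by (simp add: power_mult_distrib)
    qed
    have sq3: "s\<^sup>2 \<le> (z + s)\<^sup>2" using h s by (intro power_mono) auto
    have pos: "0 < T + x\<^sup>2" for x using T by (intro add_pos_nonneg) auto
    have 1: "(T + (z - s)\<^sup>2) powr (- p) \<le> 4 powr p * (T + s\<^sup>2) powr (- p)"
      using pos T sq1 \<alpha> by (intro powr_neg_le) (auto simp: p_def)
    have 2: "(T + (z + s)\<^sup>2) powr (- \<zeta>) \<le> 4 powr \<bar>- \<zeta>\<bar> * (T + s\<^sup>2) powr (- \<zeta>)"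
    proof (rule powr_comparable)
      show "T + s\<^sup>2 \<le> 4 * (T + (z + s)\<^sup>2)" using T sq3 zero_le_power2[of "z + s"] by (simp only: distrib_left)
    qed (use pos T sq2 in auto)
    have "stable_kernel \<zeta> \<alpha> \<tau> z s = \<tau> * (T + (z - s)\<^sup>2) powr (- p) * (T + (z + s)\<^sup>2) powr (- \<zeta>)"
      unfolding stable_kernel_def e T_def ..
    also have "\<dots> \<le> \<tau> * (4 powr p * (T + s\<^sup>2) powr (- p)) * (4 powr \<bar>- \<zeta>\<bar> * (T + s\<^sup>2) powr (- \<zeta>))"
      using 1 2 h by (intro mult_mono) auto
    also have "\<dots> = k * (\<tau> * ((T + s\<^sup>2) powr (- p) * (T + s\<^sup>2) powr (- \<zeta>)))"
      unfolding k_def by (simp only: mult_ac)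
    also have "(T + s\<^sup>2) powr (- p) * (T + s\<^sup>2) powr (- \<zeta>) = (T + s\<^sup>2) powr (- (2 * \<zeta> + 1 + \<alpha>) / 2)"
      unfolding powr_add[symmetric] p_def by (intro arg_cong[where f = "\<lambda>e. (T + s\<^sup>2) powr e"]) (simp add: field_simps)
    finally show ?thesis by (simp add: T_def)
  qed
  moreover have "0 < k" by (simp add: k_def)
  ultimately show ?thesis by blast
qed

text \<open>With X = T + s^2, the power X^(q/2) dominates s^q and T^(q/2) = \<tau>^(q/\<alpha>)
  separately, hence half of their sum. The second bound uses \<tau> = T^(\<alpha>/2) \<le>
  X^(\<alpha>/2) and then lowers X to s^2 under a negative exponent.\<close>

lemma stable_profile_le:
  fixes \<zeta> \<alpha> \<tau> s :: real
  assumes \<zeta>: "\<zeta> > -1/2" and \<alpha>: "0 < \<alpha>" and h: "0 < \<tau>" "0 < s"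
  shows "\<tau> * (\<tau> powr (2 / \<alpha>) + s\<^sup>2) powr (- (2 * \<zeta> + 1 + \<alpha>) / 2)
      \<le> 2 * (\<tau> / (s powr (2 * \<zeta> + 1 + \<alpha>) + \<tau> powr ((2 * \<zeta> + 1 + \<alpha>) / \<alpha>)))"
    and "\<tau> * (\<tau> powr (2 / \<alpha>) + s\<^sup>2) powr (- (2 * \<zeta> + 1 + \<alpha>) / 2) \<le> s powr (- (2 * \<zeta> + 1))"
proof -
  define q where "q = 2 * \<zeta> + 1 + \<alpha>"
  define T where "T = \<tau> powr (2 / \<alpha>)"
  define X where "X = T + s\<^sup>2"
  have q: "0 < q" using \<zeta> \<alpha> by (simp add: q_def)
  have T: "0 < T" "T powr (\<alpha> / 2) = \<tau>" "T powr (q / 2) = \<tau> powr (q / \<alpha>)"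
    using h \<alpha> by (auto simp: T_def powr_powr)
  have X: "0 < X" "T \<le> X" "s\<^sup>2 \<le> X" unfolding X_def using T h by (auto intro: add_pos_nonneg)
  have s2: "(s\<^sup>2) powr e = s powr (2 * e)" for e
    using h by (simp add: powr_powr flip: powr_numeral)
  have e: "- q / 2 = - (q / 2)" by simp
  have "(s\<^sup>2) powr (q / 2) \<le> X powr (q / 2)" using X q by (intro powr_mono2) auto
  moreover have "T powr (q / 2) \<le> X powr (q / 2)" using X q T by (intro powr_mono2) auto
  ultimately have sum: "s powr q + \<tau> powr (q / \<alpha>) \<le> 2 * X powr (q / 2)"
    unfolding s2 T(3) by simp
  have "\<tau> * X powr (- q / 2) = 2 * (\<tau> / (2 * X powr (q / 2)))"
    unfolding e powr_minus_divide by simp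
  also have "\<dots> \<le> 2 * (\<tau> / (s powr q + \<tau> powr (q / \<alpha>)))"
    using sum h X by (intro mult_left_mono divide_left_mono) (auto intro!: mult_pos_pos add_pos_pos)
  finally show "\<tau> * (\<tau> powr (2 / \<alpha>) + s\<^sup>2) powr (- (2 * \<zeta> + 1 + \<alpha>) / 2)
      \<le> 2 * (\<tau> / (s powr (2 * \<zeta> + 1 + \<alpha>) + \<tau> powr ((2 * \<zeta> + 1 + \<alpha>) / \<alpha>)))"
    unfolding q_def X_def T_def .
  have "\<tau> \<le> X powr (\<alpha> / 2)" using X T \<alpha> powr_mono2[of "\<alpha> / 2" T X] by simp
  then have "\<tau> * X powr (- q / 2) \<le> X powr (\<alpha> / 2) * X powr (- q / 2)" by (intro mult_right_mono) auto
  also have "\<dots> = X powr (- ((2 * \<zeta> + 1) / 2))"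
    unfolding powr_add[symmetric] q_def by (intro arg_cong[where f = "\<lambda>e. X powr e"]) (simp add: field_simps)
  also have "\<dots> \<le> (s\<^sup>2) powr (- ((2 * \<zeta> + 1) / 2))"
    using X h \<zeta> by (intro powr_mono2') auto
  also have "\<dots> = s powr (- (2 * \<zeta> + 1))"
    unfolding s2 by (intro arg_cong[where f = "\<lambda>e. s powr e"]) (simp add: field_simps)
  finally show "\<tau> * (\<tau> powr (2 / \<alpha>) + s\<^sup>2) powr (- (2 * \<zeta> + 1 + \<alpha>) / 2) \<le> s powr (- (2 * \<zeta> + 1))"
    unfolding q_def X_def T_def .
qed

text \<open>X plays the role of one squared length replacing both bases of the stable kernel. Only
  an upper bound is asked of the base with r - s, as its exponent is negative.\<close>

lemma stable_kernel_ge: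
  fixes \<zeta> \<alpha> :: real
  assumes \<alpha>: "0 < \<alpha>" and M: "1 \<le> M" and t: "0 < t" and X: "0 < X"
    and A: "t powr (2 / \<alpha>) + (r - s)\<^sup>2 \<le> M * X"
    and B: "t powr (2 / \<alpha>) + (r + s)\<^sup>2 \<le> M * X" "X \<le> M * (t powr (2 / \<alpha>) + (r + s)\<^sup>2)"
  shows "t * X powr (- (2 * \<zeta> + 1 + \<alpha>) / 2) \<le> (M powr ((1 + \<alpha>) / 2) * M powr \<bar>- \<zeta>\<bar>) * stable_kernel \<zeta> \<alpha> t r s"
proof -
  define p where "p = (1 + \<alpha>) / 2"
  have e: "- (1 + \<alpha>) / 2 = - p" unfolding p_def by (rule minus_divide_left[symmetric])
  have pos: "0 < t powr (2 / \<alpha>) + x\<^sup>2" for x using t by (intro add_pos_nonneg) auto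
  have 1: "X powr (- p) \<le> M powr p * (t powr (2 / \<alpha>) + (r - s)\<^sup>2) powr (- p)"
    using X pos M A \<alpha> by (intro powr_neg_le) (auto simp: p_def)
  have 2: "X powr (- \<zeta>) \<le> M powr \<bar>- \<zeta>\<bar> * (t powr (2 / \<alpha>) + (r + s)\<^sup>2) powr (- \<zeta>)"
    using X pos M B by (intro powr_comparable) auto
  have "X powr (- (2 * \<zeta> + 1 + \<alpha>) / 2) = X powr (- p) * X powr (- \<zeta>)"
    unfolding powr_add[symmetric] p_def by (intro arg_cong[where f = "\<lambda>e. X powr e"]) (simp add: field_simps)
  then have "t * X powr (- (2 * \<zeta> + 1 + \<alpha>) / 2) = t * X powr (- p) * X powr (- \<zeta>)" by simp
  also have "\<dots> \<le> t * (M powr p * (t powr (2 / \<alpha>) + (r - s)\<^sup>2) powr (- p)) * (M powr \<bar>- \<zeta>\<bar> * (t powr (2 / \<alpha>) + (r + s)\<^sup>2) powr (- \<zeta>))"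
    using 1 2 t by (intro mult_mono) auto
  also have "\<dots> = (M powr p * M powr \<bar>- \<zeta>\<bar>) * (t * (t powr (2 / \<alpha>) + (r - s)\<^sup>2) powr (- p) * (t powr (2 / \<alpha>) + (r + s)\<^sup>2) powr (- \<zeta>))"
    by (simp only: mult_ac)
  finally show ?thesis unfolding stable_kernel_def e unfolding p_def[symmetric] .
qed

lemma stable_profile_late_le:
  fixes \<zeta> \<alpha> :: real
  assumes \<alpha>: "0 < \<alpha>" and C: "0 < C"
  shows "\<exists>k>0. \<forall>\<tau> s. C \<le> \<tau> \<and> 0 < s \<longrightarrow>
    \<tau> * (\<tau> powr (2 / \<alpha>) + s\<^sup>2) powr (- (2 * \<zeta> + 1 + \<alpha>) / 2) \<le> k * stable_kernel \<zeta> \<alpha> \<tau> (1/32) (1/32 * s)"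
proof -
  define T0 where "T0 = C powr (2 / \<alpha>)"
  have T0: "0 < T0" using C by (simp add: T0_def)
  \<comment> \<open>1024 is 32^2, undoing the contraction of s; the other term absorbs the additive
    constant 1 of the shifted square through 1 \<le> T / T0.\<close>
  define M where "M = 1024 + 2 / T0"
  have M: "1024 \<le> M" using T0 by (simp add: M_def)
  have "\<tau> * (\<tau> powr (2 / \<alpha>) + s\<^sup>2) powr (- (2 * \<zeta> + 1 + \<alpha>) / 2)
    \<le> (M powr ((1 + \<alpha>) / 2) * M powr \<bar>- \<zeta>\<bar>) * stable_kernel \<zeta> \<alpha> \<tau> (1/32) (1/32 * s)"
    if h: "C \<le> \<tau>" "0 < s" for \<tau> s
  proof -
    define T where "T = \<tau> powr (2 / \<alpha>)"
    have \<tau>: "0 < \<tau>" using h C by linarith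
    have T: "T0 \<le> T" unfolding T_def T0_def using h C \<alpha> by (intro powr_mono2) auto
    then have T1: "1 \<le> T / T0" using T0 by simp
    have sqm: "(1/32 - 1/32 * s)\<^sup>2 \<le> 1 + s\<^sup>2 / 32" by (rule shifted_square_le)
    have sqp: "(1/32 + 1/32 * s)\<^sup>2 \<le> 1 + s\<^sup>2 / 32" using shifted_square_le[of "- s"] by simp
    have up: "T + y \<le> M * (T + s\<^sup>2)" if "y \<le> 1 + s\<^sup>2 / 32" for y
    proof -
      have "M * (T + s\<^sup>2) = 1024 * T + 2 * (T / T0) + M * s\<^sup>2" by (simp add: M_def algebra_simps)
      moreover have "1024 * s\<^sup>2 \<le> M * s\<^sup>2" using M by (intro mult_right_mono) auto
      moreover have "0 \<le> s\<^sup>2" by simp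
      ultimately show ?thesis using that T1 T T0 by linarith
    qed
    have lo: "T + s\<^sup>2 \<le> M * (T + (1/32 + 1/32 * s)\<^sup>2)"
    proof -
      have "(s / 32)\<^sup>2 \<le> (1/32 + 1/32 * s)\<^sup>2" using h by (intro power_mono) auto
      then have "s\<^sup>2 \<le> 1024 * (1/32 + 1/32 * s)\<^sup>2" by (simp add: power_divide)
      then have "T + s\<^sup>2 \<le> 1024 * (T + (1/32 + 1/32 * s)\<^sup>2)" unfolding distrib_left using T T0 by linarith
      also have "\<dots> \<le> M * (T + (1/32 + 1/32 * s)\<^sup>2)" using M T T0 by (intro mult_right_mono) auto
      finally show ?thesis .
    qed
    show ?thesis
      using up[OF sqm] up[OF sqp] lo M T T0 \<tau> unfolding T_def
      by (intro stable_kernel_ge \<alpha>) (auto intro: add_pos_nonneg)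
  qed
  then show ?thesis using M by (intro exI[of _ "M powr ((1 + \<alpha>) / 2) * M powr \<bar>- \<zeta>\<bar>"]) auto
qed

lemma stable_profile_early_le:
  fixes \<zeta> \<alpha> :: real
  assumes \<zeta>: "\<zeta> > -1/2" and \<alpha>: "0 < \<alpha>" and C: "0 < C"
  shows "\<exists>k>0. \<forall>\<tau> s. 0 < \<tau> \<and> \<tau> \<le> 1 \<and> C \<le> s \<longrightarrow>
    \<tau> * (\<tau> powr (2 / \<alpha>) + s\<^sup>2) powr (- (2 * \<zeta> + 1 + \<alpha>) / 2) \<le> k * stable_kernel \<zeta> \<alpha> 1 (1/32) (1/32 * s)"
proof -
  \<comment> \<open>Again 32^2 for the contraction; here s \<ge> C absorbs additive constants, by 1
    \<le> s^2 / C^2.\<close>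
  define M where "M = 1024 + 2 / C\<^sup>2"
  have M: "1024 \<le> M" using C by (simp add: M_def)
  have "\<tau> * (\<tau> powr (2 / \<alpha>) + s\<^sup>2) powr (- (2 * \<zeta> + 1 + \<alpha>) / 2)
    \<le> (M powr ((1 + \<alpha>) / 2) * M powr \<bar>- \<zeta>\<bar>) * stable_kernel \<zeta> \<alpha> 1 (1/32) (1/32 * s)"
    if h: "0 < \<tau>" "\<tau> \<le> 1" "C \<le> s" for \<tau> s
  proof -
    have s: "0 < s" using h C by linarith
    have Cs: "1 \<le> s\<^sup>2 / C\<^sup>2" using h C by (simp add: power_mono)
    have sqm: "(1/32 - 1/32 * s)\<^sup>2 \<le> 1 + s\<^sup>2 / 32" by (rule shifted_square_le)
    have sqp: "(1/32 + 1/32 * s)\<^sup>2 \<le> 1 + s\<^sup>2 / 32" using shifted_square_le[of "- s"] by simp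
    have up: "1 + y \<le> M * s\<^sup>2" if "y \<le> 1 + s\<^sup>2 / 32" for y
    proof -
      have "M * s\<^sup>2 = 1024 * s\<^sup>2 + 2 * (s\<^sup>2 / C\<^sup>2)" by (simp add: M_def algebra_simps)
      moreover have "0 \<le> s\<^sup>2" by simp
      ultimately show ?thesis using that Cs by linarith
    qed
    have lo: "s\<^sup>2 \<le> M * (1 + (1/32 + 1/32 * s)\<^sup>2)"
    proof -
      have "(s / 32)\<^sup>2 \<le> (1/32 + 1/32 * s)\<^sup>2" using s by (intro power_mono) auto
      then have "s\<^sup>2 \<le> 1024 * (1/32 + 1/32 * s)\<^sup>2" by (simp add: power_divide)
      then have "s\<^sup>2 \<le> 1024 * (1 + (1/32 + 1/32 * s)\<^sup>2)" unfolding distrib_left by linarith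
      also have "\<dots> \<le> M * (1 + (1/32 + 1/32 * s)\<^sup>2)" using M by (intro mult_right_mono) auto
      finally show ?thesis .
    qed
    \<comment> \<open>The exponent is negative, so dropping the time term enlarges the power; with
      \<tau> \<le> 1 this leaves X = s^2, independent of \<tau>.\<close>
    have "\<tau> * (\<tau> powr (2 / \<alpha>) + s\<^sup>2) powr (- (2 * \<zeta> + 1 + \<alpha>) / 2) \<le> 1 * (s\<^sup>2) powr (- (2 * \<zeta> + 1 + \<alpha>) / 2)"
      using h s \<zeta> \<alpha> by (intro mult_mono powr_mono2') auto
    also have "\<dots> \<le> (M powr ((1 + \<alpha>) / 2) * M powr \<bar>- \<zeta>\<bar>) * stable_kernel \<zeta> \<alpha> 1 (1/32) (1/32 * s)"
      using up[OF sqm] up[OF sqp] lo M s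
      by (intro stable_kernel_ge \<alpha>) auto
    finally show ?thesis .
  qed
  then show ?thesis using M by (intro exI[of _ "M powr ((1 + \<alpha>) / 2) * M powr \<bar>- \<zeta>\<bar>"]) auto
qed

text \<open>All bases are quadratic in s once r \<le> s confines the contracted difference and sum
  to multiples of s. The base 1 + (1 - s)^2 never vanishes and grows like s^2, so a numerical
  factor, here 8, suffices.\<close>

lemma stable_kernel_1_1_le:
  fixes \<zeta> \<alpha> :: real
  assumes \<alpha>: "0 < \<alpha>"
  shows "\<exists>k>0. \<forall>r s. 0 < r \<and> r \<le> s \<longrightarrow> stable_kernel \<zeta> \<alpha> 1 1 s \<le> k * stable_kernel \<zeta> \<alpha> 1 (1/2 * r) (1/2 * s)"
proof -
  have "stable_kernel \<zeta> \<alpha> 1 1 s \<le> (8 * 8 powr ((1 + \<alpha>) / 2) * 8 powr \<bar>- \<zeta>\<bar>) * stable_kernel \<zeta> \<alpha> 1 (1/2 * r) (1/2 * s)"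
    if h: "0 < r" "r \<le> s" for r s
  proof -
    define q where "q = s\<^sup>2"
    have q: "0 \<le> q" by (simp add: q_def)
    have m: "(1 - s)\<^sup>2 = 1 - 2 * s + q" "(1 + s)\<^sup>2 = 1 + 2 * s + q"
      by (simp_all add: q_def power2_eq_square algebra_simps)
    have s1: "2 * s \<le> 1 + q" using zero_le_power2[of "1 - s"] m by linarith
    have s2: "4 * s \<le> 4 + q" using zero_le_power2[of "s - 2"] by (simp add: q_def power2_eq_square algebra_simps)
    have A: "(1/2 * r - 1/2 * s)\<^sup>2 \<le> q / 4"
    proof -
      have "(s - r)\<^sup>2 \<le> s\<^sup>2" using h by (intro power_mono) auto
      moreover have "(1/2 * r - 1/2 * s)\<^sup>2 = (s - r)\<^sup>2 / 4" by (simp add: power2_eq_square algebra_simps)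
      ultimately show ?thesis by (simp add: q_def)
    qed
    have B1: "q / 4 \<le> (1/2 * r + 1/2 * s)\<^sup>2"
    proof -
      have "(s / 2)\<^sup>2 \<le> (1/2 * r + 1/2 * s)\<^sup>2" using h by (intro power_mono) auto
      then show ?thesis by (simp add: q_def power_divide)
    qed
    have B2: "(1/2 * r + 1/2 * s)\<^sup>2 \<le> q"
      unfolding q_def using h by (intro power_mono) auto
    show ?thesis
    proof (rule stable_kernel_le[OF \<alpha>])
      show "1 powr (2 / \<alpha>) + (1/2 * r - 1/2 * s)\<^sup>2 \<le> 8 * (1 powr (2 / \<alpha>) + (1 - s)\<^sup>2)"
      proof -
        have "1 + a \<le> 8 * (1 + (1 - 2 * s + q))" if "a \<le> q / 4" for a
          using that q s1 s2 by simp
        from this[OF A] show ?thesis unfolding m powr_one_eq_one .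
      qed
      show "1 powr (2 / \<alpha>) + (1 + s)\<^sup>2 \<le> 8 * (1 powr (2 / \<alpha>) + (1/2 * r + 1/2 * s)\<^sup>2)"
      proof -
        have "1 + (1 + 2 * s + q) \<le> 8 * (1 + a)" if "q / 4 \<le> a" for a
          using that q s1 by simp
        from this[OF B1] show ?thesis unfolding m powr_one_eq_one .
      qed
      show "1 powr (2 / \<alpha>) + (1/2 * r + 1/2 * s)\<^sup>2 \<le> 8 * (1 powr (2 / \<alpha>) + (1 + s)\<^sup>2)"
      proof -
        have "1 + a \<le> 8 * (1 + (1 + 2 * s + q))" if "a \<le> q" for a
          using that q h by simp
        from this[OF B2] show ?thesis unfolding m powr_one_eq_one .
      qed
    qed (use h in auto)
  qed
  then show ?thesis by (intro exI[of _ "8 * 8 powr ((1 + \<alpha>) / 2) * 8 powr \<bar>- \<zeta>\<bar>"]) auto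
qed

section \<open>The theorem\<close>

definition kernel :: "real \<Rightarrow> real \<Rightarrow> real \<Rightarrow> real \<Rightarrow> real \<Rightarrow> real" where
  "kernel \<zeta> \<alpha> = (if \<alpha> = 2 then heat_kernel \<zeta> else stable_kernel \<zeta> \<alpha>)"

text \<open>The common size of \<open>kernel \<zeta> \<alpha> \<tau> z s\<close> for all \<open>z \<le> s / 2\<close>, with the Gaussian factor weakened.\<close>

definition profile :: "real \<Rightarrow> real \<Rightarrow> real \<Rightarrow> real \<Rightarrow> real" where
  "profile \<zeta> \<alpha> \<tau> s = (if \<alpha> = 2 then \<tau> powr (-1/2) * exp (- (1/32) * s\<^sup>2 / \<tau>) / (\<tau> + s\<^sup>2) powr \<zeta>
     else \<tau> * (\<tau> powr (2 / \<alpha>) + s\<^sup>2) powr (- (2 * \<zeta> + 1 + \<alpha>) / 2))"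

lemma kernel_2: "kernel \<zeta> 2 = heat_kernel \<zeta>"
  and kernel_less_2: "\<alpha> < 2 \<Longrightarrow> kernel \<zeta> \<alpha> = stable_kernel \<zeta> \<alpha>"
  by (simp_all add: kernel_def)

lemma profile_2: "profile \<zeta> 2 = (\<lambda>\<tau> s. \<tau> powr (-1/2) * exp (- (1/32) * s\<^sup>2 / \<tau>) / (\<tau> + s\<^sup>2) powr \<zeta>)"
  and profile_less_2: "\<alpha> < 2 \<Longrightarrow> profile \<zeta> \<alpha> = (\<lambda>\<tau> s. \<tau> * (\<tau> powr (2 / \<alpha>) + s\<^sup>2) powr (- (2 * \<zeta> + 1 + \<alpha>) / 2))"
  by (simp_all add: profile_def fun_eq_iff)

lemma kernel_nonneg: "0 < t \<Longrightarrow> 0 \<le> kernel \<zeta> \<alpha> t r s"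
  by (simp add: kernel_def heat_kernel_def stable_kernel_def)

lemma p_alpha_commute: "p_alpha \<zeta> \<alpha> t r s = p_alpha \<zeta> \<alpha> t s r"
proof -
  have "p2 \<zeta> t r s = p2 \<zeta> t s r" for t
    by (simp add: p2_def mult.commute add.commute)
  then show ?thesis by (simp add: p_alpha_def)
qed

lemma p_alpha_kernel_bounds:
  fixes \<zeta> \<alpha> :: real
  assumes \<zeta>: "\<zeta> > -1/2" and \<alpha>: "0 < \<alpha>" "\<alpha> \<le> 2"
  shows "\<exists>K>0. \<forall>t r s. 0 < t \<and> 0 < r \<and> 0 < s \<longrightarrow>
    p_alpha \<zeta> \<alpha> t r s \<le> K * kernel \<zeta> \<alpha> t r s \<and> kernel \<zeta> \<alpha> t r s \<le> K * p_alpha \<zeta> \<alpha> t r s"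
proof (cases "\<alpha> = 2")
  case True
  then show ?thesis using p2_bounds[OF \<zeta>] by (simp add: kernel_2 p_alpha_def)
next
  case False
  then have a: "\<alpha> < 2" using \<alpha> by simp
  show ?thesis unfolding kernel_less_2[OF a] by (rule p_alpha_bounds[OF \<zeta> \<alpha>(1) a])
qed

lemma p_alpha_nonneg:
  assumes \<zeta>: "\<zeta> > -1/2" and \<alpha>: "0 < \<alpha>" "\<alpha> \<le> 2" and "0 < t" "0 < r" "0 < s"
  shows "0 \<le> p_alpha \<zeta> \<alpha> t r s"
proof -
  obtain K where K: "0 < K" "kernel \<zeta> \<alpha> t r s \<le> K * p_alpha \<zeta> \<alpha> t r s"
    using p_alpha_kernel_bounds[OF \<zeta> \<alpha>] assms by blast
  have "0 \<le> K * p_alpha \<zeta> \<alpha> t r s" using K(2) kernel_nonneg[OF \<open>0 < t\<close>, of \<zeta> \<alpha> r s] by linarith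
  then show ?thesis using K(1) by (rule zero_le_mult_imp_nonneg)
qed

text \<open>The loss \<open>A\<close> is independent of the factor k and of all arguments, so it can
  be fixed before the kernel inequality and its constant are known.\<close>

lemma p_alpha_transfer:
  assumes \<zeta>: "\<zeta> > -1/2" and \<alpha>: "0 < \<alpha>" "\<alpha> \<le> 2"
  shows "\<exists>A>0. \<forall>t r s t' r' s' k. 0 < t \<and> 0 < r \<and> 0 < s \<and> 0 < t' \<and> 0 < r' \<and> 0 < s' \<and> 0 \<le> k
    \<and> kernel \<zeta> \<alpha> t r s \<le> k * kernel \<zeta> \<alpha> t' r' s' \<longrightarrow> p_alpha \<zeta> \<alpha> t r s \<le> A * k * p_alpha \<zeta> \<alpha> t' r' s'"
proof -
  obtain K where K: "0 < K" "\<And>t r s. 0 < t \<and> 0 < r \<and> 0 < s \<Longrightarrow>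
    p_alpha \<zeta> \<alpha> t r s \<le> K * kernel \<zeta> \<alpha> t r s \<and> kernel \<zeta> \<alpha> t r s \<le> K * p_alpha \<zeta> \<alpha> t r s"
    using p_alpha_kernel_bounds[OF assms] by blast
  have "p_alpha \<zeta> \<alpha> t r s \<le> (K * K) * k * p_alpha \<zeta> \<alpha> t' r' s'"
    if h: "0 < t" "0 < r" "0 < s" "0 < t'" "0 < r'" "0 < s'" "0 \<le> k" "kernel \<zeta> \<alpha> t r s \<le> k * kernel \<zeta> \<alpha> t' r' s'" for t r s t' r' s' k
  proof -
    have "p_alpha \<zeta> \<alpha> t r s \<le> K * kernel \<zeta> \<alpha> t r s" using K(2) h by blast
    also have "\<dots> \<le> K * (k * kernel \<zeta> \<alpha> t' r' s')" using K(1) h by (intro mult_left_mono) auto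
    also have "\<dots> \<le> K * (k * (K * p_alpha \<zeta> \<alpha> t' r' s'))" using K h by (intro mult_left_mono) auto
    finally show ?thesis by (simp add: mult_ac)
  qed
  then show ?thesis using K(1) by (intro exI[of _ "K * K"]) auto
qed

section \<open>Comparison of different times and scales\<close>

lemma p2_time_comparable:
  assumes \<zeta>: "\<zeta> > -1/2" and C: "0 < C" "C \<le> 1"
  shows "\<exists>c1>0. \<exists>c2>0. \<exists>K>0. \<forall>z s \<tau>. z > 0 \<and> s > 0 \<and> C \<le> \<tau> \<and> \<tau> \<le> 1 / C \<longrightarrow>
    p2 \<zeta> 1 (c1 * z) (c1 * s) \<le> K * p2 \<zeta> \<tau> z s \<and> p2 \<zeta> \<tau> z s \<le> K * p2 \<zeta> 1 (c2 * z) (c2 * s)"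
proof -
  obtain A where A: "0 < A" "\<And>t r s t' r' s' k. 0 < t \<and> 0 < r \<and> 0 < s \<and> 0 < t' \<and> 0 < r' \<and> 0 < s' \<and> 0 \<le> k
    \<and> heat_kernel \<zeta> t r s \<le> k * heat_kernel \<zeta> t' r' s' \<Longrightarrow> p2 \<zeta> t r s \<le> A * k * p2 \<zeta> t' r' s'"
    using p_alpha_transfer[OF \<zeta>, of 2] by (auto simp: kernel_2 p_alpha_def)
  obtain k where k: "0 < k" "\<And>z s \<tau>. 0 < z \<and> 0 < s \<and> C \<le> \<tau> \<and> \<tau> \<le> 1 / C \<Longrightarrow>
    heat_kernel \<zeta> 1 (sqrt (1 / C) * z) (sqrt (1 / C) * s) \<le> k * heat_kernel \<zeta> \<tau> z s
      \<and> heat_kernel \<zeta> \<tau> z s \<le> k * heat_kernel \<zeta> 1 (sqrt C * z) (sqrt C * s)"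
    using heat_kernel_time_le[OF C] by blast
  have pos: "0 < sqrt (1 / C)" "0 < sqrt C" using C by auto
  have "p2 \<zeta> 1 (sqrt (1 / C) * z) (sqrt (1 / C) * s) \<le> A * k * p2 \<zeta> \<tau> z s
      \<and> p2 \<zeta> \<tau> z s \<le> A * k * p2 \<zeta> 1 (sqrt C * z) (sqrt C * s)"
    if h: "z > 0 \<and> s > 0 \<and> C \<le> \<tau> \<and> \<tau> \<le> 1 / C" for z s \<tau>
    using k(2)[OF h] h k(1) C pos by (intro conjI A(2)) (auto intro: mult_pos_pos)
  then show ?thesis using pos A(1) k(1)
    by (intro exI[of _ "sqrt (1 / C)"] conjI exI[of _ "sqrt C"] exI[of _ "A * k"]) auto
qed

lemma p_alpha_time_le:
  assumes \<zeta>: "\<zeta> > -1/2" and \<alpha>: "0 < \<alpha>" "\<alpha> < 2" and M: "1 \<le> M"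
  shows "\<exists>K>0. \<forall>t t' r s. 0 < t \<and> 0 < t' \<and> t \<le> M * t' \<and> t' \<le> M * t \<and> 0 < r \<and> 0 < s
    \<longrightarrow> p_alpha \<zeta> \<alpha> t r s \<le> K * p_alpha \<zeta> \<alpha> t' r s"
proof -
  obtain A where A: "0 < A" "\<And>t r s t' r' s' k. 0 < t \<and> 0 < r \<and> 0 < s \<and> 0 < t' \<and> 0 < r' \<and> 0 < s' \<and> 0 \<le> k
    \<and> stable_kernel \<zeta> \<alpha> t r s \<le> k * stable_kernel \<zeta> \<alpha> t' r' s' \<Longrightarrow> p_alpha \<zeta> \<alpha> t r s \<le> A * k * p_alpha \<zeta> \<alpha> t' r' s'"
    using p_alpha_transfer[OF \<zeta> \<alpha>(1) less_imp_le[OF \<alpha>(2)]] unfolding kernel_less_2[OF \<alpha>(2)] by blast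
  obtain k where k: "0 < k" "\<And>t t' r s. 0 < t \<and> 0 < t' \<and> t \<le> M * t' \<and> t' \<le> M * t \<and> 0 < r \<and> 0 < s
    \<Longrightarrow> stable_kernel \<zeta> \<alpha> t r s \<le> k * stable_kernel \<zeta> \<alpha> t' r s"
    using stable_kernel_time_le[OF \<alpha>(1) M] by blast
  have "p_alpha \<zeta> \<alpha> t r s \<le> A * k * p_alpha \<zeta> \<alpha> t' r s"
    if "0 < t \<and> 0 < t' \<and> t \<le> M * t' \<and> t' \<le> M * t \<and> 0 < r \<and> 0 < s" for t t' r s
    using k(2)[OF that] that k(1) by (intro A(2)) auto
  then show ?thesis using A(1) k(1) by (intro exI[of _ "A * k"]) auto
qed

lemma p_alpha_scale_le:
  assumes \<zeta>: "\<zeta> > -1/2" and \<alpha>: "0 < \<alpha>" "\<alpha> < 2" and c: "0 < c"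
  shows "\<exists>K>0. \<forall>t r s. 0 < t \<and> 0 < r \<and> 0 < s
    \<longrightarrow> p_alpha \<zeta> \<alpha> t (c * r) (c * s) \<le> K * p_alpha \<zeta> \<alpha> t r s \<and> p_alpha \<zeta> \<alpha> t r s \<le> K * p_alpha \<zeta> \<alpha> t (c * r) (c * s)"
proof -
  obtain A where A: "0 < A" "\<And>t r s t' r' s' k. 0 < t \<and> 0 < r \<and> 0 < s \<and> 0 < t' \<and> 0 < r' \<and> 0 < s' \<and> 0 \<le> k
    \<and> stable_kernel \<zeta> \<alpha> t r s \<le> k * stable_kernel \<zeta> \<alpha> t' r' s' \<Longrightarrow> p_alpha \<zeta> \<alpha> t r s \<le> A * k * p_alpha \<zeta> \<alpha> t' r' s'"
    using p_alpha_transfer[OF \<zeta> \<alpha>(1) less_imp_le[OF \<alpha>(2)]] unfolding kernel_less_2[OF \<alpha>(2)] by blast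
  obtain k where k: "0 < k" "\<And>t r s. 0 < t \<and> 0 < r \<and> 0 < s \<Longrightarrow>
      stable_kernel \<zeta> \<alpha> t (c * r) (c * s) \<le> k * stable_kernel \<zeta> \<alpha> t r s
      \<and> stable_kernel \<zeta> \<alpha> t r s \<le> k * stable_kernel \<zeta> \<alpha> t (c * r) (c * s)"
    using stable_kernel_scale_le[OF \<alpha>(1) c] by blast
  have "p_alpha \<zeta> \<alpha> t (c * r) (c * s) \<le> A * k * p_alpha \<zeta> \<alpha> t r s \<and> p_alpha \<zeta> \<alpha> t r s \<le> A * k * p_alpha \<zeta> \<alpha> t (c * r) (c * s)"
    if "0 < t \<and> 0 < r \<and> 0 < s" for t r s
    using k(2)[OF that] that k(1) c by (intro conjI A(2)) auto
  then show ?thesis using A(1) k(1) by (intro exI[of _ "A * k"]) auto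
qed

lemma p_alpha_time_scale_comparable:
  assumes \<zeta>: "\<zeta> > -1/2" and \<alpha>: "0 < \<alpha>" "\<alpha> < 2" and c: "0 < c"
  shows "\<exists>K>0. \<forall>\<tau> z s. \<tau> > 0 \<and> z > 0 \<and> s > 0 \<longrightarrow>
    p_alpha \<zeta> \<alpha> \<tau> (c * z) (c * s) \<le> K * p_alpha \<zeta> \<alpha> \<tau> z s \<and>
    p_alpha \<zeta> \<alpha> \<tau> z s \<le> K * p_alpha \<zeta> \<alpha> \<tau> (c * z) (c * s) \<and>
    p_alpha \<zeta> \<alpha> (c * \<tau>) z s \<le> K * p_alpha \<zeta> \<alpha> \<tau> z s \<and>
    p_alpha \<zeta> \<alpha> \<tau> z s \<le> K * p_alpha \<zeta> \<alpha> (c * \<tau>) z s"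
proof -
  obtain K1 where K1: "0 < K1" "\<And>t r s. 0 < t \<and> 0 < r \<and> 0 < s
    \<Longrightarrow> p_alpha \<zeta> \<alpha> t (c * r) (c * s) \<le> K1 * p_alpha \<zeta> \<alpha> t r s \<and> p_alpha \<zeta> \<alpha> t r s \<le> K1 * p_alpha \<zeta> \<alpha> t (c * r) (c * s)"
    using p_alpha_scale_le[OF \<zeta> \<alpha> c] by blast
  \<comment> \<open>Large enough that c \<tau> and \<tau> are each at most M times the other, for c
    below as well as above 1.\<close>
  define M where "M = 1 + c + 1 / c"
  have M: "1 \<le> M" "c \<le> M" "1 \<le> M * c" using c by (auto simp: M_def field_simps)
  obtain K2 where K2: "0 < K2" "\<And>t t' r s. 0 < t \<and> 0 < t' \<and> t \<le> M * t' \<and> t' \<le> M * t \<and> 0 < r \<and> 0 < s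
    \<Longrightarrow> p_alpha \<zeta> \<alpha> t r s \<le> K2 * p_alpha \<zeta> \<alpha> t' r s"
    using p_alpha_time_le[OF \<zeta> \<alpha> M(1)] by blast
  have nn: "0 \<le> p_alpha \<zeta> \<alpha> t r s" if "0 < t" "0 < r" "0 < s" for t r s
    using p_alpha_nonneg[OF \<zeta>] \<alpha> that by simp
  have grow: "x \<le> (K1 + K2) * y" if "x \<le> K1 * y \<or> x \<le> K2 * y" "0 \<le> y" for x y
  proof -
    have "0 \<le> K1 * y" "0 \<le> K2 * y" using K1(1) K2(1) that by auto
    moreover have "(K1 + K2) * y = K1 * y + K2 * y" by (rule distrib_right)
    ultimately show ?thesis using that(1) by linarith
  qed
  have "p_alpha \<zeta> \<alpha> \<tau> (c * z) (c * s) \<le> (K1 + K2) * p_alpha \<zeta> \<alpha> \<tau> z s \<and>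
    p_alpha \<zeta> \<alpha> \<tau> z s \<le> (K1 + K2) * p_alpha \<zeta> \<alpha> \<tau> (c * z) (c * s) \<and>
    p_alpha \<zeta> \<alpha> (c * \<tau>) z s \<le> (K1 + K2) * p_alpha \<zeta> \<alpha> \<tau> z s \<and>
    p_alpha \<zeta> \<alpha> \<tau> z s \<le> (K1 + K2) * p_alpha \<zeta> \<alpha> (c * \<tau>) z s"
    if h: "\<tau> > 0" "z > 0" "s > 0" for \<tau> z s
  proof -
    have ct: "0 < c * \<tau>" "0 < c * z" "0 < c * s" using c h by auto
    have m: "c * \<tau> \<le> M * \<tau>" "\<tau> \<le> M * (c * \<tau>)"
      using mult_right_mono[OF M(2), of \<tau>] mult_right_mono[OF M(3), of \<tau>] h by (auto simp: mult.assoc)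
    show ?thesis
      using K1(2)[of \<tau> z s] K2(2)[of "c * \<tau>" \<tau> z s] K2(2)[of \<tau> "c * \<tau>" z s] h ct m
      by (intro conjI grow nn) auto
  qed
  then show ?thesis using K1(1) K2(1) by (intro exI[of _ "K1 + K2"]) auto
qed

section \<open>The regime z \<le> s / 2\<close>

lemma kernel_far_le:
  fixes \<zeta> \<alpha> :: real
  assumes \<alpha>: "0 < \<alpha>" "\<alpha> \<le> 2"
  shows "\<exists>k>0. \<forall>\<tau> z s. 0 < \<tau> \<and> 0 < z \<and> z \<le> s / 2 \<longrightarrow> kernel \<zeta> \<alpha> \<tau> z s \<le> k * profile \<zeta> \<alpha> \<tau> s"
proof (cases "\<alpha> = 2")
  case True
  show ?thesis unfolding True kernel_2 profile_2 by (rule heat_kernel_far_le)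
next
  case False
  then have a: "\<alpha> < 2" using \<alpha> by simp
  show ?thesis unfolding kernel_less_2[OF a] profile_less_2[OF a] by (rule stable_kernel_far_le[OF \<alpha>(1)])
qed

lemma profile_late_le:
  fixes \<zeta> \<alpha> C :: real
  assumes \<alpha>: "0 < \<alpha>" "\<alpha> \<le> 2" and C: "0 < C"
  shows "\<exists>k>0. \<forall>\<tau> s. C \<le> \<tau> \<and> 0 < s \<longrightarrow> profile \<zeta> \<alpha> \<tau> s \<le> k * kernel \<zeta> \<alpha> \<tau> (1/32) (1/32 * s)"
proof (cases "\<alpha> = 2")
  case True
  show ?thesis unfolding True kernel_2 profile_2 by (rule heat_kernel_late_le[OF C])
next
  case False
  then have a: "\<alpha> < 2" using \<alpha> by simp
  show ?thesis unfolding kernel_less_2[OF a] profile_less_2[OF a] by (rule stable_profile_late_le[OF \<alpha>(1) C])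
qed

lemma profile_early_le:
  fixes \<zeta> \<alpha> C :: real
  assumes \<zeta>: "\<zeta> > -1/2" and \<alpha>: "0 < \<alpha>" "\<alpha> \<le> 2" and C: "0 < C"
  shows "\<exists>k>0. \<forall>\<tau> s. 0 < \<tau> \<and> \<tau> \<le> 1 \<and> C \<le> s \<longrightarrow> profile \<zeta> \<alpha> \<tau> s \<le> k * kernel \<zeta> \<alpha> 1 (1/32) (1/32 * s)"
proof (cases "\<alpha> = 2")
  case True
  show ?thesis unfolding True kernel_2 profile_2 by (rule gaussian_le_heat_kernel_1[OF C])
next
  case False
  then have a: "\<alpha> < 2" using \<alpha> by simp
  show ?thesis unfolding kernel_less_2[OF a] profile_less_2[OF a] by (rule stable_profile_early_le[OF \<zeta> \<alpha>(1) C])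
qed

lemma kernel_1_1_le:
  fixes \<zeta> \<alpha> :: real
  assumes \<alpha>: "0 < \<alpha>" "\<alpha> \<le> 2"
  shows "\<exists>k>0. \<forall>r s. 0 < r \<and> r \<le> s \<longrightarrow> kernel \<zeta> \<alpha> 1 1 s \<le> k * kernel \<zeta> \<alpha> 1 (1/2 * r) (1/2 * s)"
proof (cases "\<alpha> = 2")
  case True
  show ?thesis unfolding True kernel_2 profile_2 by (rule heat_kernel_1_1_le)
next
  case False
  then have a: "\<alpha> < 2" using \<alpha> by simp
  show ?thesis unfolding kernel_less_2[OF a] profile_less_2[OF a] by (rule stable_kernel_1_1_le[OF \<alpha>(1)])
qed

lemma profile_le_powr:
  fixes \<zeta> \<alpha> :: real
  assumes \<zeta>: "\<zeta> > -1/2" and \<alpha>: "0 < \<alpha>" "\<alpha> \<le> 2"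
  shows "\<exists>k>0. \<forall>\<tau> s. 0 < \<tau> \<and> 0 < s \<longrightarrow> profile \<zeta> \<alpha> \<tau> s \<le> k * s powr (- (2 * \<zeta> + 1))"
proof (cases "\<alpha> = 2")
  case True
  show ?thesis unfolding True profile_2 by (rule gaussian_le_powr[OF \<zeta>])
next
  case False
  then have a: "\<alpha> < 2" using \<alpha> by simp
  show ?thesis unfolding profile_less_2[OF a]
    using stable_profile_le(2)[OF \<zeta> \<alpha>(1)] by (intro exI[of _ 1]) auto
qed

lemma p_alpha_far_le:
  fixes \<zeta> \<alpha> :: real
  assumes \<zeta>: "\<zeta> > -1/2" and \<alpha>: "0 < \<alpha>" "\<alpha> \<le> 2"
  shows "\<exists>K>0. \<forall>\<tau> z s. \<tau> > 0 \<and> 0 < z \<and> z \<le> s / 2 \<longrightarrow> p_alpha \<zeta> \<alpha> \<tau> z s \<le> K * profile \<zeta> \<alpha> \<tau> s"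
proof -
  obtain K where K: "0 < K" "\<And>t r s. 0 < t \<and> 0 < r \<and> 0 < s \<Longrightarrow> p_alpha \<zeta> \<alpha> t r s \<le> K * kernel \<zeta> \<alpha> t r s"
    using p_alpha_kernel_bounds[OF assms] by blast
  obtain k where k: "0 < k" "\<And>\<tau> z s. \<tau> > 0 \<and> 0 < z \<and> z \<le> s / 2 \<Longrightarrow> kernel \<zeta> \<alpha> \<tau> z s \<le> k * profile \<zeta> \<alpha> \<tau> s"
    using kernel_far_le[OF \<alpha>, of \<zeta>] by blast
  have "p_alpha \<zeta> \<alpha> \<tau> z s \<le> (K * k) * profile \<zeta> \<alpha> \<tau> s" if h: "\<tau> > 0 \<and> 0 < z \<and> z \<le> s / 2" for \<tau> z s
  proof -
    have "0 < s" using h by linarith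
    then have "p_alpha \<zeta> \<alpha> \<tau> z s \<le> K * kernel \<zeta> \<alpha> \<tau> z s" using K(2) h by blast
    also have "\<dots> \<le> K * (k * profile \<zeta> \<alpha> \<tau> s)"
      using k(2)[OF h] K(1) by (intro mult_left_mono) auto
    finally show ?thesis by (simp only: mult.assoc)
  qed
  then show ?thesis using K(1) k(1) by (intro exI[of _ "K * k"]) auto
qed

text \<open>The profile serves as an intermediate quantity: it no longer contains z, so one
  inequality between a profile and a kernel at contracted points covers all z \<le> s / 2.\<close>

lemma p_alpha_far_transfer:
  assumes \<zeta>: "\<zeta> > -1/2" and \<alpha>: "0 < \<alpha>" "\<alpha> \<le> 2"
  shows "\<exists>A>0. \<forall>\<tau> z s t r' s' k. 0 < \<tau> \<and> 0 < z \<and> z \<le> s / 2 \<and> 0 < t \<and> 0 < r' \<and> 0 < s' \<and> 0 \<le> k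
    \<and> profile \<zeta> \<alpha> \<tau> s \<le> k * kernel \<zeta> \<alpha> t r' s' \<longrightarrow> p_alpha \<zeta> \<alpha> \<tau> z s \<le> A * k * p_alpha \<zeta> \<alpha> t r' s'"
proof -
  obtain A where A: "0 < A" "\<And>t r s t' r' s' k. 0 < t \<and> 0 < r \<and> 0 < s \<and> 0 < t' \<and> 0 < r' \<and> 0 < s' \<and> 0 \<le> k
    \<and> kernel \<zeta> \<alpha> t r s \<le> k * kernel \<zeta> \<alpha> t' r' s' \<Longrightarrow> p_alpha \<zeta> \<alpha> t r s \<le> A * k * p_alpha \<zeta> \<alpha> t' r' s'"
    using p_alpha_transfer[OF \<zeta> \<alpha>] by blast
  obtain k0 where k0: "0 < k0" "\<And>\<tau> z s. \<tau> > 0 \<and> 0 < z \<and> z \<le> s / 2 \<Longrightarrow> kernel \<zeta> \<alpha> \<tau> z s \<le> k0 * profile \<zeta> \<alpha> \<tau> s"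
    using kernel_far_le[OF \<alpha>, of \<zeta>] by blast
  have "p_alpha \<zeta> \<alpha> \<tau> z s \<le> (A * k0) * k * p_alpha \<zeta> \<alpha> t r' s'"
    if h: "0 < \<tau>" "0 < z" "z \<le> s / 2" "0 < t" "0 < r'" "0 < s'" "0 \<le> k"
      and le: "profile \<zeta> \<alpha> \<tau> s \<le> k * kernel \<zeta> \<alpha> t r' s'" for \<tau> z s t r' s' k
  proof -
    have s: "0 < s" using h by linarith
    have "kernel \<zeta> \<alpha> \<tau> z s \<le> k0 * profile \<zeta> \<alpha> \<tau> s" using k0(2) h by blast
    also have "\<dots> \<le> k0 * (k * kernel \<zeta> \<alpha> t r' s')" using le k0(1) by (intro mult_left_mono) auto
    finally have "kernel \<zeta> \<alpha> \<tau> z s \<le> (k0 * k) * kernel \<zeta> \<alpha> t r' s'" by (simp only: mult.assoc)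
    then have "p_alpha \<zeta> \<alpha> \<tau> z s \<le> A * (k0 * k) * p_alpha \<zeta> \<alpha> t r' s'"
      using h s k0(1) by (intro A(2)) auto
    then show ?thesis by (simp only: mult.assoc)
  qed
  then show ?thesis using A(1) k0(1) by (intro exI[of _ "A * k0"]) auto
qed

lemma p_alpha_far_late_le:
  fixes \<zeta> \<alpha> C :: real
  assumes \<zeta>: "\<zeta> > -1/2" and \<alpha>: "0 < \<alpha>" "\<alpha> \<le> 2" and C: "0 < C"
  shows "\<exists>K>0. \<forall>\<tau> z s. \<tau> > 0 \<and> 0 < z \<and> z \<le> s / 2 \<and> C \<le> \<tau> \<longrightarrow> p_alpha \<zeta> \<alpha> \<tau> z s \<le> K * p_alpha \<zeta> \<alpha> \<tau> (1/32) (1/32 * s)"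
proof -
  obtain A where A: "0 < A" "\<And>\<tau> z s t r' s' k. 0 < \<tau> \<and> 0 < z \<and> z \<le> s / 2 \<and> 0 < t \<and> 0 < r' \<and> 0 < s' \<and> 0 \<le> k
    \<and> profile \<zeta> \<alpha> \<tau> s \<le> k * kernel \<zeta> \<alpha> t r' s' \<Longrightarrow> p_alpha \<zeta> \<alpha> \<tau> z s \<le> A * k * p_alpha \<zeta> \<alpha> t r' s'"
    using p_alpha_far_transfer[OF \<zeta> \<alpha>] by blast
  obtain k where k: "0 < k" "\<And>\<tau> s. C \<le> \<tau> \<and> 0 < s \<Longrightarrow> profile \<zeta> \<alpha> \<tau> s \<le> k * kernel \<zeta> \<alpha> \<tau> (1/32) (1/32 * s)"
    using profile_late_le[OF \<alpha> C, of \<zeta>] by blast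
  have "p_alpha \<zeta> \<alpha> \<tau> z s \<le> A * k * p_alpha \<zeta> \<alpha> \<tau> (1/32) (1/32 * s)" if "\<tau> > 0 \<and> 0 < z \<and> z \<le> s / 2 \<and> C \<le> \<tau>" for \<tau> z s
    using k(2)[of \<tau> s] k(1) that by (intro A(2)) auto
  then show ?thesis using A(1) k(1) by (intro exI[of _ "A * k"]) auto
qed

lemma p_alpha_far_early_le:
  fixes \<zeta> \<alpha> C :: real
  assumes \<zeta>: "\<zeta> > -1/2" and \<alpha>: "0 < \<alpha>" "\<alpha> \<le> 2" and C: "0 < C"
  shows "\<exists>K>0. \<forall>\<tau> z s. 0 < \<tau> \<and> \<tau> \<le> 1 \<and> 0 < z \<and> z \<le> s / 2 \<and> s \<ge> C \<longrightarrow>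
    p_alpha \<zeta> \<alpha> \<tau> z s \<le> K * p_alpha \<zeta> \<alpha> 1 (1/32) (1/32 * s)"
proof -
  obtain A where A: "0 < A" "\<And>\<tau> z s t r' s' k. 0 < \<tau> \<and> 0 < z \<and> z \<le> s / 2 \<and> 0 < t \<and> 0 < r' \<and> 0 < s' \<and> 0 \<le> k
    \<and> profile \<zeta> \<alpha> \<tau> s \<le> k * kernel \<zeta> \<alpha> t r' s' \<Longrightarrow> p_alpha \<zeta> \<alpha> \<tau> z s \<le> A * k * p_alpha \<zeta> \<alpha> t r' s'"
    using p_alpha_far_transfer[OF \<zeta> \<alpha>] by blast
  obtain k where k: "0 < k" "\<And>\<tau> s. 0 < \<tau> \<and> \<tau> \<le> 1 \<and> C \<le> s \<Longrightarrow> profile \<zeta> \<alpha> \<tau> s \<le> k * kernel \<zeta> \<alpha> 1 (1/32) (1/32 * s)"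
    using profile_early_le[OF \<zeta> \<alpha> C] by blast
  have "p_alpha \<zeta> \<alpha> \<tau> z s \<le> A * k * p_alpha \<zeta> \<alpha> 1 (1/32) (1/32 * s)"
    if "0 < \<tau> \<and> \<tau> \<le> 1 \<and> 0 < z \<and> z \<le> s / 2 \<and> s \<ge> C" for \<tau> z s
    using k(2)[of \<tau> s] k(1) that by (intro A(2)) auto
  then show ?thesis using A(1) k(1) by (intro exI[of _ "A * k"]) auto
qed

lemma p_alpha_far_le_powr:
  fixes \<zeta> \<alpha> :: real
  assumes \<zeta>: "\<zeta> > -1/2" and \<alpha>: "0 < \<alpha>" "\<alpha> \<le> 2"
  shows "\<exists>K>0. \<forall>\<tau> z s. \<tau> > 0 \<and> 0 < z \<and> z \<le> s / 2 \<longrightarrow> p_alpha \<zeta> \<alpha> \<tau> z s \<le> K * s powr (- (2 * \<zeta> + 1))"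
proof -
  obtain K where K: "0 < K" "\<And>\<tau> z s. \<tau> > 0 \<and> 0 < z \<and> z \<le> s / 2 \<Longrightarrow> p_alpha \<zeta> \<alpha> \<tau> z s \<le> K * profile \<zeta> \<alpha> \<tau> s"
    using p_alpha_far_le[OF assms] by blast
  obtain k where k: "0 < k" "\<And>\<tau> s. 0 < \<tau> \<and> 0 < s \<Longrightarrow> profile \<zeta> \<alpha> \<tau> s \<le> k * s powr (- (2 * \<zeta> + 1))"
    using profile_le_powr[OF assms] by blast
  have "p_alpha \<zeta> \<alpha> \<tau> z s \<le> (K * k) * s powr (- (2 * \<zeta> + 1))" if h: "\<tau> > 0 \<and> 0 < z \<and> z \<le> s / 2" for \<tau> z s
  proof -
    have "0 < s" using h by linarith
    then have "K * profile \<zeta> \<alpha> \<tau> s \<le> K * (k * s powr (- (2 * \<zeta> + 1)))"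
      using k(2) K(1) h by (intro mult_left_mono) auto
    then show ?thesis using K(2)[OF h] by (simp only: mult.assoc)
  qed
  then show ?thesis using K(1) k(1) by (intro exI[of _ "K * k"]) auto
qed

lemma p_alpha_far_le_profile:
  fixes \<zeta> \<alpha> :: real
  assumes \<zeta>: "\<zeta> > -1/2" and \<alpha>: "0 < \<alpha>" "\<alpha> \<le> 2"
  shows "\<exists>K>0. \<forall>\<tau> z s. \<tau> > 0 \<and> 0 < z \<and> z \<le> s / 2 \<longrightarrow>
    p_alpha \<zeta> \<alpha> \<tau> z s \<le> K * ((\<tau> powr (-1/2) * exp (- (1/32) * s\<^sup>2 / \<tau>) / (\<tau> + s\<^sup>2) powr \<zeta>) * ind (\<alpha> = 2)
      + \<tau> / (s powr (2 * \<zeta> + 1 + \<alpha>) + \<tau> powr ((2 * \<zeta> + 1 + \<alpha>) / \<alpha>)) * ind (0 < \<alpha> \<and> \<alpha> < 2))"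
proof (cases "\<alpha> = 2")
  case True
  then show ?thesis using p_alpha_far_le[OF assms] by (simp add: profile_2 ind_def)
next
  case False
  then have a: "\<alpha> < 2" using \<alpha> by simp
  obtain K where K: "0 < K" "\<And>\<tau> z s. \<tau> > 0 \<and> 0 < z \<and> z \<le> s / 2 \<Longrightarrow> p_alpha \<zeta> \<alpha> \<tau> z s \<le> K * profile \<zeta> \<alpha> \<tau> s"
    using p_alpha_far_le[OF assms] by blast
  have "p_alpha \<zeta> \<alpha> \<tau> z s \<le> (K * 2) * (\<tau> / (s powr (2 * \<zeta> + 1 + \<alpha>) + \<tau> powr ((2 * \<zeta> + 1 + \<alpha>) / \<alpha>)))" if h: "\<tau> > 0 \<and> 0 < z \<and> z \<le> s / 2" for \<tau> z s
  proof -
    have "0 < s" using h by linarith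
    then have "profile \<zeta> \<alpha> \<tau> s \<le> 2 * (\<tau> / (s powr (2 * \<zeta> + 1 + \<alpha>) + \<tau> powr ((2 * \<zeta> + 1 + \<alpha>) / \<alpha>)))"
      unfolding profile_less_2[OF a] using h by (intro stable_profile_le(1) \<zeta> \<alpha>(1)) auto
    then have "K * profile \<zeta> \<alpha> \<tau> s \<le> K * (2 * (\<tau> / (s powr (2 * \<zeta> + 1 + \<alpha>) + \<tau> powr ((2 * \<zeta> + 1 + \<alpha>) / \<alpha>))))"
      using K(1) by (intro mult_left_mono) auto
    also have "\<dots> = (K * 2) * (\<tau> / (s powr (2 * \<zeta> + 1 + \<alpha>) + \<tau> powr ((2 * \<zeta> + 1 + \<alpha>) / \<alpha>)))" by (rule mult.assoc[symmetric])
    finally show ?thesis using K(2)[OF h] by linarith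
  qed
  moreover have "ind (\<alpha> = 2) = 0" "ind (0 < \<alpha> \<and> \<alpha> < 2) = 1" using False a \<alpha> by (simp_all add: ind_def)
  ultimately show ?thesis
    using K(1) by (intro exI[of _ "K * 2"]) (simp only: mult_zero_right add_0_left mult_1_right, simp)
qed

text \<open>A split at \<tau> = C. The boundary time is counted as late, so exactly one indicator is
  active for each \<tau>; the comparison with the contracted points does hold from \<tau> = C
  on.\<close>

lemma p_alpha_far_late_or_profile_le:
  fixes \<zeta> \<alpha> C :: real
  assumes \<zeta>: "\<zeta> > -1/2" and \<alpha>: "0 < \<alpha>" "\<alpha> \<le> 2" and C: "0 < C"
  shows "\<exists>K>0. \<forall>\<tau> z s. \<tau> > 0 \<and> 0 < z \<and> z \<le> s / 2 \<longrightarrow>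
    p_alpha \<zeta> \<alpha> \<tau> z s \<le> K * (p_alpha \<zeta> \<alpha> \<tau> (1/32) (1/32 * s) * ind (\<tau> \<ge> C)
      + ((\<tau> powr (-1/2) * exp (- (1/32) * s\<^sup>2 / \<tau>) / (\<tau> + s\<^sup>2) powr \<zeta>) * ind (\<alpha> = 2)
      + \<tau> / (s powr (2 * \<zeta> + 1 + \<alpha>) + \<tau> powr ((2 * \<zeta> + 1 + \<alpha>) / \<alpha>)) * ind (0 < \<alpha> \<and> \<alpha> < 2)) * ind (\<tau> < C))"
proof -
  define f where "f \<tau> s = ((\<tau> powr (-1/2) * exp (- (1/32) * s\<^sup>2 / \<tau>) / (\<tau> + s\<^sup>2) powr \<zeta>) * ind (\<alpha> = 2)
      + \<tau> / (s powr (2 * \<zeta> + 1 + \<alpha>) + \<tau> powr ((2 * \<zeta> + 1 + \<alpha>) / \<alpha>)) * ind (0 < \<alpha> \<and> \<alpha> < 2))" for \<tau> s :: real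
  obtain K1 where K1: "0 < K1" "\<And>\<tau> z s. \<tau> > 0 \<and> 0 < z \<and> z \<le> s / 2 \<Longrightarrow> p_alpha \<zeta> \<alpha> \<tau> z s \<le> K1 * f \<tau> s"
    using p_alpha_far_le_profile[OF \<zeta> \<alpha>] unfolding f_def by blast
  obtain K2 where K2: "0 < K2" "\<And>\<tau> z s. \<tau> > 0 \<and> 0 < z \<and> z \<le> s / 2 \<and> C \<le> \<tau> \<Longrightarrow>
    p_alpha \<zeta> \<alpha> \<tau> z s \<le> K2 * p_alpha \<zeta> \<alpha> \<tau> (1/32) (1/32 * s)"
    using p_alpha_far_late_le[OF \<zeta> \<alpha> C] by blast
  have f0: "0 \<le> f \<tau> s" if "0 < \<tau>" for \<tau> s using that by (simp add: f_def ind_def)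
  have "p_alpha \<zeta> \<alpha> \<tau> z s \<le> (K1 + K2) * (p_alpha \<zeta> \<alpha> \<tau> (1/32) (1/32 * s) * ind (\<tau> \<ge> C) + f \<tau> s * ind (\<tau> < C))"
    if h: "\<tau> > 0 \<and> 0 < z \<and> z \<le> s / 2" for \<tau> z s
  proof (cases "C \<le> \<tau>")
    case True
    have "0 < s" using h by linarith
    then have "0 \<le> p_alpha \<zeta> \<alpha> \<tau> (1/32) (1/32 * s)" using h by (intro p_alpha_nonneg \<zeta> \<alpha>) auto
    then have "K2 * p_alpha \<zeta> \<alpha> \<tau> (1/32) (1/32 * s) \<le> (K1 + K2) * p_alpha \<zeta> \<alpha> \<tau> (1/32) (1/32 * s)"
      using K1(1) by (intro mult_right_mono) auto
    then show ?thesis using K2(2)[of \<tau> z s] h True by (simp add: ind_def)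
  next
    case False
    have "K1 * f \<tau> s \<le> (K1 + K2) * f \<tau> s" using K2(1) f0 h by (intro mult_right_mono) auto
    then show ?thesis using K1(2)[OF h] False by (simp add: ind_def)
  qed
  then show ?thesis using K1(1) K2(1) unfolding f_def by (intro exI[of _ "K1 + K2"]) auto
qed

section \<open>The kernel at unit time and separated points\<close>

lemma p_alpha_1_1_le:
  fixes \<zeta> \<alpha> :: real
  assumes \<zeta>: "\<zeta> > -1/2" and \<alpha>: "0 < \<alpha>" "\<alpha> \<le> 2"
  shows "\<exists>K>0. \<forall>r s. 0 < r \<and> r \<le> s \<longrightarrow> p_alpha \<zeta> \<alpha> 1 1 s \<le> K * p_alpha \<zeta> \<alpha> 1 (1/2 * r) (1/2 * s)"
proof -
  obtain A where A: "0 < A" "\<And>t r s t' r' s' k. 0 < t \<and> 0 < r \<and> 0 < s \<and> 0 < t' \<and> 0 < r' \<and> 0 < s' \<and> 0 \<le> k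
    \<and> kernel \<zeta> \<alpha> t r s \<le> k * kernel \<zeta> \<alpha> t' r' s' \<Longrightarrow> p_alpha \<zeta> \<alpha> t r s \<le> A * k * p_alpha \<zeta> \<alpha> t' r' s'"
    using p_alpha_transfer[OF \<zeta> \<alpha>] by blast
  obtain k where k: "0 < k" "\<And>r s. 0 < r \<and> r \<le> s \<Longrightarrow> kernel \<zeta> \<alpha> 1 1 s \<le> k * kernel \<zeta> \<alpha> 1 (1/2 * r) (1/2 * s)"
    using kernel_1_1_le[OF \<alpha>, of \<zeta>] by blast
  have "p_alpha \<zeta> \<alpha> 1 1 s \<le> A * k * p_alpha \<zeta> \<alpha> 1 (1/2 * r) (1/2 * s)" if "0 < r \<and> r \<le> s" for r s
    using k(2)[OF that] k(1) that by (intro A(2)) auto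
  then show ?thesis using A(1) k(1) by (intro exI[of _ "A * k"]) auto
qed

text \<open>The minimum is bounded by the value at the larger of the two points; if that is r, the
  kernel on the right is turned round by symmetry.\<close>

lemma p_alpha_min_le:
  fixes \<zeta> \<alpha> :: real
  assumes \<zeta>: "\<zeta> > -1/2" and \<alpha>: "0 < \<alpha>" "\<alpha> \<le> 2"
  shows "\<exists>K>0. \<forall>r s. 0 < r \<and> 0 < s \<longrightarrow>
    min (p_alpha \<zeta> \<alpha> 1 1 r) (p_alpha \<zeta> \<alpha> 1 1 s) \<le> K * p_alpha \<zeta> \<alpha> 1 (1/2 * r) (1/2 * s)"
proof -
  obtain K where K: "0 < K" "\<And>r s. 0 < r \<and> r \<le> s \<Longrightarrow> p_alpha \<zeta> \<alpha> 1 1 s \<le> K * p_alpha \<zeta> \<alpha> 1 (1/2 * r) (1/2 * s)"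
    using p_alpha_1_1_le[OF assms] by blast
  have "min (p_alpha \<zeta> \<alpha> 1 1 r) (p_alpha \<zeta> \<alpha> 1 1 s) \<le> K * p_alpha \<zeta> \<alpha> 1 (1/2 * r) (1/2 * s)"
    if h: "0 < r" "0 < s" for r s
  proof (cases "r \<le> s")
    case True
    then show ?thesis using K(2)[of r s] h by (auto intro: min.coboundedI2)
  next
    case False
    then have "p_alpha \<zeta> \<alpha> 1 1 r \<le> K * p_alpha \<zeta> \<alpha> 1 (1/2 * s) (1/2 * r)" using K(2)[of s r] h by auto
    also have "p_alpha \<zeta> \<alpha> 1 (1/2 * s) (1/2 * r) = p_alpha \<zeta> \<alpha> 1 (1/2 * r) (1/2 * s)" by (rule p_alpha_commute)
    finally show ?thesis by (rule min.coboundedI1)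
  qed
  then show ?thesis using K(1) by blast
qed

text \<open>Proved for the heat kernel at every time with one constant and then averaged over the
  subordinator, so both ranges of \<alpha> are covered by the same Gaussian estimate.\<close>

lemma p_alpha_separated_le:
  fixes \<zeta> \<alpha> :: real
  assumes \<zeta>: "\<zeta> > -1/2" and \<alpha>: "0 < \<alpha>" "\<alpha> \<le> 2"
  shows "\<exists>K>0. \<forall>r s z t. 0 < r \<and> 0 < s \<and> 0 < z \<and> 0 < t \<and> \<bar>z - s\<bar> > \<bar>r - s\<bar> / 2 \<longrightarrow>
    p_alpha \<zeta> \<alpha> t z s \<le> K * p_alpha \<zeta> \<alpha> t (1/4 * r) (1/4 * s)"
proof -
  obtain A where A: "0 < A" "\<And>t r s t' r' s' k. 0 < t \<and> 0 < r \<and> 0 < s \<and> 0 < t' \<and> 0 < r' \<and> 0 < s' \<and> 0 \<le> k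
    \<and> heat_kernel \<zeta> t r s \<le> k * heat_kernel \<zeta> t' r' s' \<Longrightarrow> p2 \<zeta> t r s \<le> A * k * p2 \<zeta> t' r' s'"
    using p_alpha_transfer[OF \<zeta>, of 2] by (auto simp: kernel_2 p_alpha_def)
  obtain k where k: "0 < k" "\<And>r s z t. 0 < r \<and> 0 < s \<and> 0 < z \<and> 0 < t \<and> \<bar>z - s\<bar> > \<bar>r - s\<bar> / 2 \<Longrightarrow>
    heat_kernel \<zeta> t z s \<le> k * heat_kernel \<zeta> t (1/4 * r) (1/4 * s)"
    using heat_kernel_separated_le[of \<zeta>] by blast
  have "p_alpha \<zeta> \<alpha> t z s \<le> A * k * p_alpha \<zeta> \<alpha> t (1/4 * r) (1/4 * s)"
    if h: "0 < r" "0 < s" "0 < z" "0 < t" "\<bar>z - s\<bar> > \<bar>r - s\<bar> / 2" for r s z t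
  proof (rule p_alpha_mono_of_p2[OF \<zeta> \<alpha> h(4)])
    show "p2 \<zeta> \<tau> z s \<le> A * k * p2 \<zeta> \<tau> (1/4 * r) (1/4 * s)" if "0 < \<tau>" for \<tau>
      using k(2)[of r s z \<tau>] k(1) h that by (intro A(2)) auto
  qed (use h in auto)
  then show ?thesis using A(1) k(1) by (intro exI[of _ "A * k"]) auto
qed

theorem theorem4p1:
  fixes \<zeta> :: real
  assumes hz: "\<zeta> > -1/2"
  shows
  \<comment> \<open>Part 1\<close>
  "(\<forall>C::real. 0 < C \<and> C \<le> 1 \<longrightarrow>
      (\<exists>c1>0. \<exists>c2>0. \<exists>K>0. \<forall>z s \<tau>. z > 0 \<and> s > 0 \<and> C \<le> \<tau> \<and> \<tau> \<le> 1 / C \<longrightarrow>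
          p2 \<zeta> 1 (c1 * z) (c1 * s) \<le> K * p2 \<zeta> \<tau> z s \<and>
          p2 \<zeta> \<tau> z s \<le> K * p2 \<zeta> 1 (c2 * z) (c2 * s)) \<and>
      (\<forall>\<alpha>::real. 0 < \<alpha> \<and> \<alpha> < 2 \<longrightarrow>
         (\<exists>K>0. \<forall>z s \<tau>. z > 0 \<and> s > 0 \<and> C \<le> \<tau> \<and> \<tau> \<le> 1 / C \<longrightarrow>
            p_alpha \<zeta> \<alpha> \<tau> z s \<le> K * p_alpha \<zeta> \<alpha> 1 z s \<and>
            p_alpha \<zeta> \<alpha> 1 z s \<le> K * p_alpha \<zeta> \<alpha> \<tau> z s))) \<and>
   (\<forall>\<alpha>::real. 0 < \<alpha> \<and> \<alpha> < 2 \<longrightarrow> (\<forall>c::real. c > 0 \<longrightarrow>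
      (\<exists>K>0. \<forall>\<tau> z s. \<tau> > 0 \<and> z > 0 \<and> s > 0 \<longrightarrow>
         p_alpha \<zeta> \<alpha> \<tau> (c * z) (c * s) \<le> K * p_alpha \<zeta> \<alpha> \<tau> z s \<and>
         p_alpha \<zeta> \<alpha> \<tau> z s \<le> K * p_alpha \<zeta> \<alpha> \<tau> (c * z) (c * s) \<and>
         p_alpha \<zeta> \<alpha> (c * \<tau>) z s \<le> K * p_alpha \<zeta> \<alpha> \<tau> z s \<and>
         p_alpha \<zeta> \<alpha> \<tau> z s \<le> K * p_alpha \<zeta> \<alpha> (c * \<tau>) z s))) \<and>
   \<comment> \<open>Part 2\<close>
   (\<forall>C::real. C > 0 \<longrightarrow> (\<exists>c>0. \<forall>\<alpha>::real. 0 < \<alpha> \<and> \<alpha> \<le> 2 \<longrightarrow>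
      (\<exists>K>0. \<forall>\<tau> z s. \<tau> > 0 \<and> 0 < z \<and> z \<le> s / 2 \<longrightarrow>
         p_alpha \<zeta> \<alpha> \<tau> z s \<le> K * (p_alpha \<zeta> \<alpha> \<tau> c (c * s) * ind (\<tau> \<ge> C)
           + ((\<tau> powr (-1/2) * exp (- c * s^2 / \<tau>) / (\<tau> + s^2) powr \<zeta>) * ind (\<alpha> = 2)
              + \<tau> / (s powr (2 * \<zeta> + 1 + \<alpha>) + \<tau> powr ((2 * \<zeta> + 1 + \<alpha>) / \<alpha>))
                * ind (0 < \<alpha> \<and> \<alpha> < 2)) * ind (\<tau> < C))))) \<and>
   (\<exists>c>0. \<forall>\<alpha>::real. 0 < \<alpha> \<and> \<alpha> \<le> 2 \<longrightarrow>
      (\<exists>K>0. \<forall>\<tau> z s. \<tau> > 0 \<and> 0 < z \<and> z \<le> s / 2 \<longrightarrow>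
         p_alpha \<zeta> \<alpha> \<tau> z s \<le> K * ((\<tau> powr (-1/2) * exp (- c * s^2 / \<tau>) / (\<tau> + s^2) powr \<zeta>) * ind (\<alpha> = 2)
              + \<tau> / (s powr (2 * \<zeta> + 1 + \<alpha>) + \<tau> powr ((2 * \<zeta> + 1 + \<alpha>) / \<alpha>))
                * ind (0 < \<alpha> \<and> \<alpha> < 2)))) \<and>
   (\<forall>\<alpha>::real. 0 < \<alpha> \<and> \<alpha> \<le> 2 \<longrightarrow>
      (\<exists>K>0. \<forall>\<tau> z s. \<tau> > 0 \<and> 0 < z \<and> z \<le> s / 2 \<longrightarrow>
         p_alpha \<zeta> \<alpha> \<tau> z s \<le> K * s powr (- (2 * \<zeta> + 1)))) \<and>
   \<comment> \<open>Part 3\<close>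
   (\<forall>C::real. C > 0 \<longrightarrow> (\<exists>c>0. \<forall>\<alpha>::real. 0 < \<alpha> \<and> \<alpha> \<le> 2 \<longrightarrow>
      (\<exists>K>0. \<forall>\<tau> z s. 0 < \<tau> \<and> \<tau> \<le> 1 \<and> 0 < z \<and> z \<le> s / 2 \<and> s \<ge> C \<longrightarrow>
         p_alpha \<zeta> \<alpha> \<tau> z s \<le> K * p_alpha \<zeta> \<alpha> 1 c (c * s)))) \<and>
   \<comment> \<open>Part 4\<close>
   (\<forall>\<alpha>::real. 0 < \<alpha> \<and> \<alpha> \<le> 2 \<longrightarrow> (\<exists>c>0.
      (\<exists>K>0. \<forall>r s. 0 < r \<and> r \<le> s \<longrightarrow>
         p_alpha \<zeta> \<alpha> 1 1 s \<le> K * p_alpha \<zeta> \<alpha> 1 (c * r) (c * s)) \<and>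
      (\<exists>K>0. \<forall>r s. 0 < r \<and> 0 < s \<longrightarrow>
         min (p_alpha \<zeta> \<alpha> 1 1 r) (p_alpha \<zeta> \<alpha> 1 1 s) \<le> K * p_alpha \<zeta> \<alpha> 1 (c * r) (c * s)))) \<and>
   \<comment> \<open>Part 5\<close>
   (\<forall>\<alpha>::real. 0 < \<alpha> \<and> \<alpha> \<le> 2 \<longrightarrow> (\<exists>c>0. \<exists>K>0.
      \<forall>r s z t. 0 < r \<and> 0 < s \<and> 0 < z \<and> 0 < t \<and> \<bar>z - s\<bar> > \<bar>r - s\<bar> / 2 \<longrightarrow>
         p_alpha \<zeta> \<alpha> t z s \<le> K * p_alpha \<zeta> \<alpha> t (c * r) (c * s)))"
proof (intro conjI)
  note \<zeta> = hz
  show "\<forall>C::real. 0 < C \<and> C \<le> 1 \<longrightarrow>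
      (\<exists>c1>0. \<exists>c2>0. \<exists>K>0. \<forall>z s \<tau>. z > 0 \<and> s > 0 \<and> C \<le> \<tau> \<and> \<tau> \<le> 1 / C \<longrightarrow>
          p2 \<zeta> 1 (c1 * z) (c1 * s) \<le> K * p2 \<zeta> \<tau> z s \<and>
          p2 \<zeta> \<tau> z s \<le> K * p2 \<zeta> 1 (c2 * z) (c2 * s)) \<and>
      (\<forall>\<alpha>::real. 0 < \<alpha> \<and> \<alpha> < 2 \<longrightarrow>
         (\<exists>K>0. \<forall>z s \<tau>. z > 0 \<and> s > 0 \<and> C \<le> \<tau> \<and> \<tau> \<le> 1 / C \<longrightarrow>
            p_alpha \<zeta> \<alpha> \<tau> z s \<le> K * p_alpha \<zeta> \<alpha> 1 z s \<and>
            p_alpha \<zeta> \<alpha> 1 z s \<le> K * p_alpha \<zeta> \<alpha> \<tau> z s))"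
  proof (intro allI impI conjI)
    fix C :: real assume "0 < C \<and> C \<le> 1"
    then show "\<exists>c1>0. \<exists>c2>0. \<exists>K>0. \<forall>z s \<tau>. z > 0 \<and> s > 0 \<and> C \<le> \<tau> \<and> \<tau> \<le> 1 / C \<longrightarrow>
          p2 \<zeta> 1 (c1 * z) (c1 * s) \<le> K * p2 \<zeta> \<tau> z s \<and>
          p2 \<zeta> \<tau> z s \<le> K * p2 \<zeta> 1 (c2 * z) (c2 * s)"
      by (intro p2_time_comparable[OF \<zeta>]) auto
  next
    fix C \<alpha> :: real assume C: "0 < C \<and> C \<le> 1" and \<alpha>: "0 < \<alpha> \<and> \<alpha> < 2"
    have M: "1 \<le> 1 / C" using C by simp
    obtain K where K: "0 < K" "\<And>t t' r s. 0 < t \<and> 0 < t' \<and> t \<le> 1 / C * t' \<and> t' \<le> 1 / C * t \<and> 0 < r \<and> 0 < s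
      \<Longrightarrow> p_alpha \<zeta> \<alpha> t r s \<le> K * p_alpha \<zeta> \<alpha> t' r s"
      using p_alpha_time_le[OF \<zeta> _ _ M, of \<alpha>] \<alpha> by blast
    have "p_alpha \<zeta> \<alpha> \<tau> z s \<le> K * p_alpha \<zeta> \<alpha> 1 z s \<and> p_alpha \<zeta> \<alpha> 1 z s \<le> K * p_alpha \<zeta> \<alpha> \<tau> z s"
      if h: "z > 0 \<and> s > 0 \<and> C \<le> \<tau> \<and> \<tau> \<le> 1 / C" for z s \<tau>
    proof -
      have "0 < \<tau>" "1 \<le> 1 / C * \<tau>" using h C by (auto simp: field_simps)
      then show ?thesis using h by (intro conjI K(2)) auto
    qed
    then show "\<exists>K>0. \<forall>z s \<tau>. z > 0 \<and> s > 0 \<and> C \<le> \<tau> \<and> \<tau> \<le> 1 / C \<longrightarrow>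
            p_alpha \<zeta> \<alpha> \<tau> z s \<le> K * p_alpha \<zeta> \<alpha> 1 z s \<and>
            p_alpha \<zeta> \<alpha> 1 z s \<le> K * p_alpha \<zeta> \<alpha> \<tau> z s"
      using K(1) by blast
  qed
  show "\<forall>\<alpha>::real. 0 < \<alpha> \<and> \<alpha> < 2 \<longrightarrow> (\<forall>c::real. c > 0 \<longrightarrow>
      (\<exists>K>0. \<forall>\<tau> z s. \<tau> > 0 \<and> z > 0 \<and> s > 0 \<longrightarrow>
         p_alpha \<zeta> \<alpha> \<tau> (c * z) (c * s) \<le> K * p_alpha \<zeta> \<alpha> \<tau> z s \<and>
         p_alpha \<zeta> \<alpha> \<tau> z s \<le> K * p_alpha \<zeta> \<alpha> \<tau> (c * z) (c * s) \<and>
         p_alpha \<zeta> \<alpha> (c * \<tau>) z s \<le> K * p_alpha \<zeta> \<alpha> \<tau> z s \<and>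
         p_alpha \<zeta> \<alpha> \<tau> z s \<le> K * p_alpha \<zeta> \<alpha> (c * \<tau>) z s))"
    by (intro allI impI p_alpha_time_scale_comparable[OF \<zeta>]) auto
  show "\<forall>C::real. C > 0 \<longrightarrow> (\<exists>c>0. \<forall>\<alpha>::real. 0 < \<alpha> \<and> \<alpha> \<le> 2 \<longrightarrow>
      (\<exists>K>0. \<forall>\<tau> z s. \<tau> > 0 \<and> 0 < z \<and> z \<le> s / 2 \<longrightarrow>
         p_alpha \<zeta> \<alpha> \<tau> z s \<le> K * (p_alpha \<zeta> \<alpha> \<tau> c (c * s) * ind (\<tau> \<ge> C)
           + ((\<tau> powr (-1/2) * exp (- c * s^2 / \<tau>) / (\<tau> + s^2) powr \<zeta>) * ind (\<alpha> = 2)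
              + \<tau> / (s powr (2 * \<zeta> + 1 + \<alpha>) + \<tau> powr ((2 * \<zeta> + 1 + \<alpha>) / \<alpha>))
                * ind (0 < \<alpha> \<and> \<alpha> < 2)) * ind (\<tau> < C))))"
  \<comment> \<open>The witness is fixed before \<alpha> is introduced, as c must not depend on it;
    only K may.\<close>
  proof (rule allI, rule impI, rule exI[of _ "1/32"], intro conjI allI impI)
    fix C \<alpha> :: real assume C: "0 < C" and \<alpha>: "0 < \<alpha> \<and> \<alpha> \<le> 2"
    show "\<exists>K>0. \<forall>\<tau> z s. \<tau> > 0 \<and> 0 < z \<and> z \<le> s / 2 \<longrightarrow>
         p_alpha \<zeta> \<alpha> \<tau> z s \<le> K * (p_alpha \<zeta> \<alpha> \<tau> (1/32) (1/32 * s) * ind (\<tau> \<ge> C)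
           + ((\<tau> powr (-1/2) * exp (- (1/32) * s^2 / \<tau>) / (\<tau> + s^2) powr \<zeta>) * ind (\<alpha> = 2)
              + \<tau> / (s powr (2 * \<zeta> + 1 + \<alpha>) + \<tau> powr ((2 * \<zeta> + 1 + \<alpha>) / \<alpha>))
                * ind (0 < \<alpha> \<and> \<alpha> < 2)) * ind (\<tau> < C))"
      using C \<alpha> by (intro p_alpha_far_late_or_profile_le[OF \<zeta>]) auto
  qed simp
  show "\<exists>c>0. \<forall>\<alpha>::real. 0 < \<alpha> \<and> \<alpha> \<le> 2 \<longrightarrow>
      (\<exists>K>0. \<forall>\<tau> z s. \<tau> > 0 \<and> 0 < z \<and> z \<le> s / 2 \<longrightarrow>
         p_alpha \<zeta> \<alpha> \<tau> z s \<le> K * ((\<tau> powr (-1/2) * exp (- c * s^2 / \<tau>) / (\<tau> + s^2) powr \<zeta>) * ind (\<alpha> = 2)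
              + \<tau> / (s powr (2 * \<zeta> + 1 + \<alpha>) + \<tau> powr ((2 * \<zeta> + 1 + \<alpha>) / \<alpha>))
                * ind (0 < \<alpha> \<and> \<alpha> < 2)))"
  proof (rule exI[of _ "1/32"], intro conjI allI impI)
    fix \<alpha> :: real assume "0 < \<alpha> \<and> \<alpha> \<le> 2"
    then show "\<exists>K>0. \<forall>\<tau> z s. \<tau> > 0 \<and> 0 < z \<and> z \<le> s / 2 \<longrightarrow>
         p_alpha \<zeta> \<alpha> \<tau> z s \<le> K * ((\<tau> powr (-1/2) * exp (- (1/32) * s^2 / \<tau>) / (\<tau> + s^2) powr \<zeta>) * ind (\<alpha> = 2)
              + \<tau> / (s powr (2 * \<zeta> + 1 + \<alpha>) + \<tau> powr ((2 * \<zeta> + 1 + \<alpha>) / \<alpha>))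
                * ind (0 < \<alpha> \<and> \<alpha> < 2))"
      by (intro p_alpha_far_le_profile[OF \<zeta>]) auto
  qed simp
  show "\<forall>\<alpha>::real. 0 < \<alpha> \<and> \<alpha> \<le> 2 \<longrightarrow>
      (\<exists>K>0. \<forall>\<tau> z s. \<tau> > 0 \<and> 0 < z \<and> z \<le> s / 2 \<longrightarrow>
         p_alpha \<zeta> \<alpha> \<tau> z s \<le> K * s powr (- (2 * \<zeta> + 1)))"
    by (intro allI impI p_alpha_far_le_powr[OF \<zeta>]) auto
  show "\<forall>C::real. C > 0 \<longrightarrow> (\<exists>c>0. \<forall>\<alpha>::real. 0 < \<alpha> \<and> \<alpha> \<le> 2 \<longrightarrow>
      (\<exists>K>0. \<forall>\<tau> z s. 0 < \<tau> \<and> \<tau> \<le> 1 \<and> 0 < z \<and> z \<le> s / 2 \<and> s \<ge> C \<longrightarrow>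
         p_alpha \<zeta> \<alpha> \<tau> z s \<le> K * p_alpha \<zeta> \<alpha> 1 c (c * s)))"
  proof (rule allI, rule impI, rule exI[of _ "1/32"], intro conjI allI impI)
    fix C \<alpha> :: real assume "0 < C" and "0 < \<alpha> \<and> \<alpha> \<le> 2"
    then show "\<exists>K>0. \<forall>\<tau> z s. 0 < \<tau> \<and> \<tau> \<le> 1 \<and> 0 < z \<and> z \<le> s / 2 \<and> s \<ge> C \<longrightarrow>
         p_alpha \<zeta> \<alpha> \<tau> z s \<le> K * p_alpha \<zeta> \<alpha> 1 (1/32) (1/32 * s)"
      by (intro p_alpha_far_early_le[OF \<zeta>]) auto
  qed simp
  show "\<forall>\<alpha>::real. 0 < \<alpha> \<and> \<alpha> \<le> 2 \<longrightarrow> (\<exists>c>0.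
      (\<exists>K>0. \<forall>r s. 0 < r \<and> r \<le> s \<longrightarrow>
         p_alpha \<zeta> \<alpha> 1 1 s \<le> K * p_alpha \<zeta> \<alpha> 1 (c * r) (c * s)) \<and>
      (\<exists>K>0. \<forall>r s. 0 < r \<and> 0 < s \<longrightarrow>
         min (p_alpha \<zeta> \<alpha> 1 1 r) (p_alpha \<zeta> \<alpha> 1 1 s) \<le> K * p_alpha \<zeta> \<alpha> 1 (c * r) (c * s)))"
  proof (rule allI, rule impI, rule exI[of _ "1/2"], intro conjI)
    fix \<alpha> :: real assume \<alpha>: "0 < \<alpha> \<and> \<alpha> \<le> 2"
    show "\<exists>K>0. \<forall>r s. 0 < r \<and> r \<le> s \<longrightarrow> p_alpha \<zeta> \<alpha> 1 1 s \<le> K * p_alpha \<zeta> \<alpha> 1 (1/2 * r) (1/2 * s)"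
      using \<alpha> by (intro p_alpha_1_1_le \<zeta>) auto
    show "\<exists>K>0. \<forall>r s. 0 < r \<and> 0 < s \<longrightarrow>
      min (p_alpha \<zeta> \<alpha> 1 1 r) (p_alpha \<zeta> \<alpha> 1 1 s) \<le> K * p_alpha \<zeta> \<alpha> 1 (1/2 * r) (1/2 * s)"
      using \<alpha> by (intro p_alpha_min_le \<zeta>) auto
  qed simp
  show "\<forall>\<alpha>::real. 0 < \<alpha> \<and> \<alpha> \<le> 2 \<longrightarrow> (\<exists>c>0. \<exists>K>0.
      \<forall>r s z t. 0 < r \<and> 0 < s \<and> 0 < z \<and> 0 < t \<and> \<bar>z - s\<bar> > \<bar>r - s\<bar> / 2 \<longrightarrow>
         p_alpha \<zeta> \<alpha> t z s \<le> K * p_alpha \<zeta> \<alpha> t (c * r) (c * s))"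
  proof (rule allI, rule impI, rule exI[of _ "1/4"], intro conjI)
    fix \<alpha> :: real assume \<alpha>: "0 < \<alpha> \<and> \<alpha> \<le> 2"
    show "\<exists>K>0. \<forall>r s z t. 0 < r \<and> 0 < s \<and> 0 < z \<and> 0 < t \<and> \<bar>z - s\<bar> > \<bar>r - s\<bar> / 2 \<longrightarrow>
      p_alpha \<zeta> \<alpha> t z s \<le> K * p_alpha \<zeta> \<alpha> t (1/4 * r) (1/4 * s)"
      using \<alpha> by (intro p_alpha_separated_le \<zeta>) auto
  qed simp
qed

end
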